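(* Let $X=(X^+,X^-)$ be a piecewise analytic vector field with switching curve $\Sigma=f^{-1}(0)$. If $X$ has a $\Sigma$-monodromic singular point $p_0$ and satisfies Hypothesis H (the property defined in the context), then $p_0$ is free of limit cycles, i.e. there is a neighborhood of $p_0$ containing no crossing limit cycles of $X$.
   Context: Setting. $f:\mathbb R^2\to\mathbb R$ is an analytic function having $0$ as a regular value, $\Sigma=f^{-1}(0)$, $\Sigma^{\pm}=\{p\in\mathbb R^2:\pm f(p)>0\}$. A piecewise analytic vector field $X=(X^+,X^-)$ is a pair of analytic planar vector fields, with $X=X^+$ where $f\ge 0$ and $X=X^-$ where $f\le 0$. For a vector field $Y$, $Yf=\langle\nabla f,Y\rangle$. $\Sigma$-singular points. On $\Sigma$: $SW$ (sewing) is where $X^+f\cdot X^-f>0$; $ES$ is where $X^+f>0$, $X^-f<0$; $SL$ is where $X^+f<0$, $X^-f>0$. On $ES\cup SL$ the Filippov vector field $F_X(p)$ is the vector tangent to $\Sigma$ in the cone spanned by $X^+(p)$ and $X^-(p)$ (their convex combination tangent to $\Sigma$). A point $p\in\Sigma$ is $\Sigma$-regular if $p\in SW$, or if $p\in SL\cup ES$ and $F_X(p)\neq 0$; otherwise it is $\Sigma$-singular. $\Sigma$-monodromy. An isolated $\Sigma$-singular point $p$ has a $\Sigma$-characteristic orbit if one of the following holds: (1) there is a regular trajectory $\gamma$ of $X^+$ (resp. $X^-$) with $p=\gamma(t_0)$ for some $t_0$ and $p\in\overline{\gamma\cap\Sigma^+}$ (resp. $p\in\overline{\gamma\cap\Sigma^-}$);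 (2) there is a regular trajectory $\gamma$ of $X^+$ (resp. $X^-$) tending to $p$ as $t\to\infty$ or $t\to-\infty$ and a neighborhood $V$ of $p$ with $\gamma\cap V\subset V\cap\Sigma^+$ (resp. $\gamma\cap V\subset V\cap\Sigma^-$); (3) for every neighborhood $V$ of $p$ there is $q\in V\cap\Sigma$ with $X^+f(q)\cdot X^-f(q)<0$. An isolated $\Sigma$-singular point without $\Sigma$-characteristic orbits is a $\Sigma$-monodromic singular point. Closed orbits. A $\Sigma$-closed crossing orbit is a continuous closed curve $\gamma$ consisting of two regular trajectories, one of $X^+$ and one of $X^-$, and two points $\{p_1,p_2\}=\Sigma\cap\gamma$ that are sewing points at which $\gamma$ meets $\Sigma$ transversally. A crossing limit cycle is a $\Sigma$-closed crossing orbit isolated among the $\Sigma$-closed crossing orbits. Hypothesis H. $X$ has an isolated $\Sigma$-monodromic singular point $p_0\in\Sigma$; without loss of generality $p_0$ is the origin and the orbits of $X$ turn around it counterclockwise. $X$ satisfies Hypothesis H if: (i) there is a continuous change of coordinates such that in the new coordinates $\Sigma$ is $\{y=0\}$; and (ii) there are positive integers $p,q,r,s$ such that in the weighted polar coordinates $(x,y)=(\rho^p\cos\theta,\rho^r\sin\theta)$ in $\Sigma\cup\Sigma^+$ and $(x,y)=(\rho^q\cos\theta,\rho^s\sin\theta)$ in $\Sigma\cup\Sigma^-$ the systems associated with $X^+$ and $X^-$ are equivalent to the differential equations $\dfrac{d\rho}{d\theta}=\dfrac{F^{\pm}(\theta,\rho)}{G^{\pm}(\theta,\rho)}$ respectively,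 where $F^\pm,G^\pm$ are analytic functions with $F^\pm(\theta,0)=0$ for all $\theta\in\mathbb R$, $G^+(\theta,0)\ne0$ for all $\theta\in[0,\pi]$ and $G^-(\theta,0)\neq0$ for all $\theta\in[-\pi,0]$. *)

theory Defs
  imports "HOL-Analysis.Analysis"
begin

type_synonym plane = "real \<times> real"

subsection \<open>Real analytic functions of two variables\<close>

text \<open>As for the library's \<open>analytic_on\<close>, analyticity on a set \<open>S\<close> means analyticity in a
  neighbourhood of every point of \<open>S\<close>.\<close>

definition real_analytic_on :: "(plane \<Rightarrow> real) \<Rightarrow> plane set \<Rightarrow> bool" where
  "real_analytic_on f S \<longleftrightarrow>
     (\<forall>(x0, y0) \<in> S. \<exists>r > 0. \<exists>c :: nat \<times> nat \<Rightarrow> real. \<forall>x y. \<bar>x - x0\<bar> < r \<longrightarrow> \<bar>y - y0\<bar> < r \<longrightarrow>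
        ((\<lambda>(i, j). c (i, j) * (x - x0) ^ i * (y - y0) ^ j) has_sum f (x, y)) UNIV)"

definition analytic_vector_field :: "(plane \<Rightarrow> plane) \<Rightarrow> bool" where
  "analytic_vector_field Y \<longleftrightarrow>
     real_analytic_on (\<lambda>z. fst (Y z)) UNIV \<and> real_analytic_on (\<lambda>z. snd (Y z)) UNIV"

subsection \<open>Piecewise analytic vector fields\<close>

text \<open>A piecewise vector field with switching function \<open>f\<close> is given by its two components
  \<open>Xp\<close> (acting where \<open>f \<ge> 0\<close>) and \<open>Xm\<close> (acting where \<open>f \<le> 0\<close>).\<close>

definition gradient :: "(plane \<Rightarrow> real) \<Rightarrow> plane \<Rightarrow> plane" where
  "gradient f z = (SOME v. GDERIV f z :> v)"

definition zero_regular_value :: "(plane \<Rightarrow> real) \<Rightarrow> bool" where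
  "zero_regular_value f \<longleftrightarrow> (\<forall>z. f z = 0 \<longrightarrow> gradient f z \<noteq> 0)"

definition switching :: "(plane \<Rightarrow> real) \<Rightarrow> plane set" where
  "switching f = {z. f z = 0}"

definition pos_side :: "(plane \<Rightarrow> real) \<Rightarrow> plane set" where
  "pos_side f = {z. f z > 0}"

definition neg_side :: "(plane \<Rightarrow> real) \<Rightarrow> plane set" where
  "neg_side f = {z. f z < 0}"

definition lie :: "(plane \<Rightarrow> plane) \<Rightarrow> (plane \<Rightarrow> real) \<Rightarrow> plane \<Rightarrow> real" where
  "lie Y f z = gradient f z \<bullet> Y z"

definition sewing :: "(plane \<Rightarrow> real) \<Rightarrow> (plane \<Rightarrow> plane) \<Rightarrow> (plane \<Rightarrow> plane) \<Rightarrow> plane set" where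
  "sewing f Xp Xm = {z \<in> switching f. lie Xp f z * lie Xm f z > 0}"

definition escaping :: "(plane \<Rightarrow> real) \<Rightarrow> (plane \<Rightarrow> plane) \<Rightarrow> (plane \<Rightarrow> plane) \<Rightarrow> plane set" where
  "escaping f Xp Xm = {z \<in> switching f. lie Xp f z > 0 \<and> lie Xm f z < 0}"

definition sliding :: "(plane \<Rightarrow> real) \<Rightarrow> (plane \<Rightarrow> plane) \<Rightarrow> (plane \<Rightarrow> plane) \<Rightarrow> plane set" where
  "sliding f Xp Xm = {z \<in> switching f. lie Xp f z < 0 \<and> lie Xm f z > 0}"

text \<open>The convex combination of \<open>Xp z\<close> and \<open>Xm z\<close> that is tangent to the switching curve.  It is
  unique on the escaping and sliding sets, and only used there.\<close>

definition filippov :: "(plane \<Rightarrow> real) \<Rightarrow> (plane \<Rightarrow> plane) \<Rightarrow> (plane \<Rightarrow> plane) \<Rightarrow> plane \<Rightarrow> plane" where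
  "filippov f Xp Xm z = (THE v. v \<in> closed_segment (Xm z) (Xp z) \<and> gradient f z \<bullet> v = 0)"

definition sigma_regular :: "(plane \<Rightarrow> real) \<Rightarrow> (plane \<Rightarrow> plane) \<Rightarrow> (plane \<Rightarrow> plane) \<Rightarrow> plane \<Rightarrow> bool" where
  "sigma_regular f Xp Xm z \<longleftrightarrow>
     z \<in> sewing f Xp Xm \<or> z \<in> sliding f Xp Xm \<union> escaping f Xp Xm \<and> filippov f Xp Xm z \<noteq> 0"

definition sigma_singular :: "(plane \<Rightarrow> real) \<Rightarrow> (plane \<Rightarrow> plane) \<Rightarrow> (plane \<Rightarrow> plane) \<Rightarrow> plane \<Rightarrow> bool" where
  "sigma_singular f Xp Xm z \<longleftrightarrow> z \<in> switching f \<and> \<not> sigma_regular f Xp Xm z"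

definition isolated_sigma_singular ::
    "(plane \<Rightarrow> real) \<Rightarrow> (plane \<Rightarrow> plane) \<Rightarrow> (plane \<Rightarrow> plane) \<Rightarrow> plane \<Rightarrow> bool" where
  "isolated_sigma_singular f Xp Xm z \<longleftrightarrow>
     sigma_singular f Xp Xm z \<and>
     (\<exists>V. open V \<and> z \<in> V \<and> (\<forall>w \<in> V. sigma_singular f Xp Xm w \<longrightarrow> w = z))"

subsection \<open>Monodromic singular points\<close>

text \<open>Trajectories are integral curves on some time interval, not necessarily maximal ones;
  regular ones avoid the equilibria.\<close>

definition regular_trajectory :: "(plane \<Rightarrow> plane) \<Rightarrow> real set \<Rightarrow> (real \<Rightarrow> plane) \<Rightarrow> bool" where
  "regular_trajectory Y I \<gamma> \<longleftrightarrow>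
     is_interval I \<and>
     (\<forall>t \<in> I. (\<gamma> has_vector_derivative Y (\<gamma> t)) (at t within I) \<and> Y (\<gamma> t) \<noteq> 0)"

definition touches_through :: "(plane \<Rightarrow> plane) \<Rightarrow> plane set \<Rightarrow> plane \<Rightarrow> bool" where
  "touches_through Y S z \<longleftrightarrow>
     (\<exists>I \<gamma> t0. open I \<and> regular_trajectory Y I \<gamma> \<and> t0 \<in> I \<and> z = \<gamma> t0 \<and> z \<in> closure (\<gamma> ` I \<inter> S))"

definition tends_through :: "(plane \<Rightarrow> plane) \<Rightarrow> plane set \<Rightarrow> plane \<Rightarrow> bool" where
  "tends_through Y S z \<longleftrightarrow>
     (\<exists>I \<gamma> V. regular_trajectory Y I \<gamma> \<and> open V \<and> z \<in> V \<and> \<gamma> ` I \<inter> V \<subseteq> V \<inter> S \<and>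
        ((\<exists>a. I = {a<..}) \<and> (\<gamma> \<longlongrightarrow> z) at_top \<or>
         (\<exists>a. I = {..<a}) \<and> (\<gamma> \<longlongrightarrow> z) at_bot))"

definition has_characteristic_orbit ::
    "(plane \<Rightarrow> real) \<Rightarrow> (plane \<Rightarrow> plane) \<Rightarrow> (plane \<Rightarrow> plane) \<Rightarrow> plane \<Rightarrow> bool" where
  "has_characteristic_orbit f Xp Xm z \<longleftrightarrow>
     (touches_through Xp (pos_side f) z \<or> touches_through Xm (neg_side f) z) \<or>
     (tends_through Xp (pos_side f) z \<or> tends_through Xm (neg_side f) z) \<or>
     (\<forall>V. open V \<and> z \<in> V \<longrightarrow> (\<exists>w \<in> V \<inter> switching f. lie Xp f w * lie Xm f w < 0))"

definition sigma_monodromic ::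
    "(plane \<Rightarrow> real) \<Rightarrow> (plane \<Rightarrow> plane) \<Rightarrow> (plane \<Rightarrow> plane) \<Rightarrow> plane \<Rightarrow> bool" where
  "sigma_monodromic f Xp Xm z \<longleftrightarrow>
     isolated_sigma_singular f Xp Xm z \<and> \<not> has_characteristic_orbit f Xp Xm z"

subsection \<open>Crossing limit cycles\<close>

text \<open>Closed orbits are represented by their images.  The matching of start and end points of the
  two arcs expresses that the flow directions agree, which the sewing condition forces anyway;
  that condition makes both \<open>lie Xp f\<close> and \<open>lie Xm f\<close> nonzero at \<open>p1\<close> and \<open>p2\<close>, i.e. the
  intersections are transversal.\<close>

definition closed_crossing_orbit ::
    "(plane \<Rightarrow> real) \<Rightarrow> (plane \<Rightarrow> plane) \<Rightarrow> (plane \<Rightarrow> plane) \<Rightarrow> plane set \<Rightarrow> bool" where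
  "closed_crossing_orbit f Xp Xm C \<longleftrightarrow>
     (\<exists>p1 p2 a b \<gamma>p c d \<gamma>m.
        p1 \<noteq> p2 \<and> {p1, p2} \<subseteq> sewing f Xp Xm \<and>
        a < b \<and> regular_trajectory Xp {a..b} \<gamma>p \<and> \<gamma>p a = p1 \<and> \<gamma>p b = p2 \<and>
        \<gamma>p ` {a<..<b} \<subseteq> pos_side f \<and>
        c < d \<and> regular_trajectory Xm {c..d} \<gamma>m \<and> \<gamma>m c = p2 \<and> \<gamma>m d = p1 \<and>
        \<gamma>m ` {c<..<d} \<subseteq> neg_side f \<and>
        C = \<gamma>p ` {a..b} \<union> \<gamma>m ` {c..d})"

definition crossing_limit_cycle ::
    "(plane \<Rightarrow> real) \<Rightarrow> (plane \<Rightarrow> plane) \<Rightarrow> (plane \<Rightarrow> plane) \<Rightarrow> plane set \<Rightarrow> bool" where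
  "crossing_limit_cycle f Xp Xm C \<longleftrightarrow>
     closed_crossing_orbit f Xp Xm C \<and>
     (\<exists>W. open W \<and> C \<subseteq> W \<and> (\<forall>C'. closed_crossing_orbit f Xp Xm C' \<and> C' \<subseteq> W \<longrightarrow> C' = C))"

subsection \<open>Hypothesis H\<close>

definition weighted_polar :: "nat \<Rightarrow> nat \<Rightarrow> plane \<Rightarrow> plane" where
  "weighted_polar k l = (\<lambda>(\<theta>, \<rho>). (\<rho> ^ k * cos \<theta>, \<rho> ^ l * sin \<theta>))"

definition orbit_arc :: "(plane \<Rightarrow> plane) \<Rightarrow> plane set \<Rightarrow> bool" where
  "orbit_arc Y S \<longleftrightarrow> (\<exists>a b \<gamma>. a < b \<and> regular_trajectory Y {a..b} \<gamma> \<and> S = \<gamma> ` {a..b})"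

definition solution_arc :: "(real \<Rightarrow> real \<Rightarrow> real) \<Rightarrow> plane set \<Rightarrow> bool" where
  "solution_arc R S \<longleftrightarrow>
     (\<exists>\<alpha> \<beta> \<sigma>. \<alpha> < \<beta> \<and>
        (\<forall>\<theta> \<in> {\<alpha>..\<beta>}. (\<sigma> has_real_derivative R \<theta> (\<sigma> \<theta>)) (at \<theta> within {\<alpha>..\<beta>})) \<and>
        S = (\<lambda>\<theta>. (\<theta>, \<sigma> \<theta>)) ` {\<alpha>..\<beta>})"

text \<open>Since the change of coordinates is only continuous, the vector field cannot be pushed forward
  along it.  Equivalence of \<open>Y\<close> with the equation \<open>d\<rho>/d\<theta> = F/G\<close> therefore means that, for
  small \<open>\<rho> > 0\<close> and angles in the sector \<open>\<Theta>\<close>, the coordinates carry the orbit arcs of \<open>Y\<close> exactly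
  to the graphs of the solutions.  Here \<open>g\<close> maps the new Cartesian coordinates, defined on \<open>V\<close>, back
  to the original plane.  The functions \<open>F\<close> and \<open>G\<close> are analytic near the line \<open>\<rho> = 0\<close>; as \<open>G\<close>
  has no zero on the compact set \<open>\<Theta> \<times> {0}\<close>, the quotient is defined for small \<open>\<rho>\<close>.\<close>

definition polar_equivalent ::
    "(plane \<Rightarrow> plane) \<Rightarrow> (plane \<Rightarrow> plane) \<Rightarrow> plane set \<Rightarrow> real set \<Rightarrow> nat \<Rightarrow> nat \<Rightarrow> bool" where
  "polar_equivalent Y g V \<Theta> k l \<longleftrightarrow>
     (\<exists>F G. real_analytic_on (\<lambda>(\<theta>, \<rho>). F \<theta> \<rho>) (UNIV \<times> {0}) \<and>
            real_analytic_on (\<lambda>(\<theta>, \<rho>). G \<theta> \<rho>) (UNIV \<times> {0}) \<and>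
            (\<forall>\<theta>. F \<theta> 0 = 0) \<and> (\<forall>\<theta> \<in> \<Theta>. G \<theta> 0 \<noteq> 0) \<and>
            (\<exists>\<epsilon> > 0.
               weighted_polar k l ` (\<Theta> \<times> {0<..<\<epsilon>}) \<subseteq> V \<and>
               (\<forall>\<theta> \<in> \<Theta>. \<forall>\<rho> \<in> {0<..<\<epsilon>}. G \<theta> \<rho> \<noteq> 0) \<and>
               (\<forall>S \<subseteq> \<Theta> \<times> {0<..<\<epsilon>}.
                  solution_arc (\<lambda>\<theta> \<rho>. F \<theta> \<rho> / G \<theta> \<rho>) S \<longleftrightarrow>
                  orbit_arc Y (g ` weighted_polar k l ` S))))"

text \<open>The change of coordinates \<open>h\<close> is a homeomorphism between neighbourhoods of \<open>p0\<close> and of the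
  origin; it takes the switching curve to the horizontal axis and the two sides of the curve to
  the upper and lower half-planes.  No orientation is imposed: composing \<open>h\<close> with the reflection
  \<open>(x, y) \<mapsto> (-x, y)\<close>, which turns \<open>\<theta>\<close> into \<open>\<pi> - \<theta>\<close> or \<open>-\<pi> - \<theta>\<close>, makes the orbits turn counterclockwise.\<close>

definition hypothesis_H ::
    "(plane \<Rightarrow> real) \<Rightarrow> (plane \<Rightarrow> plane) \<Rightarrow> (plane \<Rightarrow> plane) \<Rightarrow> plane \<Rightarrow> bool" where
  "hypothesis_H f Xp Xm p0 \<longleftrightarrow>
     (\<exists>U V h g. open U \<and> p0 \<in> U \<and> open V \<and> homeomorphism U V h g \<and> h p0 = (0, 0) \<and>
        (\<forall>z \<in> U. sgn (snd (h z)) = sgn (f z)) \<and>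
        (\<exists>p q r s. p > 0 \<and> q > 0 \<and> r > 0 \<and> s > 0 \<and>
           polar_equivalent Xp g V {0..pi} p r \<and>
           polar_equivalent Xm g V {-pi..0} q s))"

end

theory Submission
  imports Defs "HOL-Complex_Analysis.Complex_Analysis"
begin

text \<open>
  In the weighted polar coordinates of Hypothesis H a trajectory arc close to \<open>p0\<close> that joins two points
  of the switching curve is the graph of a solution of \<open>d\<rho>/d\<theta> = F/G\<close> over \<open>[0, \<pi>]\<close> (or \<open>[-\<pi>, 0]\<close>,
  which the reflection \<open>\<theta> \<mapsto> -\<theta>\<close> reduces to the former).  Since \<open>F/G\<close> is analytic near \<open>\<rho> = 0\<close>, it extends
  to complex \<open>\<rho>\<close>, and Picard iteration shows that the half-return maps \<open>P\<close> and \<open>Q\<close>, both started on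
  the ray \<open>\<theta> = 0\<close>, are holomorphic near \<open>0\<close>.  The closed crossing orbits near \<open>p0\<close> correspond to the small
  positive zeros of the holomorphic function \<open>D u = P (u ^ q) ^ p - Q (u ^ p) ^ q\<close>.  Either these
  zeros do not accumulate at \<open>0\<close>, and there are no closed crossing orbits near \<open>p0\<close>, or \<open>D\<close> vanishes identically,
  and every closed crossing orbit near \<open>p0\<close> is a limit of others.
\<close>

subsection \<open>Holomorphic dependence of solutions on the initial value\<close>

text \<open>The obstacle is that the chart \<open>h\<close> is merely continuous and Hypothesis H
  identifies orbit arcs with solution graphs as point sets: neither orientation nor time is
  transported. Which points of an arc are its ends is recovered from the nonvanishing velocity of
  trajectories, and the direction of travel from the signs of the Lie derivatives at sewing points.
  Both half-return maps start on the same ray and are compared where they end, so neither has to be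
  inverted. In the chart, the first coordinate of a crossing point on that ray is the
  \<open>p\<close>-th power of the upper and the \<open>q\<close>-th power of the lower radius;
  taking these radii to be \<open>u ^ q\<close> and \<open>u ^ p\<close> makes the starting points
  agree without fractional powers, so the comparison is holomorphic at the singular point itself.
  Analyticity for \<open>u > 0\<close> alone would allow infinitely many cycles shrinking to the
  point. A limit cycle is refuted through its isolating open set \<open>W\<close>, hence every arc
  has to be perturbed inside an arbitrary open set that contains it.\<close>

lemma continuous_on_fst_section:
  assumes "continuous_on (K \<times> U) (\<lambda>(s, z). H s z)" "z \<in> U"
  shows "continuous_on K (\<lambda>s. H s z)"
proof -
  have "continuous_on K (\<lambda>s. case (s, z) of (s, z) \<Rightarrow> H s z)"
    by (rule continuous_on_compose2[OF assms(1)]) (use assms(2) in \<open>auto intro!: continuous_intros\<close>)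
  then show ?thesis by simp
qed

text \<open>Cauchy's inequality on a small circle bounds the derivative of \<open>H s - H s0\<close>
  by the size of this difference on the circle, which uniform continuity on a compact set makes
  small. What remains is the continuity of the single function \<open>deriv (H s0)\<close>.\<close>

lemma continuous_on_deriv_param:
  fixes H :: "'a::metric_space \<Rightarrow> complex \<Rightarrow> complex"
  assumes cont: "continuous_on (K \<times> U) (\<lambda>(s, z). H s z)" and "compact K" "open U"
    and hol: "\<And>s. s \<in> K \<Longrightarrow> H s holomorphic_on U"
  shows "continuous_on (K \<times> U) (\<lambda>(s, z). deriv (H s) z)"
  unfolding continuous_on_iff
proof (intro ballI allI impI)
  fix x0 and e :: real
  assume "x0 \<in> K \<times> U" and e: "e > 0"
  then obtain s0 z0 where x0: "x0 = (s0, z0)" and s0: "s0 \<in> K" and z0: "z0 \<in> U" by auto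
  obtain r where r: "r > 0" "cball z0 r \<subseteq> U"
    using \<open>open U\<close> z0 open_contains_cball_eq by blast
  \<comment> \<open>Half the radius: a circle of radius \<open>q\<close> about any point within
    \<open>q\<close> of \<open>z0\<close> stays in \<open>cball z0 r\<close>.\<close>
  define q where "q = r / 2"
  have q: "q > 0" using r by (simp add: q_def)
  have "uniformly_continuous_on (K \<times> cball z0 r) (\<lambda>(s, z). H s z)"
    by (intro compact_uniformly_continuous compact_Times \<open>compact K\<close> compact_cball
        continuous_on_subset[OF cont]) (use r in auto)
  \<comment> \<open>The factor \<open>q\<close> in the tolerance cancels the division by the radius
    in Cauchy's inequality.\<close>
  then obtain d where d: "d > 0"
    "\<And>s z s' z'. s \<in> K \<Longrightarrow> z \<in> cball z0 r \<Longrightarrow> s' \<in> K \<Longrightarrow> z' \<in> cball z0 r \<Longrightarrow>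
       dist (s', z') (s, z) < d \<Longrightarrow> dist (H s' z') (H s z) < e / 2 * q"
    unfolding uniformly_continuous_on_def using mult_pos_pos[OF half_gt_zero[OF e] q] by fastforce
  have "deriv (H s0) holomorphic_on U"
    by (intro holomorphic_deriv hol s0 \<open>open U\<close>)
  then have "continuous_on U (deriv (H s0))"
    by (rule holomorphic_on_imp_continuous_on)
  then obtain d' where d': "d' > 0"
    "\<And>z. z \<in> U \<Longrightarrow> dist z z0 < d' \<Longrightarrow> dist (deriv (H s0) z) (deriv (H s0) z0) < e / 2"
    unfolding continuous_on_iff using z0 e by (meson half_gt_zero)
  have "dist (deriv (H s) z) (deriv (H s0) z0) < e"
    if s: "s \<in> K" and z: "z \<in> U" and dd: "dist (s, z) (s0, z0) < min (min d d') q" for s z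
  proof -
    have ds: "dist s s0 < d" and dz: "dist z z0 < d'" "dist z z0 < q"
      using dd dist_fst_le[of "(s, z)" "(s0, z0)"] dist_snd_le[of "(s, z)" "(s0, z0)"] by auto
    have sub: "cball z q \<subseteq> cball z0 r"
    proof
      fix w assume "w \<in> cball z q"
      then show "w \<in> cball z0 r"
        using dz(2) dist_triangle[of z0 w z] by (simp add: q_def dist_commute)
    qed
    have h: "H s holomorphic_on U" "H s0 holomorphic_on U" using hol s s0 by auto
    have "norm ((deriv ^^ 1) (\<lambda>w. H s w - H s0 w) z) \<le> fact 1 * (e / 2 * q) / q ^ 1"
    proof (rule Cauchy_inequality)
      show "(\<lambda>w. H s w - H s0 w) holomorphic_on ball z q"
        by (rule holomorphic_on_subset[OF holomorphic_on_diff[OF h]])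
          (use sub r ball_subset_cball in blast)
      show "continuous_on (cball z q) (\<lambda>w. H s w - H s0 w)"
        by (intro holomorphic_on_imp_continuous_on holomorphic_on_subset[OF holomorphic_on_diff[OF h]])
          (use sub r in blast)
      show "norm (H s x - H s0 x) \<le> e / 2 * q" if "norm (z - x) = q" for x
      proof -
        have "x \<in> cball z0 r" using sub that by (auto simp: dist_norm)
        then have "dist (H s x) (H s0 x) < e / 2 * q"
          using d(2)[of s0 x s x] s s0 ds by (simp add: dist_Pair_Pair)
        then show ?thesis by (simp add: dist_norm)
      qed
    qed (use q in auto)
    moreover have "deriv (\<lambda>w. H s w - H s0 w) z = deriv (H s) z - deriv (H s0) z"
      using h z \<open>open U\<close> by (intro deriv_diff) (auto simp: holomorphic_on_open field_differentiable_def)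
    ultimately have "norm (deriv (H s) z - deriv (H s0) z) \<le> e / 2"
      using q by simp
    then show ?thesis
      using d'(2)[OF z dz(1)] dist_triangle[of "deriv (H s) z" "deriv (H s0) z0" "deriv (H s0) z"]
      by (simp add: dist_norm)
  qed
  then show "\<exists>d>0. \<forall>x'\<in>K \<times> U. dist x' x0 < d \<longrightarrow>
      dist (case x' of (s, z) \<Rightarrow> deriv (H s) z) (case x0 of (s, z) \<Rightarrow> deriv (H s) z) < e"
    unfolding x0 using d(1) d'(1) q by (intro exI[of _ "min (min d d') q"]) auto
qed

text \<open>Differentiation under the integral sign. The joint continuity of the derivative that the
  Leibniz rule asks for comes from the Cauchy estimate above. This is what keeps every Picard
  iterate holomorphic in the initial value.\<close>

lemma holomorphic_on_integral_param:
  fixes H :: "real \<Rightarrow> complex \<Rightarrow> complex"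
  assumes cont: "continuous_on ({a..b} \<times> U) (\<lambda>(s, z). H s z)" and "open U" "convex U"
    and hol: "\<And>s. s \<in> {a..b} \<Longrightarrow> H s holomorphic_on U"
  shows "(\<lambda>z. integral {a..b} (\<lambda>s. H s z)) holomorphic_on U"
  unfolding box_real(2)[symmetric]
proof (rule leibniz_rule_holomorphic[where fx = "\<lambda>z s. deriv (H s) z"])
  have swap: "continuous_on (U \<times> {a..b}) prod.swap"
    by (intro continuous_on_swap)
  show "((\<lambda>z. H s z) has_field_derivative deriv (H s) z) (at z within U)"
    if "z \<in> U" "s \<in> cbox a b" for z s
    using hol that \<open>open U\<close> holomorphic_derivI by (metis box_real(2))
  have "continuous_on {a..b} (\<lambda>s. H s z)" if "z \<in> U" for z
    by (rule continuous_on_fst_section[OF cont that])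
  then show "(\<lambda>s. H s z) integrable_on cbox a b" if "z \<in> U" for z
    using that integrable_continuous_interval by auto
  have "continuous_on ({a..b} \<times> U) (\<lambda>(s, z). deriv (H s) z)"
    by (rule continuous_on_deriv_param) (use assms in auto)
  from continuous_on_compose2[OF this swap]
  show "continuous_on (U \<times> cbox a b) (\<lambda>(z, s). deriv (H s) z)"
    by (force simp: case_prod_unfold)
qed (fact \<open>convex U\<close>)

text \<open>Rescaling to the unit interval turns the moving endpoint into a parameter.\<close>

lemma continuous_on_integral_upper_param:
  fixes H :: "real \<Rightarrow> 'a::metric_space \<Rightarrow> complex"
  assumes cont: "continuous_on ({0..T} \<times> U) (\<lambda>(s, z). H s z)"
  shows "continuous_on ({0..T} \<times> U) (\<lambda>(t, z). integral {0..t} (\<lambda>s. H s z))"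
proof -
  have "continuous_on ({0..T} \<times> U) (\<lambda>x. integral (cbox 0 1) (\<lambda>s. fst x *\<^sub>R H (s * fst x) (snd x)))"
  proof (rule integral_continuous_on_param)
    have "continuous_on (({0..T} \<times> U) \<times> cbox 0 1) (\<lambda>y. H (snd y * fst (fst y)) (snd (fst y)))"
      by (rule continuous_on_compose2[OF cont, of _ "\<lambda>y. (snd y * fst (fst y), snd (fst y))", simplified])
        (auto intro!: continuous_intros intro: order_trans[OF mult_left_le_one_le])
    then show "continuous_on (({0..T} \<times> U) \<times> cbox 0 1)
        (\<lambda>(x, s). fst x *\<^sub>R H (s * fst x) (snd x))"
      by (auto simp: case_prod_unfold intro!: continuous_intros)
  qed
  moreover have "integral (cbox 0 1) (\<lambda>s. t *\<^sub>R H (s * t) z) = integral {0..t} (\<lambda>s. H s z)"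
    if "t \<in> {0..T}" "z \<in> U" for t z
  proof (cases "t = 0")
    case False
    then have t: "t > 0" using that by simp
    have "continuous_on {0..t} (\<lambda>s. H s z)"
      by (rule continuous_on_subset[OF continuous_on_fst_section[OF cont \<open>z \<in> U\<close>]]) (use that in auto)
    then have "((\<lambda>s. H s z) has_integral integral {0..t} (\<lambda>s. H s z)) (cbox 0 t)"
      using integrable_integral integrable_continuous_interval by (metis box_real(2))
    from has_integral_affinity[OF this, of t 0]
    have "((\<lambda>s. H (s * t) z) has_integral (1 / t) *\<^sub>R integral {0..t} (\<lambda>s. H s z)) (cbox 0 1)"
      using t by (simp add: mult.commute image_affinity_atLeastAtMost_div_diff
          image_affinity_atLeastAtMost field_simps)
    from has_integral_cmul[OF this, of t]
    have "((\<lambda>s. t *\<^sub>R H (s * t) z) has_integral integral {0..t} (\<lambda>s. H s z)) (cbox 0 1)"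
      using t by simp
    then show ?thesis by (rule integral_unique)
  qed simp
  ultimately show ?thesis
    by (subst continuous_on_cong[OF refl]) (auto simp: case_prod_unfold)
qed

text \<open>Gronwall's inequality in both time directions. The square of the norm is differentiable
  even where \<open>v\<close> vanishes, and its derivative is at most \<open>2 * L\<close> times
  itself in absolute value; so it decreases after multiplication by \<open>exp (- 2 * L * t)\<close>
  and increases after multiplication by \<open>exp (2 * L * t)\<close>.\<close>

lemma norm_growth:
  fixes v :: "real \<Rightarrow> 'a::real_inner"
  assumes v: "\<And>t. t \<in> {a..b} \<Longrightarrow> (v has_vector_derivative v' t) (at t within {a..b})"
    and v': "\<And>t. t \<in> {a..b} \<Longrightarrow> norm (v' t) \<le> L * norm (v t)"
    and st: "s \<in> {a..b}" "t \<in> {a..b}"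
  shows "norm (v t) \<le> exp (L * \<bar>t - s\<bar>) * norm (v s)"
proof -
  have D: "((\<lambda>t. v t \<bullet> v t) has_real_derivative 2 * (v t \<bullet> v' t)) (at t)" if "a < t" "t < b" for t
  proof -
    have "(v has_vector_derivative v' t) (at t)"
      using v[of t] that by (simp add: at_within_Icc_at)
    then have "((\<lambda>t. v t \<bullet> v t) has_derivative (\<lambda>h. v t \<bullet> (h *\<^sub>R v' t) + (h *\<^sub>R v' t) \<bullet> v t)) (at t)"
      unfolding has_vector_derivative_def by (intro has_derivative_inner)
    then show ?thesis
      unfolding has_field_derivative_def
      by (rule has_derivative_eq_rhs) (auto simp: inner_commute fun_eq_iff)
  qed
  have bd: "\<bar>v t \<bullet> v' t\<bar> \<le> L * (v t \<bullet> v t)" if "t \<in> {a..b}" for t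
    using Cauchy_Schwarz_ineq2[of "v t" "v' t"] mult_left_mono[OF v'[OF that], of "norm (v t)"]
    by (simp add: power2_norm_eq_inner[symmetric] power2_eq_square mult.left_commute)
  have cv: "continuous_on {a..b} v"
    using v by (meson continuous_on_vector_derivative)
  have sq: "x \<le> y * z" if "x\<^sup>2 \<le> (y\<^sup>2) * z\<^sup>2" "0 \<le> y" "0 \<le> z" for x y z :: real
    using that by (metis mult_nonneg_nonneg power2_le_imp_le power_mult_distrib)
  have e2: "(exp x)\<^sup>2 = exp (2 * x)" for x :: real
    by (simp add: exp_double)
  consider "s \<le> t" | "t \<le> s" by linarith
  then show ?thesis
  proof cases
    case 1
    have "(v t \<bullet> v t) * exp (- 2 * L * t) \<le> (v s \<bullet> v s) * exp (- 2 * L * s)"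
    proof (rule DERIV_nonpos_imp_decreasing_open[OF 1])
      fix x assume x: "s < x" "x < t"
      have d: "((\<lambda>x. (v x \<bullet> v x) * exp (- 2 * L * x)) has_real_derivative
          2 * (v x \<bullet> v' x) * exp (- 2 * L * x) + exp (- 2 * L * x) * (- 2 * L) * (v x \<bullet> v x)) (at x)"
        by (rule DERIV_mult[OF D]) (use x st in \<open>auto intro!: derivative_eq_intros\<close>)
      have eq: "2 * (v x \<bullet> v' x) * exp (- 2 * L * x) + exp (- 2 * L * x) * (- 2 * L) * (v x \<bullet> v x)
          = 2 * exp (- 2 * L * x) * (v x \<bullet> v' x - L * (v x \<bullet> v x))"
        by (simp add: algebra_simps)
      have le: "v x \<bullet> v' x - L * (v x \<bullet> v x) \<le> 0"
        using bd[of x] x st by auto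
      show "\<exists>y. ((\<lambda>x. (v x \<bullet> v x) * exp (- 2 * L * x)) has_real_derivative y) (at x) \<and> y \<le> 0"
        by (rule exI, rule conjI[OF DERIV_cong[OF d eq]]) (use le in \<open>simp add: mult_nonneg_nonpos\<close>)
    next
      show "continuous_on {s..t} (\<lambda>x. (v x \<bullet> v x) * exp (- 2 * L * x))"
        using st by (intro continuous_intros continuous_on_subset[OF cv]) auto
    qed
    from mult_right_mono[OF this, of "exp (2 * L * t)"]
    have "v t \<bullet> v t \<le> exp (2 * (L * (t - s))) * (v s \<bullet> v s)"
      by (simp add: mult.assoc exp_add[symmetric] algebra_simps)
    then show ?thesis
      using 1 by (intro sq[of "norm (v t)" _ "norm (v s)"]) (auto simp: e2 power2_norm_eq_inner)
  next
    case 2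
    have "(v t \<bullet> v t) * exp (2 * L * t) \<le> (v s \<bullet> v s) * exp (2 * L * s)"
    proof (rule DERIV_nonneg_imp_increasing_open[OF 2])
      fix x assume x: "t < x" "x < s"
      have d: "((\<lambda>x. (v x \<bullet> v x) * exp (2 * L * x)) has_real_derivative
          2 * (v x \<bullet> v' x) * exp (2 * L * x) + exp (2 * L * x) * (2 * L) * (v x \<bullet> v x)) (at x)"
        by (rule DERIV_mult[OF D]) (use x st in \<open>auto intro!: derivative_eq_intros\<close>)
      have eq: "2 * (v x \<bullet> v' x) * exp (2 * L * x) + exp (2 * L * x) * (2 * L) * (v x \<bullet> v x)
          = 2 * exp (2 * L * x) * (v x \<bullet> v' x + L * (v x \<bullet> v x))"
        by (simp add: algebra_simps)
      have le: "v x \<bullet> v' x + L * (v x \<bullet> v x) \<ge> 0"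
        using bd[of x] x st by auto
      show "\<exists>y. ((\<lambda>x. (v x \<bullet> v x) * exp (2 * L * x)) has_real_derivative y) (at x) \<and> 0 \<le> y"
        by (rule exI, rule conjI[OF DERIV_cong[OF d eq]]) (use le in simp)
    next
      show "continuous_on {t..s} (\<lambda>x. (v x \<bullet> v x) * exp (2 * L * x))"
        using st by (intro continuous_intros continuous_on_subset[OF cv]) auto
    qed
    from mult_right_mono[OF this, of "exp (- (2 * L * t))"]
    have "v t \<bullet> v t \<le> exp (2 * (L * (s - t))) * (v s \<bullet> v s)"
      by (simp add: mult.assoc exp_add[symmetric] algebra_simps)
    then show ?thesis
      using 2 by (intro sq[of "norm (v t)" _ "norm (v s)"]) (auto simp: e2 power2_norm_eq_inner)
  qed
qed

text \<open>Compactness of \<open>K \<times> S\<close> bounds the derivative by one constant for all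
  parameters, and convexity of \<open>S\<close> turns this bound into a Lipschitz constant.\<close>

lemma holomorphic_family_lipschitz:
  fixes R :: "'a::metric_space \<Rightarrow> complex \<Rightarrow> complex"
  assumes cont: "continuous_on (K \<times> U) (\<lambda>(s, z). R s z)" and "compact K" "open U"
    and hol: "\<And>s. s \<in> K \<Longrightarrow> R s holomorphic_on U"
    and S: "compact S" "convex S" "S \<subseteq> U"
  obtains L where "L > 0"
    "\<And>s z w. s \<in> K \<Longrightarrow> z \<in> S \<Longrightarrow> w \<in> S \<Longrightarrow> norm (R s z - R s w) \<le> L * norm (z - w)"
proof -
  have "continuous_on (K \<times> U) (\<lambda>(s, z). deriv (R s) z)"
    by (rule continuous_on_deriv_param) (use assms in auto)
  then have "compact ((\<lambda>(s, z). deriv (R s) z) ` (K \<times> S))"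
    by (intro compact_continuous_image compact_Times) (use assms in \<open>auto elim: continuous_on_subset\<close>)
  then obtain L where L: "L > 0" "\<And>s z. s \<in> K \<Longrightarrow> z \<in> S \<Longrightarrow> norm (deriv (R s) z) \<le> L"
    by (auto dest!: compact_imp_bounded simp: bounded_pos)
  show thesis
  proof (rule that)
    fix s z w assume s: "s \<in> K" and zw: "z \<in> S" "w \<in> S"
    show "norm (R s z - R s w) \<le> L * norm (z - w)"
    proof (rule field_differentiable_bound[OF \<open>convex S\<close> _ _ zw])
      show "(R s has_field_derivative deriv (R s) x) (at x within S)" if "x \<in> S" for x
        using that hol[OF s] S \<open>open U\<close> holomorphic_derivI by blast
    qed (use L s in auto)
  qed (fact L(1))
qed

text \<open>The estimate behind an exponentially weighted norm, which lets Picard iteration work on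
  the whole interval at once. The rate \<open>c\<close> is later \<open>L\<close> for the growth of
  the iterates and \<open>2 * L\<close> for the differences of consecutive ones.\<close>

lemma norm_integral_exp_bound:
  fixes h :: "real \<Rightarrow> complex"
  assumes "continuous_on {0..t} h" "0 < c" "0 \<le> t"
    and h: "\<And>s. s \<in> {0..t} \<Longrightarrow> norm (h s) \<le> C * (c * exp (c * s))"
  shows "norm (integral {0..t} h) \<le> C * (exp (c * t) - 1)"
proof -
  have "((\<lambda>s. C * (c * exp (c * s))) has_integral C * exp (c * t) - C * exp (c * 0)) {0..t}"
    using \<open>0 \<le> t\<close> by (intro fundamental_theorem_of_calculus)
      (auto intro!: derivative_eq_intros simp: has_real_derivative_iff_has_vector_derivative[symmetric])
  then have I: "((\<lambda>s. C * (c * exp (c * s))) has_integral C * (exp (c * t) - 1)) {0..t}"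
    by (simp add: algebra_simps)
  have "norm (integral {0..t} h) \<le> integral {0..t} (\<lambda>s. C * (c * exp (c * s)))"
    using assms by (intro integral_norm_bound_integral integrable_continuous_interval h
        has_integral_integrable[OF I])
  then show ?thesis by (simp only: integral_unique[OF I])
qed

text \<open>Picard iteration carried out for all initial values simultaneously: the iterates are
  holomorphic in \<open>z\<close> and converge uniformly, so the limit is holomorphic. As the
  equation vanishes at \<open>0\<close>, every iterate is bounded by
  \<open>norm z * exp (L * t)\<close>, and the smallness of \<eta> is exactly what keeps this below
  \<delta> up to time \<open>T\<close>.\<close>

lemma holomorphic_flow:
  fixes R :: "real \<Rightarrow> complex \<Rightarrow> complex"
  assumes cont: "continuous_on ({0..T} \<times> ball 0 \<delta>) (\<lambda>(s, z). R s z)"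
    and hol: "\<And>s. s \<in> {0..T} \<Longrightarrow> R s holomorphic_on ball 0 \<delta>"
    and R0: "\<And>s. s \<in> {0..T} \<Longrightarrow> R s 0 = 0"
    and lip: "\<And>s z w. s \<in> {0..T} \<Longrightarrow> z \<in> ball 0 \<delta> \<Longrightarrow> w \<in> ball 0 \<delta> \<Longrightarrow>
               norm (R s z - R s w) \<le> L * norm (z - w)"
    and L: "L > 0" and \<eta>: "\<eta> * exp (L * T) \<le> \<delta>"
  obtains \<phi> where
    "\<And>t z. t \<in> {0..T} \<Longrightarrow> z \<in> ball 0 \<eta> \<Longrightarrow> \<phi> t z \<in> ball 0 \<delta>"
    "\<And>z. z \<in> ball 0 \<eta> \<Longrightarrow> \<phi> 0 z = z"
    "\<And>t z. t \<in> {0..T} \<Longrightarrow> z \<in> ball 0 \<eta> \<Longrightarrow>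
       ((\<lambda>t. \<phi> t z) has_vector_derivative R t (\<phi> t z)) (at t within {0..T})"
    "\<And>t. t \<in> {0..T} \<Longrightarrow> \<phi> t holomorphic_on ball 0 \<eta>"
proof -
  let ?I = "{0..T}" and ?B = "ball (0::complex) \<eta>" and ?D = "ball (0::complex) \<delta>"
  define \<psi> where "\<psi> = rec_nat (\<lambda>t z. z) (\<lambda>n u t z. z + integral {0..t} (\<lambda>s. R s (u s z)))"
  have \<psi>0: "\<psi> 0 t z = z" and \<psi>S: "\<psi> (Suc n) t z = z + integral {0..t} (\<lambda>s. R s (\<psi> n s z))" for n t z
    by (simp_all add: \<psi>_def)
  have inD: "norm z * exp (L * t) < \<delta>" if "t \<in> ?I" "z \<in> ?B" for t z
  proof (cases "z = 0")
    case True
    then have "0 < \<eta> * exp (L * T)" using that by simp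
    then show ?thesis using \<eta> True by simp
  next
    case False
    have "norm z * exp (L * t) \<le> norm z * exp (L * T)"
      using that L by (intro mult_left_mono) auto
    also have "\<dots> < \<eta> * exp (L * T)" using that by simp
    finally show ?thesis using \<eta> by simp
  qed
  have Rbd: "norm (R s w) \<le> L * norm w" if "s \<in> ?I" "w \<in> ?D" for s w
    using lip[of s w 0] R0[of s] that by (cases "\<delta> > 0") (auto simp: not_less ball_empty)
  have comp: "continuous_on (?I \<times> ?B) (\<lambda>(s, z). R s (u s z))"
    if "continuous_on (?I \<times> ?B) (\<lambda>(s, z). u s z)" "\<And>s z. s \<in> ?I \<Longrightarrow> z \<in> ?B \<Longrightarrow> u s z \<in> ?D" for u
  proof -
    have "continuous_on (?I \<times> ?B) (\<lambda>x. (fst x, case x of (s, z) \<Rightarrow> u s z))"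
      using that(1) by (intro continuous_intros)
    from continuous_on_compose2[OF cont this] that(2) show ?thesis
      by (force simp: case_prod_unfold)
  qed
  \<comment> \<open>The three properties need one joint induction: continuity makes the next
    integral meaningful, and the norm bound keeps the iterate in the disc on which \<open>R\<close>
    is controlled.\<close>
  have inv: "continuous_on (?I \<times> ?B) (\<lambda>(t, z). \<psi> n t z) \<and>
      (\<forall>t\<in>?I. \<forall>z\<in>?B. norm (\<psi> n t z) \<le> norm z * exp (L * t)) \<and>
      (\<forall>t\<in>?I. \<psi> n t holomorphic_on ?B)" for n
  proof (induction n)
    case 0
    have "norm z \<le> norm z * exp (L * t)" if "t \<in> ?I" for t and z :: complex
      using that L mult_left_mono[of 1 "exp (L * t)" "norm z"] by simp
    then show ?case
      by (auto simp: \<psi>0 case_prod_unfold intro!: continuous_intros)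
  next
    case (Suc n)
    have ub: "\<psi> n s z \<in> ?D" if "s \<in> ?I" "z \<in> ?B" for s z
      using Suc inD[OF that] that by force
    have c: "continuous_on (?I \<times> ?B) (\<lambda>(s, z). R s (\<psi> n s z))"
      using Suc ub by (intro comp) auto
    have "continuous_on (?I \<times> ?B) (\<lambda>(t, z). \<psi> (Suc n) t z)"
      using continuous_on_integral_upper_param[OF c]
      by (auto simp: \<psi>S case_prod_unfold intro!: continuous_intros)
    moreover have "norm (\<psi> (Suc n) t z) \<le> norm z * exp (L * t)" if "t \<in> ?I" "z \<in> ?B" for t z
    proof -
      have "norm (integral {0..t} (\<lambda>s. R s (\<psi> n s z))) \<le> norm z * (exp (L * t) - 1)"
      proof (rule norm_integral_exp_bound)
        show "continuous_on {0..t} (\<lambda>s. R s (\<psi> n s z))"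
          by (rule continuous_on_subset[OF continuous_on_fst_section[OF c \<open>z \<in> ?B\<close>]]) (use that in auto)
        show "norm (R s (\<psi> n s z)) \<le> norm z * (L * exp (L * s))" if s: "s \<in> {0..t}" for s
        proof -
          have sI: "s \<in> ?I" using s \<open>t \<in> ?I\<close> by auto
          then have "norm (R s (\<psi> n s z)) \<le> L * norm (\<psi> n s z)"
            using \<open>z \<in> ?B\<close> by (intro Rbd ub)
          also have "\<dots> \<le> L * (norm z * exp (L * s))"
            using Suc sI \<open>z \<in> ?B\<close> L by (intro mult_left_mono) auto
          finally show ?thesis by (simp add: mult_ac)
        qed
      qed (use L that in auto)
      then show ?thesis
        using norm_triangle_ineq[of z "integral {0..t} (\<lambda>s. R s (\<psi> n s z))"]
        by (simp add: \<psi>S algebra_simps)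
    qed
    moreover have "\<psi> (Suc n) t holomorphic_on ?B" if "t \<in> ?I" for t
    proof -
      have "(\<lambda>z. integral {0..t} (\<lambda>s. R s (\<psi> n s z))) holomorphic_on ?B"
      proof (rule holomorphic_on_integral_param)
        show "continuous_on ({0..t} \<times> ?B) (\<lambda>(s, z). R s (\<psi> n s z))"
          by (rule continuous_on_subset[OF c]) (use that in auto)
        show "(\<lambda>z. R s (\<psi> n s z)) holomorphic_on ?B" if "s \<in> {0..t}" for s
        proof -
          have s: "s \<in> ?I" using that \<open>t \<in> ?I\<close> by auto
          have "(R s \<circ> \<psi> n s) holomorphic_on ?B"
            by (rule holomorphic_on_compose_gen[OF _ hol[OF s]]) (use Suc ub s in auto)
          then show ?thesis by (simp add: o_def)
        qed
      qed auto
      moreover have "\<psi> (Suc n) t = (\<lambda>z. z + integral {0..t} (\<lambda>s. R s (\<psi> n s z)))"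
        by (simp add: \<psi>S fun_eq_iff)
      ultimately show ?thesis by (auto intro!: holomorphic_intros)
    qed
    ultimately show ?case by blast
  qed
  have \<psi>D: "\<psi> n s z \<in> ?D" if "s \<in> ?I" "z \<in> ?B" for n s z
    using inv[of n] inD[OF that] that by force
  have Rcont: "continuous_on {0..t} (\<lambda>s. R s (\<psi> n s z))" if "t \<in> ?I" "z \<in> ?B" for n t z
    by (rule continuous_on_subset[OF continuous_on_fst_section[OF comp[of "\<psi> n"] that(2)]])
      (use inv[of n] \<psi>D that in auto)
  \<comment> \<open>The weight grows at twice the Lipschitz rate, so \<open>L\<close> times its
    integral is at most half of it again and each iteration halves the difference.\<close>
  have diff: "norm (\<psi> (Suc n) t z - \<psi> n t z) \<le> norm z * exp (2 * L * t) / 2 ^ n"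
    if "t \<in> ?I" "z \<in> ?B" for n t z
    using that(1)
  proof (induction n arbitrary: t)
    case 0
    have "norm (integral {0..t} (\<lambda>s. R s z)) \<le> norm z / 2 * (exp (2 * L * t) - 1)"
    proof (rule norm_integral_exp_bound)
      show "continuous_on {0..t} (\<lambda>s. R s z)"
        using Rcont[OF 0 that(2), of 0] by (simp add: \<psi>0)
      show "norm (R s z) \<le> norm z / 2 * (2 * L * exp (2 * L * s))" if "s \<in> {0..t}" for s
      proof -
        have "norm (R s z) \<le> L * norm z"
          using \<psi>D[of s z 0] \<open>z \<in> ?B\<close> that 0 by (intro Rbd) (auto simp: \<psi>0)
        also have "\<dots> \<le> L * norm z * exp (2 * L * s)"
          using L that mult_left_mono[of 1 "exp (2 * L * s)" "L * norm z"] by simp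
        finally show ?thesis by (simp add: mult_ac)
      qed
    qed (use L 0 in auto)
    also have "\<dots> \<le> norm z * exp (2 * L * t)"
    proof -
      have "norm z * (exp (2 * L * t) - 1) \<le> norm z * (2 * exp (2 * L * t))"
        using exp_ge_zero[of "2 * L * t"] by (intro mult_left_mono) (linarith, simp)
      then show ?thesis by simp
    qed
    finally show ?case by (simp add: \<psi>S \<psi>0)
  next
    case (Suc n)
    have "norm (integral {0..t} (\<lambda>s. R s (\<psi> (Suc n) s z) - R s (\<psi> n s z)))
        \<le> norm z / 2 ^ Suc n * (exp (2 * L * t) - 1)"
    proof (rule norm_integral_exp_bound)
      show "continuous_on {0..t} (\<lambda>s. R s (\<psi> (Suc n) s z) - R s (\<psi> n s z))"
        by (intro continuous_on_diff Rcont Suc that)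
      show "norm (R s (\<psi> (Suc n) s z) - R s (\<psi> n s z)) \<le> norm z / 2 ^ Suc n * (2 * L * exp (2 * L * s))"
        if "s \<in> {0..t}" for s
      proof -
        have s: "s \<in> ?I" using that Suc.prems by auto
        have "norm (R s (\<psi> (Suc n) s z) - R s (\<psi> n s z)) \<le> L * norm (\<psi> (Suc n) s z - \<psi> n s z)"
          by (intro lip \<psi>D s \<open>z \<in> ?B\<close>)
        also have "\<dots> \<le> L * (norm z * exp (2 * L * s) / 2 ^ n)"
          using L Suc.IH[OF s] by (intro mult_left_mono) auto
        finally show ?thesis by (simp add: field_simps)
      qed
    qed (use L Suc.prems in auto)
    also have "\<dots> \<le> norm z / 2 ^ Suc n * exp (2 * L * t)"
      by (intro mult_left_mono) auto
    finally have "norm (integral {0..t} (\<lambda>s. R s (\<psi> (Suc n) s z) - R s (\<psi> n s z)))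
        \<le> norm z * exp (2 * L * t) / 2 ^ Suc n" by simp
    moreover have "\<psi> (Suc (Suc n)) t z - \<psi> (Suc n) t z =
        integral {0..t} (\<lambda>s. R s (\<psi> (Suc n) s z) - R s (\<psi> n s z))"
      using integral_diff[OF integrable_continuous_interval[OF Rcont[OF Suc.prems that(2)]]
          integrable_continuous_interval[OF Rcont[OF Suc.prems that(2)]], of "Suc n" n]
      by (simp add: \<psi>S)
    ultimately show ?case by simp
  qed
  \<comment> \<open>The limit of the iterates, written as a telescoping series so that the geometric
    bound on the differences feeds the Weierstrass test.\<close>
  define \<phi> where "\<phi> t z = z + (\<Sum>n. \<psi> (Suc n) t z - \<psi> n t z)" for t z
  have ulim: "uniform_limit (?I \<times> ?B) (\<lambda>n (t, z). \<psi> n t z) (\<lambda>(t, z). \<phi> t z) sequentially"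
  proof -
    have *: "uniform_limit (?I \<times> ?B) (\<lambda>n x. \<Sum>i<n. (case x of (t, z) \<Rightarrow> \<psi> (Suc i) t z - \<psi> i t z))
        (\<lambda>x. \<Sum>i. (case x of (t, z) \<Rightarrow> \<psi> (Suc i) t z - \<psi> i t z)) sequentially"
    proof (rule Weierstrass_m_test)
      fix n x assume "x \<in> ?I \<times> ?B"
      then obtain t z where x: "x = (t, z)" "t \<in> ?I" "z \<in> ?B" by auto
      have "norm z * exp (2 * L * t) / 2 ^ n \<le> \<eta> * exp (2 * L * T) / 2 ^ n"
        using x L order_trans[OF norm_ge_zero[of z], of \<eta>]
        by (intro divide_right_mono mult_mono) auto
      then show "norm (case x of (t, z) \<Rightarrow> \<psi> (Suc n) t z - \<psi> n t z) \<le> \<eta> * exp (2 * L * T) * (1 / 2) ^ n"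
        using diff[OF x(2,3), of n] x(1) by (simp add: power_divide)
    next
      show "summable (\<lambda>n. \<eta> * exp (2 * L * T) * (1 / 2) ^ n)"
        by (intro summable_mult summable_geometric) simp
    qed
    have tel: "z + (\<Sum>i<n. \<psi> (Suc i) t z - \<psi> i t z) = \<psi> n t z" for n t z
      by (simp add: sum_lessThan_telescope[of "\<lambda>i. \<psi> i t z"] \<psi>0)
    from uniform_limit_add[OF uniform_limit_const[where c = snd] *]
    show ?thesis
      by (rule uniform_limit_cong'[THEN iffD1, rotated -1])
        (auto simp: \<phi>_def tel case_prod_unfold)
  qed
  have ptlim: "(\<lambda>n. \<psi> n t z) \<longlonglongrightarrow> \<phi> t z" if "t \<in> ?I" "z \<in> ?B" for t z
    using tendsto_uniform_limitI[OF ulim, of "(t, z)"] that unfolding prod.case by blast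
  have \<phi>bd: "norm (\<phi> t z) \<le> norm z * exp (L * t)" if "t \<in> ?I" "z \<in> ?B" for t z
    using inv that by (intro Lim_norm_ubound[OF _ ptlim[OF that]]) (auto simp: always_eventually)
  have \<phi>D: "\<phi> t z \<in> ?D" if "t \<in> ?I" "z \<in> ?B" for t z
    using \<phi>bd[OF that] inD[OF that] by simp
  have \<phi>cont: "continuous_on (?I \<times> ?B) (\<lambda>(t, z). \<phi> t z)"
    by (rule uniform_limit_theorem[OF _ ulim]) (use inv in \<open>auto intro!: always_eventually\<close>)
  have R\<phi>cont: "continuous_on ?I (\<lambda>s. R s (\<phi> s z))" if "z \<in> ?B" for z
    by (rule continuous_on_fst_section[OF comp[OF \<phi>cont \<phi>D] that])
  have eq: "\<phi> t z = z + integral {0..t} (\<lambda>s. R s (\<phi> s z))" if t: "t \<in> ?I" and z: "z \<in> ?B" for t z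
  proof -
    \<comment> \<open>The Lipschitz condition transfers uniform convergence from the iterates to the
      integrands, so the integral equation survives the limit.\<close>
    have ul: "uniform_limit {0..t} (\<lambda>n s. R s (\<psi> n s z)) (\<lambda>s. R s (\<phi> s z)) sequentially"
    proof (rule uniform_limitI)
      fix e :: real assume "e > 0"
      then have "\<forall>\<^sub>F n in sequentially. \<forall>x\<in>?I \<times> ?B.
          dist (case x of (t, z) \<Rightarrow> \<psi> n t z) (case x of (t, z) \<Rightarrow> \<phi> t z) < e / L"
        using L by (intro uniform_limitD[OF ulim]) auto
      then show "\<forall>\<^sub>F n in sequentially. \<forall>s\<in>{0..t}. dist (R s (\<psi> n s z)) (R s (\<phi> s z)) < e"
      proof eventually_elim
        case (elim n)
        show ?case
        proof
          fix s assume "s \<in> {0..t}"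
          then have s: "s \<in> ?I" using t by auto
          have "norm (R s (\<psi> n s z) - R s (\<phi> s z)) \<le> L * norm (\<psi> n s z - \<phi> s z)"
            by (intro lip \<psi>D \<phi>D s z)
          also have "\<dots> < L * (e / L)"
            using elim s z L by (intro mult_strict_left_mono) (auto simp: dist_norm)
          finally show "dist (R s (\<psi> n s z)) (R s (\<phi> s z)) < e" using L by (simp add: dist_norm)
        qed
      qed
    qed
    obtain I J where IJ: "\<And>n. ((\<lambda>s. R s (\<psi> n s z)) has_integral I n) {0..t}"
      "((\<lambda>s. R s (\<phi> s z)) has_integral J) {0..t}" "I \<longlonglongrightarrow> J"
      by (rule uniform_limit_integral[OF ul]) (use Rcont[OF t z] in auto)
    have "(\<lambda>n. z + I n) \<longlonglongrightarrow> z + J"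
      by (intro tendsto_intros IJ(3))
    then have "(\<lambda>n. \<psi> (Suc n) t z) \<longlonglongrightarrow> z + integral {0..t} (\<lambda>s. R s (\<phi> s z))"
      by (simp only: \<psi>S integral_unique[OF IJ(1)] integral_unique[OF IJ(2)])
    moreover have "(\<lambda>n. \<psi> (Suc n) t z) \<longlonglongrightarrow> \<phi> t z"
      using ptlim[OF t z] by (rule LIMSEQ_Suc)
    ultimately show ?thesis using LIMSEQ_unique by blast
  qed
  show thesis
  proof (rule that[of \<phi>])
    show "\<phi> t z \<in> ?D" if "t \<in> ?I" "z \<in> ?B" for t z by (fact \<phi>D[OF that])
    show "\<phi> 0 z = z" if "z \<in> ?B" for z
    proof -
      have "\<psi> n 0 z = z" for n by (cases n) (simp_all add: \<psi>0 \<psi>S)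
      then show ?thesis by (simp add: \<phi>_def)
    qed
    show "((\<lambda>t. \<phi> t z) has_vector_derivative R t (\<phi> t z)) (at t within ?I)"
      if "t \<in> ?I" "z \<in> ?B" for t z
    proof -
      have "((\<lambda>t. z + integral {0..t} (\<lambda>s. R s (\<phi> s z))) has_vector_derivative 0 + R t (\<phi> t z))
          (at t within ?I)"
        by (intro has_vector_derivative_add has_vector_derivative_const
            integral_has_vector_derivative R\<phi>cont that)
      from has_vector_derivative_transform[OF that(1) eq[OF _ that(2)] this]
      show ?thesis by simp
    qed
    show "\<phi> t holomorphic_on ?B" if "t \<in> ?I" for t
    proof (rule holomorphic_uniform_sequence[of _ "\<lambda>n. \<psi> n t"])
      have u: "uniform_limit ?B (\<lambda>n. \<psi> n t) (\<phi> t) sequentially"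
      proof (rule uniform_limitI)
        fix e :: real assume "e > 0"
        from uniform_limitD[OF ulim this]
        show "\<forall>\<^sub>F n in sequentially. \<forall>z\<in>?B. dist (\<psi> n t z) (\<phi> t z) < e"
          by eventually_elim (use that in auto)
      qed
      show "\<exists>d>0. cball z d \<subseteq> ?B \<and> uniform_limit (cball z d) (\<lambda>n. \<psi> n t) (\<phi> t) sequentially"
        if "z \<in> ?B" for z
      proof -
        obtain d where "d > 0" "cball z d \<subseteq> ?B"
          using \<open>z \<in> ?B\<close> open_contains_cball_eq[OF open_ball] by blast
        then show ?thesis using uniform_limit_on_subset[OF u] by blast
      qed
      show "\<psi> n t holomorphic_on ?B" for n using inv that by blast
    qed simp
  qed
qed

subsection \<open>Complexification of analytic equations\<close>

text \<open>Unconditional summability of reals is absolute summability. Hence convergence at one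
  point with nonnegative offsets yields a majorant for all offsets, real or complex, that are no
  larger in absolute value.\<close>

lemma double_series_majorant:
  fixes c :: "nat \<times> nat \<Rightarrow> real"
  assumes "((\<lambda>(i, j). c (i, j) * a ^ i * b ^ j) has_sum s) UNIV" "a \<ge> 0" "b \<ge> 0"
  shows "(\<lambda>(i, j). \<bar>c (i, j)\<bar> * a ^ i * b ^ j) summable_on UNIV"
proof -
  have "(\<lambda>x. norm ((\<lambda>(i, j). c (i, j) * a ^ i * b ^ j) x)) summable_on UNIV"
    using assms(1) summable_on_iff_abs_summable_on_real has_sum_imp_summable by blast
  then show ?thesis
    using assms by (simp add: case_prod_unfold abs_mult)
qed

text \<open>Only the radius becomes complex; the angle is the independent variable of the equation
  and stays real. The majorant is taken at the offset \<open>(r / 2, r / 2)\<close>, which lies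
  inside the region of convergence, and gives uniform convergence on the closed product of radius
  \<open>r / 2\<close>.\<close>

lemma complexify_double_series:
  fixes c :: "nat \<times> nat \<Rightarrow> real"
  assumes r: "r > 0" and F: "\<And>x y. \<bar>x - x0\<bar> < r \<Longrightarrow> \<bar>y\<bar> < r \<Longrightarrow>
      ((\<lambda>(i, j). c (i, j) * (x - x0) ^ i * y ^ j) has_sum F x y) UNIV"
  obtains E where "continuous_on (ball x0 (r / 2) \<times> ball 0 (r / 2)) (\<lambda>(x, z). E x z)"
    "\<And>x. x \<in> ball x0 (r / 2) \<Longrightarrow> E x holomorphic_on ball 0 (r / 2)"
    "\<And>x y. x \<in> ball x0 (r / 2) \<Longrightarrow> \<bar>y\<bar> < r / 2 \<Longrightarrow> E x (complex_of_real y) = of_real (F x y)"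
proof -
  define f where "f k w = (case k of (i, j) \<Rightarrow>
      complex_of_real (c (i, j) * (fst w - x0) ^ i) * snd w ^ j)" for k :: "nat \<times> nat" and w
  define M where "M = (\<lambda>(i, j). \<bar>c (i, j)\<bar> * (r / 2) ^ i * (r / 2) ^ j)"
  define E where "E x z = (\<Sum>\<^sub>\<infinity>k. f k (x, z))" for x z
  have M: "M summable_on UNIV"
    unfolding M_def using r F[of "x0 + r / 2" "r / 2"]
    by (intro double_series_majorant[where s = "F (x0 + r / 2) (r / 2)"]) auto
  have bd: "norm (f k w) \<le> M k" if "w \<in> cball x0 (r / 2) \<times> cball 0 (r / 2)" for k w
    using that r unfolding f_def M_def
    by (cases k, cases w) (auto simp: norm_mult norm_power abs_mult power_abs dist_real_def abs_minus_commute
        simp del: of_real_mult of_real_power of_real_diff intro!: mult_mono power_mono mult_nonneg_nonneg)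
  have ul: "uniform_limit (cball x0 (r / 2) \<times> cball 0 (r / 2)) (\<lambda>X w. \<Sum>k\<in>X. f k w)
      (\<lambda>w. \<Sum>\<^sub>\<infinity>k. f k w) (finite_subsets_at_top UNIV)"
    by (rule Weierstrass_m_test_general[OF bd M])
  show thesis
  proof (rule that)
    have "continuous_on (cball x0 (r / 2) \<times> cball 0 (r / 2)) (\<lambda>w. \<Sum>\<^sub>\<infinity>k. f k w)"
      by (rule uniform_limit_theorem[OF _ ul])
        (auto simp: f_def case_prod_unfold intro!: always_eventually continuous_intros)
    then have "continuous_on (ball x0 (r / 2) \<times> ball 0 (r / 2)) (\<lambda>w. \<Sum>\<^sub>\<infinity>k. f k w)"
      by (rule continuous_on_subset) (intro Sigma_mono ball_subset_cball)
    then show "continuous_on (ball x0 (r / 2) \<times> ball 0 (r / 2)) (\<lambda>(x, z). E x z)"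
      by (simp add: E_def case_prod_unfold)
    show "E x holomorphic_on ball 0 (r / 2)" if "x \<in> ball x0 (r / 2)" for x
    proof (rule holomorphic_uniform_limit)
      show "uniform_limit (cball 0 (r / 2)) (\<lambda>X z. \<Sum>k\<in>X. f k (x, z)) (E x) (finite_subsets_at_top UNIV)"
      proof (rule uniform_limitI)
        fix e :: real assume "e > 0"
        from uniform_limitD[OF ul this]
        show "\<forall>\<^sub>F X in finite_subsets_at_top UNIV. \<forall>z\<in>cball 0 (r / 2).
            dist (\<Sum>k\<in>X. f k (x, z)) (E x z) < e"
          by eventually_elim (use that in \<open>auto simp: E_def\<close>)
      qed
      show "\<forall>\<^sub>F X in finite_subsets_at_top UNIV. continuous_on (cball 0 (r / 2)) (\<lambda>z. \<Sum>k\<in>X. f k (x, z)) \<and>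
          (\<lambda>z. \<Sum>k\<in>X. f k (x, z)) holomorphic_on ball 0 (r / 2)"
        by (auto simp: f_def case_prod_unfold intro!: always_eventually continuous_intros holomorphic_intros)
    qed auto
    show "E x (complex_of_real y) = of_real (F x y)" if "x \<in> ball x0 (r / 2)" "\<bar>y\<bar> < r / 2" for x y
    proof -
      have "((\<lambda>(i, j). c (i, j) * (x - x0) ^ i * y ^ j) has_sum F x y) UNIV"
        using that r by (intro F) (auto simp: dist_real_def abs_minus_commute)
      from has_sum_of_real[OF this]
      have "((\<lambda>k. f k (x, of_real y)) has_sum complex_of_real (F x y)) UNIV"
        by (rule has_sum_cong[THEN iffD1, rotated]) (auto simp: f_def)
      then show ?thesis unfolding E_def by (rule infsumI)
    qed
  qed
qed

text \<open>The real segment accumulates at the centre, so the identity theorem applies. This is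
  what forces local complexifications around different angles to agree where they overlap.\<close>

lemma holomorphic_eq_of_real_eq:
  assumes "f holomorphic_on ball 0 \<delta>" "g holomorphic_on ball 0 \<delta>" "z \<in> ball 0 \<delta>"
    and "\<And>y. \<bar>y\<bar> < \<delta> \<Longrightarrow> f (complex_of_real y) = g (of_real y)"
  shows "f z = g z"
proof -
  have \<delta>: "\<delta> > 0" using assms(3) by (auto intro: le_less_trans[OF norm_ge_zero])
  have "f z - g z = 0"
  proof (rule analytic_continuation[where f = "\<lambda>z. f z - g z" and w = z and \<xi> = 0
        and S = "ball 0 \<delta>" and U = "complex_of_real ` {-\<delta><..<\<delta>}"])
    show "(\<lambda>z. f z - g z) holomorphic_on ball 0 \<delta>" by (intro holomorphic_intros assms)
    show "0 islimpt (complex_of_real ` {-\<delta><..<\<delta>})"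
      unfolding islimpt_approachable
    proof (intro allI impI)
      fix e :: real assume "e > 0"
      then show "\<exists>x'\<in>complex_of_real ` {- \<delta><..<\<delta>}. x' \<noteq> 0 \<and> dist x' 0 < e"
        using \<delta> by (intro bexI[of _ "complex_of_real (min (e / 2) (\<delta> / 2))"]) (auto simp: min_def)
    qed
    show "complex_of_real ` {- \<delta><..<\<delta>} \<subseteq> ball 0 \<delta>" by auto
  qed (use assms \<delta> in auto)
  then show ?thesis by simp
qed

text \<open>The power series live on neighbourhoods of single angles with varying radii. Compactness
  leaves finitely many, hence a common radius, and the identity theorem glues the pieces.\<close>

lemma complexification:
  assumes an: "real_analytic_on (\<lambda>(x, y). F x y) (K \<times> {0})" and "compact K"
  obtains \<delta> Fc where "\<delta> > 0" "continuous_on (K \<times> ball 0 \<delta>) (\<lambda>(x, z). Fc x z)"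
    "\<And>x. x \<in> K \<Longrightarrow> Fc x holomorphic_on ball 0 \<delta>"
    "\<And>x y. x \<in> K \<Longrightarrow> \<bar>y\<bar> < \<delta> \<Longrightarrow> Fc x (complex_of_real y) = of_real (F x y)"
proof -
  have "\<forall>t\<in>K. \<exists>r E. r > 0 \<and> continuous_on (ball t r \<times> ball 0 r) (\<lambda>(x, z). E x z) \<and>
    (\<forall>x \<in> ball t r. E x holomorphic_on ball 0 r \<and>
       (\<forall>y. \<bar>y\<bar> < r \<longrightarrow> E x (complex_of_real y) = of_real (F x y)))"
  proof
    fix t assume "t \<in> K"
    then obtain r c where r: "r > 0" and c: "\<And>x y. \<bar>x - t\<bar> < r \<Longrightarrow> \<bar>y\<bar> < r \<Longrightarrow>
        ((\<lambda>(i, j). c (i, j) * (x - t) ^ i * y ^ j) has_sum F x y) UNIV"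
      using an unfolding real_analytic_on_def by force
    obtain E where E: "continuous_on (ball t (r / 2) \<times> ball 0 (r / 2)) (\<lambda>(x, z). E x z)"
      "\<And>x. x \<in> ball t (r / 2) \<Longrightarrow> E x holomorphic_on ball 0 (r / 2)"
      "\<And>x y. x \<in> ball t (r / 2) \<Longrightarrow> \<bar>y\<bar> < r / 2 \<Longrightarrow> E x (complex_of_real y) = of_real (F x y)"
      using complexify_double_series[OF r c] by blast
    then show "\<exists>r E. r > 0 \<and> continuous_on (ball t r \<times> ball 0 r) (\<lambda>(x, z). E x z) \<and>
        (\<forall>x \<in> ball t r. E x holomorphic_on ball 0 r \<and>
           (\<forall>y. \<bar>y\<bar> < r \<longrightarrow> E x (complex_of_real y) = of_real (F x y)))"
      using r by (intro exI[of _ "r / 2"] exI[of _ E]) auto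
  qed
  then obtain r E where r: "\<And>t. t \<in> K \<Longrightarrow> r t > 0"
    and Ec: "\<And>t. t \<in> K \<Longrightarrow> continuous_on (ball t (r t) \<times> ball 0 (r t)) (\<lambda>(x, z). E t x z)"
    and Eh: "\<And>t x. t \<in> K \<Longrightarrow> x \<in> ball t (r t) \<Longrightarrow> E t x holomorphic_on ball 0 (r t)"
    and Er: "\<And>t x y. t \<in> K \<Longrightarrow> x \<in> ball t (r t) \<Longrightarrow> \<bar>y\<bar> < r t \<Longrightarrow> E t x (of_real y) = of_real (F x y)"
    by metis
  have "K \<subseteq> (\<Union>t\<in>K. ball t (r t))" using r by force
  then obtain D where D: "D \<subseteq> K" "finite D" "K \<subseteq> (\<Union>t\<in>D. ball t (r t))"
    using compactE_image[OF \<open>compact K\<close>, of K "\<lambda>t. ball t (r t)"] by auto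
  \<comment> \<open>The extra element \<open>1\<close> keeps the minimum meaningful when
    \<open>D\<close> is empty.\<close>
  define \<delta> where "\<delta> = Min (insert 1 (r ` D))"
  have \<delta>: "\<delta> > 0" using D r unfolding \<delta>_def by (subst Min_gr_iff) auto
  have \<delta>r: "\<delta> \<le> r t" if "t \<in> D" for t using D that unfolding \<delta>_def by (intro Min_le) auto
  define \<Omega> where "\<Omega> = (\<Union>t\<in>D. ball t (r t))"
  \<comment> \<open>An arbitrary choice of a patch for every angle. It could jump as
    \<open>x\<close> varies; \<open>FE\<close> shows that the value of \<open>Fc\<close> does not
    depend on it, and continuity is then checked patch by patch on an open cover.\<close>
  define c where "c x = (SOME t. t \<in> D \<and> x \<in> ball t (r t))" for x
  have c: "c x \<in> D" "x \<in> ball (c x) (r (c x))" if "x \<in> \<Omega>" for x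
    using that someI_ex[of "\<lambda>t. t \<in> D \<and> x \<in> ball t (r t)"] by (auto simp: \<Omega>_def c_def)
  define Fc where "Fc x z = E (c x) x z" for x z
  have Fh: "Fc x holomorphic_on ball 0 \<delta>" if "x \<in> \<Omega>" for x
    unfolding Fc_def using Eh[of "c x" x] c[OF that] D(1)
    by (intro holomorphic_on_subset[OF Eh subset_ball[OF \<delta>r]]) auto
  have Fr: "Fc x (of_real y) = of_real (F x y)" if "x \<in> \<Omega>" "\<bar>y\<bar> < \<delta>" for x y
    unfolding Fc_def using Er[of "c x" x y] c[OF that(1)] D(1) \<delta>r[of "c x"] that by auto
  have FE: "Fc x z = E t x z" if "t \<in> D" "x \<in> ball t (r t)" "z \<in> ball 0 \<delta>" for t x z
  proof (rule holomorphic_eq_of_real_eq[where \<delta> = \<delta> and f = "Fc x" and g = "E t x"])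
    have x: "x \<in> \<Omega>" using that by (auto simp: \<Omega>_def)
    show "Fc x holomorphic_on ball 0 \<delta>" by (rule Fh[OF x])
    show "Fc x (of_real y) = E t x (of_real y)" if "\<bar>y\<bar> < \<delta>" for y
      using Fr[OF x that] Er[of t x y] \<open>t \<in> D\<close> \<open>x \<in> ball t (r t)\<close> D(1) \<delta>r[of t] that by auto
    show "E t x holomorphic_on ball 0 \<delta>"
      using that D(1) by (intro holomorphic_on_subset[OF Eh subset_ball[OF \<delta>r]]) auto
  qed (use that in auto)
  have "continuous_on (\<Union>t\<in>D. ball t (r t) \<times> ball 0 \<delta>) (\<lambda>(x, z). Fc x z)"
  proof (rule continuous_on_open_UN)
    show "continuous_on (ball t (r t) \<times> ball 0 \<delta>) (\<lambda>(x, z). Fc x z)" if "t \<in> D" for t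
    proof -
      have "continuous_on (ball t (r t) \<times> ball 0 \<delta>) (\<lambda>(x, z). E t x z)"
        using D(1) that \<delta>r[OF that] by (intro continuous_on_subset[OF Ec]) auto
      then show ?thesis
        by (rule continuous_on_cong[THEN iffD1, OF refl, rotated]) (use FE that in auto)
    qed
  qed (auto intro: open_Times)
  then have Fcont: "continuous_on (K \<times> ball 0 \<delta>) (\<lambda>(x, z). Fc x z)"
    by (rule continuous_on_subset) (use D(3) in auto)
  show thesis
    using D(3)[folded \<Omega>_def] by (intro that[OF \<delta> Fcont Fh Fr]) blast+
qed

text \<open>The zeros of the complexified denominator over \<open>K\<close> and a closed disc form a
  compact set. Its projection to the radius is closed and misses \<open>0\<close>, which leaves one
  disc free of zeros for all angles.\<close>

lemma complexified_quotient:
  assumes F: "real_analytic_on (\<lambda>(x, y). F x y) (K \<times> {0})"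
    and G: "real_analytic_on (\<lambda>(x, y). G x y) (K \<times> {0})" and "compact K"
    and F0: "\<And>x. x \<in> K \<Longrightarrow> F x 0 = 0" and G0: "\<And>x. x \<in> K \<Longrightarrow> G x 0 \<noteq> 0"
  obtains \<delta> R where "\<delta> > 0" "continuous_on (K \<times> ball 0 \<delta>) (\<lambda>(x, z). R x z)"
    "\<And>x. x \<in> K \<Longrightarrow> R x holomorphic_on ball 0 \<delta>" "\<And>x. x \<in> K \<Longrightarrow> R x 0 = 0"
    "\<And>x y. x \<in> K \<Longrightarrow> \<bar>y\<bar> < \<delta> \<Longrightarrow> R x (complex_of_real y) = of_real (F x y / G x y)"
proof -
  obtain d1 Fc where d1: "d1 > 0" and Fc: "continuous_on (K \<times> ball 0 d1) (\<lambda>(x, z). Fc x z)"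
    "\<And>x. x \<in> K \<Longrightarrow> Fc x holomorphic_on ball 0 d1"
    "\<And>x y. x \<in> K \<Longrightarrow> \<bar>y\<bar> < d1 \<Longrightarrow> Fc x (complex_of_real y) = of_real (F x y)"
    using complexification[OF F \<open>compact K\<close>] by blast
  obtain d2 Gc where d2: "d2 > 0" and Gc: "continuous_on (K \<times> ball 0 d2) (\<lambda>(x, z). Gc x z)"
    "\<And>x. x \<in> K \<Longrightarrow> Gc x holomorphic_on ball 0 d2"
    "\<And>x y. x \<in> K \<Longrightarrow> \<bar>y\<bar> < d2 \<Longrightarrow> Gc x (complex_of_real y) = of_real (G x y)"
    using complexification[OF G \<open>compact K\<close>] by blast
  define Z where "Z = (K \<times> cball 0 (d2 / 2)) \<inter> (\<lambda>(x, z). Gc x z) -` {0}"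
  have "closedin (top_of_set (K \<times> cball 0 (d2 / 2))) Z"
    unfolding Z_def using d2
    by (intro continuous_closedin_preimage continuous_on_subset[OF Gc(1)]) auto
  then have "compact Z"
    by (intro closedin_compact[OF compact_Times[OF \<open>compact K\<close> compact_cball]])
  then have "closed (snd ` Z)"
    by (intro compact_imp_closed compact_continuous_image continuous_intros)
  moreover have "0 \<notin> snd ` Z"
  proof
    assume "0 \<in> snd ` Z"
    then obtain x where "x \<in> K" "Gc x 0 = 0" by (auto simp: Z_def)
    then show False using Gc(3)[of x 0] d2 G0[of x] by auto
  qed
  ultimately obtain d3 where d3: "d3 > 0" "ball 0 d3 \<subseteq> - snd ` Z"
    by (metis ComplI open_Compl open_contains_ball)
  define \<delta> where "\<delta> = min d1 (min (d2 / 2) d3)"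
  have \<delta>: "\<delta> > 0" "\<delta> \<le> d1" "\<delta> \<le> d2" using d1 d2 d3 by (auto simp: \<delta>_def)
  have Gn: "Gc x z \<noteq> 0" if "x \<in> K" "z \<in> ball 0 \<delta>" for x z
  proof
    assume "Gc x z = 0"
    then have "(x, z) \<in> Z" using that by (auto simp: Z_def \<delta>_def)
    then have "z \<in> snd ` Z" by force
    then show False using d3 that by (auto simp: \<delta>_def)
  qed
  show thesis
  proof (rule that[OF \<delta>(1)])
    have "continuous_on (K \<times> ball 0 \<delta>) (\<lambda>w. (\<lambda>(x, z). Fc x z) w / (\<lambda>(x, z). Gc x z) w)"
      using \<delta> Gn by (intro continuous_intros continuous_on_subset[OF Fc(1)] continuous_on_subset[OF Gc(1)]) auto
    then show "continuous_on (K \<times> ball 0 \<delta>) (\<lambda>(x, z). Fc x z / Gc x z)"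
      by (simp add: case_prod_unfold)
    show "(\<lambda>z. Fc x z / Gc x z) holomorphic_on ball 0 \<delta>" if "x \<in> K" for x
      using Gn that holomorphic_on_subset[OF Fc(2)[OF that] subset_ball[OF \<delta>(2)]]
        holomorphic_on_subset[OF Gc(2)[OF that] subset_ball[OF \<delta>(3)]]
      by (intro holomorphic_on_divide) auto
    show "Fc x 0 / Gc x 0 = 0" if "x \<in> K" for x
      using Fc(3)[OF that, of 0] F0[OF that] d1 by simp
    show "Fc x (of_real y) / Gc x (of_real y) = of_real (F x y / G x y)" if "x \<in> K" "\<bar>y\<bar> < \<delta>" for x y
      using Fc(3)[of x y] Gc(3)[of x y] that \<delta> by simp
  qed
qed

subsection \<open>Trajectory arcs and weighted polar coordinates\<close>

text \<open>Since \<open>gradient\<close> is a choice, some derivative has to be exhibited: the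
  vector of the linear coefficients. For the terms of degree at least two,
  \<open>norm h ^ (i + j)\<close> is at most \<open>\<rho> ^ (i + j)\<close> times the square of
  \<open>norm h / \<rho>\<close>, so the convergent majorant at offset \<rho> bounds the remainder
  quadratically.\<close>

lemma real_analytic_has_gradient:
  assumes "real_analytic_on f S" "z \<in> S"
  shows "GDERIV f z :> gradient f z"
proof -
  obtain x0 y0 where z: "z = (x0, y0)" by (cases z)
  obtain r c where r: "r > 0" and F: "\<And>x y. \<bar>x - x0\<bar> < r \<Longrightarrow> \<bar>y - y0\<bar> < r \<Longrightarrow>
      ((\<lambda>(i, j). c (i, j) * (x - x0) ^ i * (y - y0) ^ j) has_sum f (x, y)) UNIV"
    using assms z unfolding real_analytic_on_def by blast
  define \<rho> where "\<rho> = r / 2"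
  have \<rho>: "\<rho> > 0" "\<rho> < r" using r by (auto simp: \<rho>_def)
  define m where "m = (\<lambda>(i, j). \<bar>c (i, j)\<bar> * \<rho> ^ i * \<rho> ^ j)"
  \<comment> \<open>The indices of total degree at most one; \<open>M\<close> sums the majorant over
    all other indices.\<close>
  define A where "A = {(0, 0), (Suc 0, 0), (0, Suc 0)}"
  define v where "v = (c (1, 0), c (0, 1))"
  have "m summable_on UNIV"
    unfolding m_def using \<rho> F[of "x0 + \<rho>" "y0 + \<rho>"] by (intro double_series_majorant) auto
  then have "m summable_on (UNIV - A)"
    by (rule summable_on_subset_banach) simp
  then obtain M where M: "(m has_sum M) (UNIV - A)" by (auto simp: summable_on_def)
  have f_at_z: "f z = c (0, 0)"
  proof -
    have "((\<lambda>(i, j). c (i, j) * (0::real) ^ i * 0 ^ j) has_sum f z) UNIV"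
      using F[of x0 y0] r by (simp add: z)
    moreover have "((\<lambda>(i, j). c (i, j) * (0::real) ^ i * 0 ^ j) has_sum c (0, 0)) UNIV"
      by (rule has_sum_cong_neutral[THEN iffD1, OF _ _ _ has_sum_finite[of "{(0, 0)}" "\<lambda>(i, j). c (i, j) * (0::real) ^ i * 0 ^ j", simplified]])
        (auto simp: power_0_left split: if_splits)
    ultimately show ?thesis by (rule has_sum_unique)
  qed
  have quad: "\<bar>f (z + h) - f z - h \<bullet> v\<bar> \<le> (norm h / \<rho>)\<^sup>2 * M" if h: "norm h \<le> \<rho>" for h
  proof -
    obtain h1 h2 where hh: "h = (h1, h2)" by (cases h)
    have hb: "\<bar>h1\<bar> \<le> norm h" "\<bar>h2\<bar> \<le> norm h"
      unfolding hh using norm_fst_le[of h1 h2] norm_snd_le[of h2 h1] by auto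
    define T where "T = (\<lambda>(i, j). c (i, j) * h1 ^ i * h2 ^ j)"
    have "(T has_sum f (z + h)) UNIV"
      using F[of "x0 + h1" "y0 + h2"] hb h \<rho> by (simp add: T_def z hh)
    moreover have "(T has_sum sum T A) A" by (rule has_sum_finite) (simp add: A_def)
    ultimately have "(T has_sum f (z + h) - sum T A) (UNIV - A)"
      by (intro has_sum_Diff) auto
    moreover have "sum T A = f z + h \<bullet> v"
      by (simp add: A_def T_def f_at_z v_def hh)
    ultimately have S: "(T has_sum f (z + h) - f z - h \<bullet> v) (UNIV - A)"
      by (simp add: algebra_simps)
    have S': "((\<lambda>k. - T k) has_sum - (f (z + h) - f z - h \<bullet> v)) (UNIV - A)"
      unfolding has_sum_uminus using S by simp
    have B: "((\<lambda>k. (norm h / \<rho>)\<^sup>2 * m k) has_sum (norm h / \<rho>)\<^sup>2 * M) (UNIV - A)"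
      by (intro has_sum_cmult_right M)
    have bd: "\<bar>T k\<bar> \<le> (norm h / \<rho>)\<^sup>2 * m k" if "k \<in> UNIV - A" for k
    proof -
      obtain i j where k: "k = (i, j)" by (cases k)
      have ij: "2 \<le> i + j" using that by (cases i; cases j; auto simp: A_def k)
      have "\<bar>T k\<bar> = \<bar>c (i, j)\<bar> * (\<bar>h1\<bar> ^ i * \<bar>h2\<bar> ^ j)"
        by (simp add: T_def k abs_mult power_abs)
      also have "\<dots> \<le> \<bar>c (i, j)\<bar> * (norm h ^ i * norm h ^ j)"
        using hb by (intro mult_left_mono mult_mono power_mono) auto
      also have "\<dots> = \<bar>c (i, j)\<bar> * \<rho> ^ i * \<rho> ^ j * (norm h / \<rho>) ^ (i + j)"
        using \<rho> by (simp add: power_add power_divide)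
      also have "\<dots> \<le> \<bar>c (i, j)\<bar> * \<rho> ^ i * \<rho> ^ j * (norm h / \<rho>)\<^sup>2"
        using ij h \<rho> by (intro mult_left_mono power_decreasing) auto
      finally show ?thesis by (simp add: m_def k mult.commute)
    qed
    have "f (z + h) - f z - h \<bullet> v \<le> (norm h / \<rho>)\<^sup>2 * M"
      by (rule has_sum_mono[OF S B]) (use bd abs_le_D1 in blast)
    moreover have "- (f (z + h) - f z - h \<bullet> v) \<le> (norm h / \<rho>)\<^sup>2 * M"
      by (rule has_sum_mono[OF S' B]) (use bd abs_le_D2 in blast)
    ultimately show ?thesis by linarith
  qed
  have "GDERIV f z :> v"
    unfolding gderiv_def
  proof (rule has_derivativeI_sandwich[of \<rho>])
    show "bounded_linear (\<lambda>h. h \<bullet> v)" by (rule bounded_linear_inner_left)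
    show "norm (f y - f z - (y - z) \<bullet> v) / norm (y - z) \<le> norm (y - z) * (M / \<rho>\<^sup>2)"
      if "y \<noteq> z" "dist y z < \<rho>" for y
    proof -
      have "\<bar>f y - f z - (y - z) \<bullet> v\<bar> \<le> (norm (y - z) / \<rho>)\<^sup>2 * M"
        using quad[of "y - z"] that by (simp add: dist_norm)
      then show ?thesis using that by (simp add: field_simps power2_eq_square)
    qed
    have "((\<lambda>y. norm (y - z) * (M / \<rho>\<^sup>2)) \<longlongrightarrow> norm (z - z) * (M / \<rho>\<^sup>2)) (at z)"
      by (intro tendsto_intros)
    then show "((\<lambda>y. norm (y - z) * (M / \<rho>\<^sup>2)) \<longlongrightarrow> 0) (at z)" by simp
  qed (fact \<rho>(1))
  then show ?thesis
    unfolding gradient_def by (rule someI)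
qed

text \<open>Differentiability is assumed at \<open>t\<close> only, so the comparison is between
  points on opposite sides of \<open>t\<close>. There the two remainders add up to at most half of
  \<open>(s' - s) * norm v\<close>, while equal values of the curve would make them account for all
  of it.\<close>

lemma locally_injective_if_derivative_nonzero:
  fixes \<gamma> :: "real \<Rightarrow> 'a::real_normed_vector"
  assumes "(\<gamma> has_vector_derivative v) (at t within S)" "v \<noteq> 0"
  obtains d where "d > 0" "\<And>s s'. s \<in> S \<Longrightarrow> s' \<in> S \<Longrightarrow> s \<le> t \<Longrightarrow> t \<le> s' \<Longrightarrow> t - s < d \<Longrightarrow> s' - t < d \<Longrightarrow>
      \<gamma> s = \<gamma> s' \<Longrightarrow> s = s'"
proof -
  have "norm v / 2 > 0" using assms by simp
  then obtain d where d: "d > 0" "\<And>y. y \<in> S \<Longrightarrow> norm (y - t) < d \<Longrightarrow>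
      norm (\<gamma> y - \<gamma> t - (y - t) *\<^sub>R v) \<le> norm v / 2 * norm (y - t)"
    using assms(1) unfolding has_vector_derivative_def has_derivative_within_alt by blast
  show thesis
  proof (rule that[OF d(1)])
    fix s s' assume s: "s \<in> S" "s' \<in> S" "s \<le> t" "t \<le> s'" "t - s < d" "s' - t < d" "\<gamma> s = \<gamma> s'"
    have "(s' - s) *\<^sub>R v = (\<gamma> s - \<gamma> t - (s - t) *\<^sub>R v) - (\<gamma> s' - \<gamma> t - (s' - t) *\<^sub>R v)"
      using s(7) by (simp add: algebra_simps)
    then have "norm ((s' - s) *\<^sub>R v) \<le> norm v / 2 * norm (s - t) + norm v / 2 * norm (s' - t)"
      using d(2)[of s] d(2)[of s'] s norm_triangle_ineq4 by (smt (verit) real_norm_def)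
    also have "\<dots> = norm v / 2 * ((t - s) + (s' - t))" using s by (simp only: distrib_left) simp
    also have "\<dots> = norm v / 2 * (s' - s)" by simp
    finally have "(s' - s) * norm v \<le> 0" using s by (simp add: mult.commute)
    then show "s = s'" using s assms(2) by (simp add: mult_le_0_iff)
  qed
qed

text \<open>As in Rolle's theorem: if both extrema are attained at the ends only, the function is
  constant and the midpoint serves.\<close>

lemma interior_extremum:
  fixes \<kappa> :: "real \<Rightarrow> real"
  assumes "a < b" "continuous_on {a..b} \<kappa>" "\<kappa> a = \<kappa> b"
  obtains t where "a < t" "t < b" "(\<forall>x\<in>{a..b}. \<kappa> x \<le> \<kappa> t) \<or> (\<forall>x\<in>{a..b}. \<kappa> t \<le> \<kappa> x)"
proof -
  have ne: "{a..b} \<noteq> {}" using assms by auto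
  obtain M where M: "M \<in> {a..b}" "\<And>x. x \<in> {a..b} \<Longrightarrow> \<kappa> x \<le> \<kappa> M"
    using continuous_attains_sup[OF compact_Icc ne assms(2)] by blast
  obtain m where m: "m \<in> {a..b}" "\<And>x. x \<in> {a..b} \<Longrightarrow> \<kappa> m \<le> \<kappa> x"
    using continuous_attains_inf[OF compact_Icc ne assms(2)] by blast
  consider "a < M" "M < b" | "a < m" "m < b" | "M \<in> {a, b}" "m \<in> {a, b}"
    using M m by force
  then show thesis
  proof cases
    case 3
    then have "\<kappa> M = \<kappa> m" using assms(3) by auto
    then have "\<kappa> x \<le> \<kappa> ((a + b) / 2)" if "x \<in> {a..b}" for x
      using M(2)[OF that] m(2)[of "(a + b) / 2"] \<open>a < b\<close> by auto
    then show thesis using that[of "(a + b) / 2"] \<open>a < b\<close> by auto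
  qed (use M m that in blast)+
qed

text \<open>Of the values at \<open>t - e\<close> and \<open>t + e\<close>, the larger one is taken
  again on the other side of \<open>t\<close>, by the intermediate value theorem between there and
  the maximum. So a value repeats across \<open>t\<close> at arbitrarily small distance.\<close>

lemma fold_at_maximum:
  fixes \<kappa> :: "real \<Rightarrow> real"
  assumes "continuous_on {a..b} \<kappa>" "a < t" "t < b" "\<And>x. x \<in> {a..b} \<Longrightarrow> \<kappa> x \<le> \<kappa> t" "d > 0"
  obtains s s' where "s \<in> {a..b}" "s' \<in> {a..b}" "s \<le> t" "t \<le> s'" "s < s'" "t - s < d" "s' - t < d"
    "\<kappa> s = \<kappa> s'"
proof -
  define e where "e = min (d / 2) (min (t - a) (b - t))"
  have e: "e > 0" "e < d" "e \<le> t - a" "e \<le> b - t" using assms by (auto simp: e_def min_def)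
  show thesis
  proof (cases "\<kappa> (t - e) \<le> \<kappa> (t + e)")
    case True
    have "\<exists>x\<ge>t - e. x \<le> t \<and> \<kappa> x = \<kappa> (t + e)"
      by (rule IVT'[of \<kappa> "t - e" "\<kappa> (t + e)" t]) (use e assms True in \<open>auto intro: continuous_on_subset\<close>)
    then obtain x where "t - e \<le> x" "x \<le> t" "\<kappa> x = \<kappa> (t + e)" by blast
    then show thesis using that[of x "t + e"] e by auto
  next
    case False
    have "\<exists>x\<ge>t. x \<le> t + e \<and> \<kappa> x = \<kappa> (t - e)"
      by (rule IVT2') (use e assms False in \<open>auto intro: continuous_on_subset\<close>)
    then obtain x where "t \<le> x" "x \<le> t + e" "\<kappa> x = \<kappa> (t - e)" by blast
    then show thesis using that[of "t - e" x] e by auto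
  qed
qed

text \<open>A curve with nonvanishing velocity cannot turn back inside an arc: at an interior extremum of
  its parameter on the arc it would fail to be locally injective.\<close>

lemma arc_parametrization_endpoints:
  fixes \<gamma> \<Gamma> :: "real \<Rightarrow> 'a::real_normed_vector"
  assumes "a < b" "\<alpha> < \<beta>"
    and \<Gamma>: "continuous_on {\<alpha>..\<beta>} \<Gamma>" "inj_on \<Gamma> {\<alpha>..\<beta>}"
    and \<gamma>: "\<And>t. t \<in> {a..b} \<Longrightarrow> (\<gamma> has_vector_derivative v t) (at t within {a..b})"
           "\<And>t. t \<in> {a..b} \<Longrightarrow> v t \<noteq> 0"
    and im: "\<gamma> ` {a..b} = \<Gamma> ` {\<alpha>..\<beta>}"
  shows "\<gamma> a = \<Gamma> \<alpha> \<and> \<gamma> b = \<Gamma> \<beta> \<or> \<gamma> a = \<Gamma> \<beta> \<and> \<gamma> b = \<Gamma> \<alpha>"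
    and "\<gamma> ` {a<..<b} \<subseteq> \<Gamma> ` {\<alpha><..<\<beta>}"
proof -
  obtain g where g: "homeomorphism {\<alpha>..\<beta>} (\<Gamma> ` {\<alpha>..\<beta>}) \<Gamma> g"
    using homeomorphism_compact[OF compact_Icc \<Gamma>(1) refl \<Gamma>(2)] by blast
  \<comment> \<open>The position along \<Gamma> as a function of time. The inverse \<open>g\<close>
    is continuous because the parameter interval is compact, so this function is continuous although
    it need not be differentiable.\<close>
  define \<kappa> where "\<kappa> = g \<circ> \<gamma>"
  have \<gamma>c: "continuous_on {a..b} \<gamma>"
    using \<gamma>(1) by (meson continuous_on_vector_derivative)
  have \<kappa>c: "continuous_on {a..b} \<kappa>"
    unfolding \<kappa>_def using g im \<gamma>c by (intro continuous_on_compose) (auto simp: homeomorphism_def)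
  have \<kappa>im: "\<kappa> ` {a..b} = {\<alpha>..\<beta>}"
    unfolding \<kappa>_def image_comp[symmetric] im using g by (simp add: homeomorphism_def)
  have \<Gamma>\<kappa>: "\<Gamma> (\<kappa> t) = \<gamma> t" if "t \<in> {a..b}" for t
    using g im that unfolding homeomorphism_def \<kappa>_def by (metis comp_apply imageI)
  have nofold: False if t: "s1 \<in> {a..b}" "s2 \<in> {a..b}" "s1 < s2" "\<kappa> s1 = \<kappa> s2" for s1 s2
  proof -
    have sub: "{s1..s2} \<subseteq> {a..b}" using t by auto
    have c: "continuous_on {s1..s2} \<kappa>" using \<kappa>c sub by (rule continuous_on_subset)
    obtain t where t: "s1 < t" "t < s2" and
      ext: "(\<forall>x\<in>{s1..s2}. \<kappa> x \<le> \<kappa> t) \<or> (\<forall>x\<in>{s1..s2}. - \<kappa> x \<le> - \<kappa> t)"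
      using interior_extremum[OF t(3) c t(4)] by auto
    have "t \<in> {a..b}" using t sub by auto
    from locally_injective_if_derivative_nonzero[OF \<gamma>(1)[OF this] \<gamma>(2)[OF this]]
    obtain d where d: "d > 0" "\<And>s s'. s \<in> {a..b} \<Longrightarrow> s' \<in> {a..b} \<Longrightarrow> s \<le> t \<Longrightarrow> t \<le> s' \<Longrightarrow>
        t - s < d \<Longrightarrow> s' - t < d \<Longrightarrow> \<gamma> s = \<gamma> s' \<Longrightarrow> s = s'" by blast
    obtain s s' where "s \<in> {s1..s2}" "s' \<in> {s1..s2}" "s \<le> t" "t \<le> s'" "s < s'" "t - s < d" "s' - t < d"
      "\<kappa> s = \<kappa> s'"
      using ext
    proof
      assume *: "\<forall>x\<in>{s1..s2}. \<kappa> x \<le> \<kappa> t"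
      show thesis by (rule fold_at_maximum[OF c t _ d(1)]) (use * that in auto)
    next
      assume *: "\<forall>x\<in>{s1..s2}. - \<kappa> x \<le> - \<kappa> t"
      show thesis
        by (rule fold_at_maximum[OF continuous_on_minus[OF c] t _ d(1)]) (use * that in auto)
    qed
    then show False using d(2)[of s s'] \<Gamma>\<kappa>[of s] \<Gamma>\<kappa>[of s'] sub by auto
  qed
  have inj: "inj_on \<kappa> {a..b}"
    by (rule inj_onI) (metis nofold linorder_neqE_linordered_idom)
  \<comment> \<open>Continuity and injectivity on an interval give strict monotonicity, so interior
    times have interior parameters. As \<kappa> is onto, the two end parameters can only be taken at
    the two end times.\<close>
  have between: "\<alpha> < \<kappa> t \<and> \<kappa> t < \<beta>" if "t \<in> {a<..<b}" for t
  proof -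
    have "\<kappa> a < \<kappa> t \<and> \<kappa> t < \<kappa> b \<or> \<kappa> b < \<kappa> t \<and> \<kappa> t < \<kappa> a"
      using continuous_inj_imp_mono[OF _ _ \<kappa>c inj, of t] that by auto
    moreover have "\<kappa> a \<in> {\<alpha>..\<beta>}" "\<kappa> b \<in> {\<alpha>..\<beta>}"
      using \<kappa>im \<open>a < b\<close> by (metis atLeastAtMost_iff imageI less_imp_le order_refl)+
    ultimately show ?thesis by auto
  qed
  show "\<gamma> ` {a<..<b} \<subseteq> \<Gamma> ` {\<alpha><..<\<beta>}"
  proof
    fix x assume "x \<in> \<gamma> ` {a<..<b}"
    then obtain t where "t \<in> {a<..<b}" "x = \<gamma> t" by auto
    then show "x \<in> \<Gamma> ` {\<alpha><..<\<beta>}"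
      using between[of t] \<Gamma>\<kappa>[of t] by (auto intro!: image_eqI[of _ _ "\<kappa> t"])
  qed
  have endp: "\<exists>t\<in>{a, b}. \<kappa> t = x" if "x \<in> {\<alpha>, \<beta>}" for x
  proof -
    have "x \<in> \<kappa> ` {a..b}" using that \<kappa>im \<open>\<alpha> < \<beta>\<close> by auto
    then obtain t where "t \<in> {a..b}" "\<kappa> t = x" by auto
    then show ?thesis using between[of t] that by (cases "t \<in> {a<..<b}") auto
  qed
  have "\<kappa> a = \<alpha> \<and> \<kappa> b = \<beta> \<or> \<kappa> a = \<beta> \<and> \<kappa> b = \<alpha>"
    using endp[of \<alpha>] endp[of \<beta>] \<open>\<alpha> < \<beta>\<close> by auto
  then show "\<gamma> a = \<Gamma> \<alpha> \<and> \<gamma> b = \<Gamma> \<beta> \<or> \<gamma> a = \<Gamma> \<beta> \<and> \<gamma> b = \<Gamma> \<alpha>"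
    using \<Gamma>\<kappa>[of a] \<Gamma>\<kappa>[of b] \<open>a < b\<close> by auto
qed

text \<open>With different weights there is no norm that reads off the radius. Instead, if a point
  had two radii, the larger radius would go with a cosine and a sine that are no larger in absolute
  value and strictly smaller where nonzero, against \<open>sin_cos_squared_add\<close>. Once the
  radius is known, the cosine fixes the angle in the upper half.\<close>

lemma weighted_polar_inj_on:
  assumes "k > 0" "l > 0"
  shows "inj_on (weighted_polar k l) ({0..pi} \<times> {0<..})"
proof -
  have le: "\<rho>' \<le> \<rho>" if eq: "weighted_polar k l (\<theta>, \<rho>) = weighted_polar k l (\<theta>', \<rho>')" and "\<rho> > 0" "\<rho>' > 0"
    for \<theta> \<theta>' \<rho> \<rho>'
  proof (rule ccontr)
    assume "\<not> \<rho>' \<le> \<rho>"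
    then have p: "\<rho> ^ k < \<rho>' ^ k" "\<rho> ^ l < \<rho>' ^ l"
      using assms \<open>\<rho> > 0\<close> by (auto intro!: power_strict_mono)
    have e: "\<rho> ^ k * cos \<theta> = \<rho>' ^ k * cos \<theta>'" "\<rho> ^ l * sin \<theta> = \<rho>' ^ l * sin \<theta>'"
      using eq by (auto simp: weighted_polar_def)
    have sm: "\<bar>u'\<bar> \<le> \<bar>u\<bar> \<and> (u' \<noteq> 0 \<longrightarrow> \<bar>u'\<bar> < \<bar>u\<bar>)" if "x * u = x' * u'" "0 < x" "x < x'" for x x' u u' :: real
    proof (cases "u' = 0")
      case False
      have "x' * \<bar>u'\<bar> = x * \<bar>u\<bar>" using that by (metis abs_mult abs_of_pos less_trans)
      moreover have "x * \<bar>u'\<bar> < x' * \<bar>u'\<bar>" using that False by simp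
      ultimately have "\<bar>u'\<bar> < \<bar>u\<bar>" using that by (metis mult_less_cancel_left_pos)
      then show ?thesis by simp
    qed (use that in auto)
    have c: "\<bar>cos \<theta>'\<bar> \<le> \<bar>cos \<theta>\<bar> \<and> (cos \<theta>' \<noteq> 0 \<longrightarrow> \<bar>cos \<theta>'\<bar> < \<bar>cos \<theta>\<bar>)"
      and s: "\<bar>sin \<theta>'\<bar> \<le> \<bar>sin \<theta>\<bar> \<and> (sin \<theta>' \<noteq> 0 \<longrightarrow> \<bar>sin \<theta>'\<bar> < \<bar>sin \<theta>\<bar>)"
      using sm[OF e(1)] sm[OF e(2)] p \<open>\<rho> > 0\<close> by auto
    have lt: "x\<^sup>2 < y\<^sup>2 \<longleftrightarrow> \<bar>x\<bar> < \<bar>y\<bar>" for x y :: real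
      by (metis abs_le_square_iff linorder_not_le)
    have "(sin \<theta>')\<^sup>2 + (cos \<theta>')\<^sup>2 < (sin \<theta>)\<^sup>2 + (cos \<theta>)\<^sup>2"
    proof (cases "cos \<theta>' = 0")
      case True
      then have "sin \<theta>' \<noteq> 0" using sin_cos_squared_add[of \<theta>'] by force
      then show ?thesis using c s
        by (intro add_less_le_mono) (auto simp: abs_le_square_iff[symmetric] lt)
    next
      case False
      then show ?thesis using c s
        by (intro add_le_less_mono) (auto simp: abs_le_square_iff[symmetric] lt)
    qed
    then show False by simp
  qed
  show ?thesis
  proof (rule inj_onI)
    fix w w' assume w: "w \<in> {0..pi} \<times> {0<..}" "w' \<in> {0..pi} \<times> {0<..}"
      and eq': "weighted_polar k l w = weighted_polar k l w'"
    obtain \<theta> \<rho> \<theta>' \<rho>' where ww: "w = (\<theta>, \<rho>)" "w' = (\<theta>', \<rho>')" by (cases w, cases w')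
    then have m: "\<theta> \<in> {0..pi}" "\<theta>' \<in> {0..pi}" "\<rho> \<in> {0<..}" "\<rho>' \<in> {0<..}"
      using w by auto
    note eq = eq'[unfolded ww]
    have \<rho>: "\<rho> = \<rho>'" using le[OF eq] le[OF eq[symmetric]] m by auto
    then have "cos \<theta> = cos \<theta>'" using eq m by (auto simp: weighted_polar_def)
    then show "w = w'" using m \<rho> cos_inj_pi ww by auto
  qed
qed

text \<open>The radius of \<open>(x, y)\<close> is a solution of \<open>N \<rho> = 1\<close>, where
  \<open>N\<close> is the sum of the squares that should be cosine and sine. It is found by the
  intermediate value theorem, and the angle is then an arc cosine.\<close>

lemma weighted_polar_covers:
  assumes "k > 0" "l > 0" "e > 0"
  obtains m where "m > 0" "\<And>x y. \<bar>x\<bar> < m \<Longrightarrow> \<bar>y\<bar> < m \<Longrightarrow> y \<ge> 0 \<Longrightarrow> (x, y) \<noteq> (0, 0) \<Longrightarrow>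
    (x, y) \<in> weighted_polar k l ` ({0..pi} \<times> {0<..<e})"
proof -
  define e' where "e' = e / 2"
  have e': "e' > 0" "e' < e" using assms by (auto simp: e'_def)
  \<comment> \<open>Half of the powers, so that both quotients at radius \<open>e'\<close> are at
    most \<open>1 / 2\<close> and \<open>N e'\<close> is at most \<open>1\<close>.\<close>
  define m where "m = min (e' ^ k) (e' ^ l) / 2"
  show thesis
  proof (rule that)
    show "m > 0" using e' by (simp add: m_def)
    fix x y :: real assume xy: "\<bar>x\<bar> < m" "\<bar>y\<bar> < m" "y \<ge> 0" "(x, y) \<noteq> (0, 0)"
    define N where "N \<rho> = (x / \<rho> ^ k)\<^sup>2 + (y / \<rho> ^ l)\<^sup>2" for \<rho>
    \<comment> \<open>Being at most \<open>1\<close>, this radius dominates its own positive powers;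
      being at most the larger coordinate, it makes one of the two squares in \<open>N\<close> at
      least \<open>1\<close>.\<close>
    define \<rho>1 where "\<rho>1 = min (min e' 1) (max \<bar>x\<bar> \<bar>y\<bar>)"
    have \<rho>1: "\<rho>1 > 0" "\<rho>1 \<le> e'" "\<rho>1 \<le> 1" "\<rho>1 \<le> \<bar>x\<bar> \<or> \<rho>1 \<le> \<bar>y\<bar>" using xy e' by (auto simp: \<rho>1_def)
    have pw: "\<rho>1 ^ n \<le> \<rho>1" if "n > 0" for n
      using power_decreasing[of 1 n \<rho>1] \<rho>1 that by auto
    have big: "1 \<le> (u / \<rho>1 ^ n)\<^sup>2" if "\<rho>1 \<le> \<bar>u\<bar>" "n > 0" for u n
    proof -
      have "1 \<le> \<bar>u / \<rho>1 ^ n\<bar>" using pw[OF that(2)] that \<rho>1 by (simp add: abs_divide)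
      then show ?thesis by (metis one_power2 abs_le_square_iff abs_one)
    qed
    have small: "(u / e' ^ n)\<^sup>2 \<le> 1 / 4" if "\<bar>u\<bar> < e' ^ n / 2" for u n
    proof -
      have "\<bar>u / e' ^ n\<bar> \<le> \<bar>1 / 2\<bar>" using that e' by (simp add: abs_divide field_simps)
      then have "(u / e' ^ n)\<^sup>2 \<le> (1 / 2)\<^sup>2" by (simp only: abs_le_square_iff)
      then show ?thesis by (simp add: power2_eq_square)
    qed
    have "N e' \<le> 1"
      using small[of x k] small[of y l] xy by (auto simp: N_def m_def)
    moreover have "1 \<le> N \<rho>1"
      using \<rho>1(4) big[of x k] big[of y l] assms
      by (auto simp: N_def intro: add_increasing add_increasing2)
    moreover have "continuous_on {\<rho>1..e'} N"
      unfolding N_def using \<rho>1 by (auto intro!: continuous_intros)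
    ultimately obtain \<rho> where \<rho>: "\<rho>1 \<le> \<rho>" "\<rho> \<le> e'" "N \<rho> = 1"
      using IVT2'[of N e' 1 \<rho>1] \<rho>1 by blast
    then have pos: "\<rho> > 0" using \<rho>1 by simp
    have N1: "(y / \<rho> ^ l)\<^sup>2 = 1 - (x / \<rho> ^ k)\<^sup>2" using \<rho> by (simp add: N_def)
    have "(x / \<rho> ^ k)\<^sup>2 \<le> 1\<^sup>2" using N1 by (metis diff_ge_0_iff_ge one_power2 zero_le_power2)
    then have "\<bar>x / \<rho> ^ k\<bar> \<le> \<bar>1\<bar>" by (simp only: abs_le_square_iff)
    then have ab: "- 1 \<le> x / \<rho> ^ k" "x / \<rho> ^ k \<le> 1" unfolding abs_one abs_le_iff by linarith+
    define \<theta> where "\<theta> = arccos (x / \<rho> ^ k)"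
    have "sin \<theta> = sqrt ((y / \<rho> ^ l)\<^sup>2)"
      using ab by (simp add: \<theta>_def sin_arccos N1)
    also have "\<dots> = y / \<rho> ^ l" using pos xy by simp
    finally have "weighted_polar k l (\<theta>, \<rho>) = (x, y)"
      using pos ab by (simp add: weighted_polar_def \<theta>_def cos_arccos)
    moreover have "\<theta> \<in> {0..pi}" using ab by (auto simp: \<theta>_def arccos_lbound arccos_ubound)
    moreover have "\<rho> \<in> {0<..<e}" using pos \<rho> e' by auto
    ultimately show "(x, y) \<in> weighted_polar k l ` ({0..pi} \<times> {0<..<e})"
      by (intro image_eqI[of _ _ "(\<theta>, \<rho>)"]) auto
  qed
qed

subsection \<open>Half-return maps\<close>

text \<open>The complex flow restricted to real initial values. Gronwall's inequality is applied
  four times: to the imaginary part, so that solutions stay real; against the zero solution, so that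
  they stay positive; to two solutions, for the Lipschitz dependence; and to an arbitrary real
  solution, for uniqueness.\<close>

lemma polar_flow:
  assumes F: "real_analytic_on (\<lambda>(\<theta>, \<rho>). F \<theta> \<rho>) (UNIV \<times> {0})"
    and G: "real_analytic_on (\<lambda>(\<theta>, \<rho>). G \<theta> \<rho>) (UNIV \<times> {0})"
    and F0: "\<And>\<theta>. F \<theta> 0 = 0" and G0: "\<forall>\<theta>\<in>{0..T}. G \<theta> 0 \<noteq> 0" and T: "T \<ge> 0"
  obtains \<eta> C P \<sigma> where "\<eta> > 0" "C > 0" "P holomorphic_on ball 0 \<eta>"
    "\<And>\<rho>. \<rho> \<in> {0<..<\<eta>} \<Longrightarrow> P (complex_of_real \<rho>) = of_real (\<sigma> \<rho> T)"
    "\<And>\<rho>. \<rho> \<in> {0<..<\<eta>} \<Longrightarrow> \<sigma> \<rho> 0 = \<rho>"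
    "\<And>\<rho> t. \<rho> \<in> {0<..<\<eta>} \<Longrightarrow> t \<in> {0..T} \<Longrightarrow> \<sigma> \<rho> t > 0"
    "\<And>\<rho> t. \<rho> \<in> {0<..<\<eta>} \<Longrightarrow> t \<in> {0..T} \<Longrightarrow>
       (\<sigma> \<rho> has_real_derivative F t (\<sigma> \<rho> t) / G t (\<sigma> \<rho> t)) (at t within {0..T})"
    "\<And>\<rho> \<rho>' t. \<rho> \<in> {0<..<\<eta>} \<Longrightarrow> \<rho>' \<in> {0<..<\<eta>} \<Longrightarrow> t \<in> {0..T} \<Longrightarrow> \<bar>\<sigma> \<rho> t - \<sigma> \<rho>' t\<bar> \<le> C * \<bar>\<rho> - \<rho>'\<bar>"
    "\<And>\<tau> t. \<lbrakk>\<And>s. s \<in> {0..T} \<Longrightarrow> \<tau> s \<in> {0<..<\<eta>};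
       \<And>s. s \<in> {0..T} \<Longrightarrow> (\<tau> has_real_derivative F s (\<tau> s) / G s (\<tau> s)) (at s within {0..T});
       t \<in> {0..T}\<rbrakk> \<Longrightarrow> \<tau> t = \<sigma> (\<tau> 0) t"
proof -
  let ?I = "{0..T}"
  have FG: "real_analytic_on (\<lambda>(\<theta>, \<rho>). F \<theta> \<rho>) (?I \<times> {0})" "real_analytic_on (\<lambda>(\<theta>, \<rho>). G \<theta> \<rho>) (?I \<times> {0})"
    using F G unfolding real_analytic_on_def by blast+
  obtain d R where d: "d > 0" and R: "continuous_on (?I \<times> ball 0 d) (\<lambda>(s, z). R s z)"
    "\<And>s. s \<in> ?I \<Longrightarrow> R s holomorphic_on ball 0 d" "\<And>s. s \<in> ?I \<Longrightarrow> R s 0 = 0"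
    "\<And>s y. s \<in> ?I \<Longrightarrow> \<bar>y\<bar> < d \<Longrightarrow> R s (complex_of_real y) = of_real (F s y / G s y)"
    using complexified_quotient[OF FG compact_Icc F0 G0[rule_format]] by blast
  \<comment> \<open>The Lipschitz constant is taken on a compact disc, which has to fit inside the
    open disc where \<open>R\<close> is holomorphic.\<close>
  define \<delta> where "\<delta> = d / 2"
  have \<delta>: "\<delta> > 0" "\<delta> < d" using d by (auto simp: \<delta>_def)
  obtain L where L: "L > 0" and "\<And>s z w. s \<in> ?I \<Longrightarrow> z \<in> cball 0 \<delta> \<Longrightarrow> w \<in> cball 0 \<delta> \<Longrightarrow>
      norm (R s z - R s w) \<le> L * norm (z - w)"
    using holomorphic_family_lipschitz[OF R(1) compact_Icc open_ball R(2) compact_cball[of 0 \<delta>] convex_cball] \<delta>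
    by (auto simp: cball_subset_ball_iff)
  then have lip: "norm (R s z - R s w) \<le> L * norm (z - w)"
    if "s \<in> ?I" "z \<in> ball 0 \<delta>" "w \<in> ball 0 \<delta>" for s z w using that by auto
  \<comment> \<open>Growth up to time \<open>T\<close> is by at most the factor
    \<open>exp (L * T)\<close>; initial values below this bound stay within radius \<delta>.\<close>
  define \<eta> where "\<eta> = \<delta> * exp (- (L * T))"
  have \<eta>: "\<eta> > 0" "\<eta> \<le> \<delta>" "\<eta> * exp (L * T) \<le> \<delta>"
    using \<delta> L T by (auto simp: \<eta>_def mult.assoc exp_add[symmetric] mult_le_cancel_left1)
  have R\<delta>: "continuous_on (?I \<times> ball 0 \<delta>) (\<lambda>(s, z). R s z)"
    by (rule continuous_on_subset[OF R(1)]) (use \<delta> in auto)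
  have Rh: "R s holomorphic_on ball 0 \<delta>" if "s \<in> ?I" for s
    by (rule holomorphic_on_subset[OF R(2)[OF that]]) (use \<delta> in auto)
  obtain \<phi> where \<phi>D: "\<And>t z. t \<in> ?I \<Longrightarrow> z \<in> ball 0 \<eta> \<Longrightarrow> \<phi> t z \<in> ball 0 \<delta>"
    and \<phi>0: "\<And>z. z \<in> ball 0 \<eta> \<Longrightarrow> \<phi> 0 z = z"
    and \<phi>': "\<And>t z. t \<in> ?I \<Longrightarrow> z \<in> ball 0 \<eta> \<Longrightarrow>
       ((\<lambda>t. \<phi> t z) has_vector_derivative R t (\<phi> t z)) (at t within ?I)"
    and \<phi>h: "\<And>t. t \<in> ?I \<Longrightarrow> \<phi> t holomorphic_on ball 0 \<eta>"
    using holomorphic_flow[OF R\<delta> Rh R(3) lip L \<eta>(3)] by blast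
  have grow: "norm (u t - w t) \<le> exp (L * \<bar>t - s\<bar>) * norm (u s - w s)"
    if "\<And>t. t \<in> ?I \<Longrightarrow> u t \<in> ball 0 \<delta>" "\<And>t. t \<in> ?I \<Longrightarrow> w t \<in> ball 0 \<delta>"
      "\<And>t. t \<in> ?I \<Longrightarrow> (u has_vector_derivative R t (u t)) (at t within ?I)"
      "\<And>t. t \<in> ?I \<Longrightarrow> (w has_vector_derivative R t (w t)) (at t within ?I)"
      "s \<in> ?I" "t \<in> ?I" for u w s t
    by (rule norm_growth[where v = "\<lambda>t. u t - w t" and v' = "\<lambda>t. R t (u t) - R t (w t)" and a = 0 and b = T])
      (use that lip in \<open>auto intro!: has_vector_derivative_diff\<close>)
  have b: "complex_of_real \<rho> \<in> ball 0 \<eta>" if "\<rho> \<in> {0<..<\<eta>}" for \<rho> using that by simp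
  \<comment> \<open>\<open>R\<close> is real on the real axis, so the imaginary part of
    \<open>R\<close> at a point is at most \<open>L\<close> times the distance to its real part. The
    imaginary part of a solution thus satisfies a linear growth bound and starts at zero.\<close>
  have Im0: "Im (\<phi> t (of_real \<rho>)) = 0" if t: "t \<in> ?I" and \<rho>: "\<rho> \<in> {0<..<\<eta>}" for t \<rho>
  proof -
    let ?u = "\<lambda>t. \<phi> t (of_real \<rho>)"
    have "norm (Im (?u t)) \<le> exp (L * \<bar>t - 0\<bar>) * norm (Im (?u 0))"
    proof (rule norm_growth[where v = "\<lambda>t. Im (?u t)" and v' = "\<lambda>t. Im (R t (?u t))" and a = 0 and b = T])
      fix s assume s: "s \<in> ?I"
      show "((\<lambda>t. Im (?u t)) has_vector_derivative Im (R s (?u s))) (at s within ?I)"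
        by (rule bounded_linear.has_vector_derivative[OF bounded_linear_Im \<phi>'[OF s b[OF \<rho>]]])
      have D: "?u s \<in> ball 0 \<delta>" by (rule \<phi>D[OF s b[OF \<rho>]])
      then have "\<bar>Re (?u s)\<bar> < \<delta>" using abs_Re_le_cmod[of "?u s"] by simp
      then have D': "complex_of_real (Re (?u s)) \<in> ball 0 \<delta>"
        and "Im (R s (of_real (Re (?u s)))) = 0" using R(4)[OF s] \<delta> by auto
      then have "norm (Im (R s (?u s))) = \<bar>Im (R s (?u s) - R s (of_real (Re (?u s))))\<bar>" by simp
      also have "\<dots> \<le> norm (R s (?u s) - R s (of_real (Re (?u s))))" by (rule abs_Im_le_cmod)
      also have "\<dots> \<le> L * norm (?u s - of_real (Re (?u s)))" by (rule lip[OF s D D'])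
      also have "?u s - of_real (Re (?u s)) = \<i> * of_real (Im (?u s))"
        by (simp add: complex_eq_iff)
      finally show "norm (Im (R s (?u s))) \<le> L * norm (Im (?u s))" by (simp add: norm_mult)
    qed (use t T in auto)
    then show ?thesis using \<phi>0[OF b[OF \<rho>]] by simp
  qed
  define \<sigma> where "\<sigma> \<rho> t = Re (\<phi> t (of_real \<rho>))" for \<rho> t
  have \<sigma>\<phi>: "\<phi> t (of_real \<rho>) = of_real (\<sigma> \<rho> t)" if "t \<in> ?I" "\<rho> \<in> {0<..<\<eta>}" for t \<rho>
    using Im0[OF that] by (simp add: \<sigma>_def complex_eq_iff)
  have \<sigma>D: "\<bar>\<sigma> \<rho> t\<bar> < \<delta>" if "t \<in> ?I" "\<rho> \<in> {0<..<\<eta>}" for t \<rho>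
    using \<phi>D[OF that(1) b[OF that(2)]] \<sigma>\<phi>[OF that] by simp
  have \<sigma>0: "\<sigma> \<rho> 0 = \<rho>" if "\<rho> \<in> {0<..<\<eta>}" for \<rho>
    using \<phi>0[OF b[OF that]] by (simp add: \<sigma>_def)
  have \<sigma>': "(\<sigma> \<rho> has_real_derivative F t (\<sigma> \<rho> t) / G t (\<sigma> \<rho> t)) (at t within ?I)"
    if t: "t \<in> ?I" and \<rho>: "\<rho> \<in> {0<..<\<eta>}" for t \<rho>
  proof -
    have "((\<lambda>t. Re (\<phi> t (of_real \<rho>))) has_vector_derivative Re (R t (\<phi> t (of_real \<rho>)))) (at t within ?I)"
      by (rule bounded_linear.has_vector_derivative[OF bounded_linear_Re \<phi>'[OF t b[OF \<rho>]]])
    moreover have "R t (\<phi> t (of_real \<rho>)) = of_real (F t (\<sigma> \<rho> t) / G t (\<sigma> \<rho> t))"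
      unfolding \<sigma>\<phi>[OF t \<rho>] using \<sigma>D[OF t \<rho>] \<delta> by (intro R(4)[OF t]) auto
    moreover have "\<sigma> \<rho> = (\<lambda>t. Re (\<phi> t (of_real \<rho>)))" by (simp add: \<sigma>_def fun_eq_iff)
    ultimately show ?thesis
      unfolding has_real_derivative_iff_has_vector_derivative by simp
  qed
  have \<sigma>pos: "\<sigma> \<rho> t > 0" if t: "t \<in> ?I" and \<rho>: "\<rho> \<in> {0<..<\<eta>}" for t \<rho>
  proof (rule ccontr)
    assume neg: "\<not> \<sigma> \<rho> t > 0"
    have c: "continuous_on ?I (\<sigma> \<rho>)" by (rule DERIV_continuous_on[OF \<sigma>'[OF _ \<rho>]])
    have "\<exists>s\<ge>0. s \<le> t \<and> \<sigma> \<rho> s = 0"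
      by (rule IVT2'[of "\<sigma> \<rho>" t 0 0])
        (use neg t \<rho> \<sigma>0[OF \<rho>] in \<open>auto intro: continuous_on_subset[OF c]\<close>)
    then obtain s where s: "s \<in> ?I" "\<sigma> \<rho> s = 0"
      using t by (metis atLeastAtMost_iff order_trans)
    \<comment> \<open>Gronwall backwards from time \<open>s\<close>: a solution that meets the zero
      solution there would have started at \<open>0\<close>.\<close>
    have "norm (\<phi> 0 (of_real \<rho>) - 0) \<le> exp (L * \<bar>0 - s\<bar>) * norm (\<phi> s (of_real \<rho>) - 0)"
      by (rule grow[where w = "\<lambda>_. 0"]) (use \<phi>D \<phi>' R(3) b[OF \<rho>] \<delta> s T in auto)
    then show False using \<sigma>\<phi>[OF s(1) \<rho>] s(2) \<phi>0[OF b[OF \<rho>]] \<rho> by simp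
  qed
  have gC: "exp (L * \<bar>t - 0\<bar>) * x \<le> exp (L * T) * x" if "t \<in> ?I" "x \<ge> 0" for t x
    using that L by (intro mult_right_mono) auto
  show thesis
  proof (rule that[OF \<eta>(1), of "exp (L * T)" "\<phi> T" \<sigma>])
    show "\<phi> T holomorphic_on ball 0 \<eta>" using \<phi>h T by simp
    show "\<phi> T (of_real \<rho>) = of_real (\<sigma> \<rho> T)" if "\<rho> \<in> {0<..<\<eta>}" for \<rho>
      using \<sigma>\<phi>[OF _ that] T by simp
    show "\<bar>\<sigma> \<rho> t - \<sigma> \<rho>' t\<bar> \<le> exp (L * T) * \<bar>\<rho> - \<rho>'\<bar>"
      if \<rho>: "\<rho> \<in> {0<..<\<eta>}" "\<rho>' \<in> {0<..<\<eta>}" and t: "t \<in> ?I" for \<rho> \<rho>' t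
    proof -
      have "norm (\<phi> t (of_real \<rho>) - \<phi> t (of_real \<rho>'))
          \<le> exp (L * \<bar>t - 0\<bar>) * norm (\<phi> 0 (of_real \<rho>) - \<phi> 0 (of_real \<rho>'))"
        by (rule grow) (use \<phi>D \<phi>' b \<rho> t T in auto)
      also have "\<dots> \<le> exp (L * T) * norm (\<phi> 0 (of_real \<rho>) - \<phi> 0 (of_real \<rho>'))"
        by (rule gC[OF t]) simp
      finally show ?thesis
        unfolding \<sigma>\<phi>[OF t \<rho>(1)] \<sigma>\<phi>[OF t \<rho>(2)] \<phi>0[OF b[OF \<rho>(1)]] \<phi>0[OF b[OF \<rho>(2)]]
          of_real_diff[symmetric] norm_of_real .
    qed
    show "\<tau> t = \<sigma> (\<tau> 0) t"
      if \<tau>: "\<And>s. s \<in> ?I \<Longrightarrow> \<tau> s \<in> {0<..<\<eta>}"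
        "\<And>s. s \<in> ?I \<Longrightarrow> (\<tau> has_real_derivative F s (\<tau> s) / G s (\<tau> s)) (at s within ?I)" and t: "t \<in> ?I" for \<tau> t
    proof -
      have \<tau>0: "\<tau> 0 \<in> {0<..<\<eta>}" using \<tau>(1) T by simp
      have "norm (of_real (\<tau> t) - \<phi> t (of_real (\<tau> 0)))
          \<le> exp (L * \<bar>t - 0\<bar>) * norm (of_real (\<tau> 0) - \<phi> 0 (of_real (\<tau> 0)))"
      proof (rule grow[where u = "\<lambda>t. of_real (\<tau> t)"])
        fix s assume s: "s \<in> ?I"
        have \<tau>s: "\<bar>\<tau> s\<bar> < \<delta>" using \<tau>(1)[OF s] \<eta> by auto
        then show "complex_of_real (\<tau> s) \<in> ball 0 \<delta>" by simp
        have "((\<lambda>t. complex_of_real (\<tau> t)) has_vector_derivative of_real (F s (\<tau> s) / G s (\<tau> s))) (at s within ?I)"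
          using \<tau>(2)[OF s] by (intro has_vector_derivative_of_real)
             (simp add: has_real_derivative_iff_has_vector_derivative)
        then show "((\<lambda>t. complex_of_real (\<tau> t)) has_vector_derivative R s (of_real (\<tau> s))) (at s within ?I)"
          using R(4)[OF s, of "\<tau> s"] \<tau>s \<delta> by simp
      qed (use \<phi>D \<phi>' b[OF \<tau>0] t T in auto)
      then show ?thesis using \<phi>0[OF b[OF \<tau>0]] \<sigma>\<phi>[OF t \<tau>0] by simp
    qed
  qed (use \<sigma>0 \<sigma>' \<sigma>pos in auto)
qed

text \<open>An arc of \<open>Y\<close> on the positive side of the switching curve; \<open>x\<close> and \<open>x'\<close> are the first
  coordinates of its two end points in the chart \<open>h\<close>, in either order.\<close>

definition crossing_arc ::
    "(plane \<Rightarrow> plane) \<Rightarrow> (plane \<Rightarrow> real) \<Rightarrow> (plane \<Rightarrow> plane) \<Rightarrow> plane set \<Rightarrow> real \<Rightarrow> real \<Rightarrow> bool" where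
  "crossing_arc Y f h A x x' \<longleftrightarrow>
     (\<exists>a b \<gamma>. a < b \<and> regular_trajectory Y {a..b} \<gamma> \<and> A = \<gamma> ` {a..b} \<and> \<gamma> ` {a<..<b} \<subseteq> pos_side f \<and>
        (h (\<gamma> a) = (x, 0) \<and> h (\<gamma> b) = (x', 0) \<or> h (\<gamma> a) = (x', 0) \<and> h (\<gamma> b) = (x, 0)))"

text \<open>The trajectory arcs of \<open>Y\<close> in \<open>N\<close> that join two points of the switching curve through its
  positive side start at radius \<open>\<rho> < e\<close> and end at radius \<open>ret \<rho>\<close>, and every nearby \<open>\<rho>'\<close> is realized
  by a nearby arc.\<close>

definition radial_arcs ::
    "(plane \<Rightarrow> plane) \<Rightarrow> (plane \<Rightarrow> real) \<Rightarrow> (plane \<Rightarrow> plane) \<Rightarrow> plane \<Rightarrow> nat \<Rightarrow> (real \<Rightarrow> real) \<Rightarrow>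
      real \<Rightarrow> plane set \<Rightarrow> bool" where
  "radial_arcs Y f h p0 k ret e N \<longleftrightarrow>
     (\<forall>a b \<gamma>. a < b \<longrightarrow> regular_trajectory Y {a..b} \<gamma> \<longrightarrow> \<gamma> ` {a..b} \<subseteq> N \<longrightarrow> p0 \<notin> \<gamma> ` {a..b} \<longrightarrow>
        f (\<gamma> a) = 0 \<longrightarrow> f (\<gamma> b) = 0 \<longrightarrow> \<gamma> a \<noteq> \<gamma> b \<longrightarrow> \<gamma> ` {a<..<b} \<subseteq> pos_side f \<longrightarrow>
        (\<exists>\<rho>\<in>{0<..<e}.
           (h (\<gamma> a) = (\<rho> ^ k, 0) \<and> h (\<gamma> b) = (- (ret \<rho> ^ k), 0) \<or>
            h (\<gamma> a) = (- (ret \<rho> ^ k), 0) \<and> h (\<gamma> b) = (\<rho> ^ k, 0)) \<and>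
           (\<forall>W. open W \<longrightarrow> \<gamma> ` {a..b} \<subseteq> W \<longrightarrow>
              (\<forall>\<^sub>F \<rho>' in nhds \<rho>. \<exists>A \<subseteq> W. crossing_arc Y f h A (\<rho>' ^ k) (- (ret \<rho>' ^ k))))))"

section \<open>Passing between solution graphs and trajectory arcs\<close>

lemma continuous_on_weighted_polar: "continuous_on A (weighted_polar k l)"
  unfolding weighted_polar_def case_prod_unfold by (intro continuous_intros)

text \<open>Hypothesis H yields a trajectory with the right image and nothing about its
  parametrization. Since the image is an injective arc and the velocity never vanishes, the end
  times must sit at the angles \<open>0\<close> and \<open>pi\<close>, and all other times at
  interior angles, where the sine is positive.\<close>

lemma crossing_arc_of_solution:
  assumes hom: "homeomorphism U V h g"
    and sgn: "\<And>z. z \<in> U \<Longrightarrow> sgn (snd (h z)) = sgn (f z)" and kl: "k > 0" "l > 0"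
    and sub: "weighted_polar k l ` ({0..pi} \<times> {0<..<\<epsilon>}) \<subseteq> V"
    and orb: "\<And>S. S \<subseteq> {0..pi} \<times> {0<..<\<epsilon>} \<Longrightarrow> solution_arc R S \<Longrightarrow> orbit_arc Y (g ` weighted_polar k l ` S)"
    and s: "\<And>\<theta>. \<theta> \<in> {0..pi} \<Longrightarrow> s \<theta> \<in> {0<..<\<epsilon>}"
    and s': "\<And>\<theta>. \<theta> \<in> {0..pi} \<Longrightarrow> (s has_real_derivative R \<theta> (s \<theta>)) (at \<theta> within {0..pi})"
  shows "crossing_arc Y f h (g ` weighted_polar k l ` (\<lambda>\<theta>. (\<theta>, s \<theta>)) ` {0..pi}) (s 0 ^ k) (- (s pi ^ k))"
proof -
  define S where "S = (\<lambda>\<theta>. (\<theta>, s \<theta>)) ` {0..pi}"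
  define \<Gamma> where "\<Gamma> \<theta> = g (weighted_polar k l (\<theta>, s \<theta>))" for \<theta>
  have im: "g ` weighted_polar k l ` S = \<Gamma> ` {0..pi}"
    by (auto simp: S_def \<Gamma>_def image_image)
  have wV: "weighted_polar k l (\<theta>, s \<theta>) \<in> V" if "\<theta> \<in> {0..pi}" for \<theta>
    using sub s[OF that] that by blast
  have h\<Gamma>: "h (\<Gamma> \<theta>) = weighted_polar k l (\<theta>, s \<theta>)" "\<Gamma> \<theta> \<in> U" if "\<theta> \<in> {0..pi}" for \<theta>
    using hom wV[OF that] by (auto simp: \<Gamma>_def homeomorphism_def)
  have S: "S \<subseteq> {0..pi} \<times> {0<..<\<epsilon>}" using s by (auto simp: S_def)
  have "solution_arc R S"
    unfolding solution_arc_def S_def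
    by (rule exI[of _ 0], rule exI[of _ pi], rule exI[of _ s]) (use s' in auto)
  from orb[OF S this] obtain a b \<gamma> where ab: "a < b" and \<gamma>: "regular_trajectory Y {a..b} \<gamma>"
    and \<gamma>im: "\<gamma> ` {a..b} = \<Gamma> ` {0..pi}"
    unfolding orbit_arc_def im by auto
  have sc: "continuous_on {0..pi} s" by (rule DERIV_continuous_on[OF s'])
  have \<Gamma>c: "continuous_on {0..pi} \<Gamma>"
    unfolding \<Gamma>_def
  proof (rule continuous_on_compose2[of V g])
    show "continuous_on V g" using hom by (simp add: homeomorphism_def)
    show "continuous_on {0..pi} (\<lambda>\<theta>. weighted_polar k l (\<theta>, s \<theta>))"
      by (rule continuous_on_compose2[OF continuous_on_weighted_polar]) (auto intro!: continuous_intros sc)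
  qed (use wV in auto)
  have \<Gamma>i: "inj_on \<Gamma> {0..pi}"
  proof (rule inj_onI)
    fix x y assume xy: "x \<in> {0..pi}" "y \<in> {0..pi}" "\<Gamma> x = \<Gamma> y"
    then have "weighted_polar k l (x, s x) = weighted_polar k l (y, s y)"
      using h\<Gamma> by metis
    then show "x = y"
      using inj_onD[OF weighted_polar_inj_on[OF kl], of "(x, s x)" "(y, s y)"] xy s[of x] s[of y] by auto
  qed
  have \<gamma>': "(\<gamma> has_vector_derivative Y (\<gamma> t)) (at t within {a..b})" "Y (\<gamma> t) \<noteq> 0" if "t \<in> {a..b}" for t
    using \<gamma> that unfolding regular_trajectory_def by auto
  have \<Gamma>pos: "\<Gamma> \<theta> \<in> pos_side f" if "\<theta> \<in> {0<..<pi}" for \<theta>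
  proof -
    have \<theta>: "\<theta> \<in> {0..pi}" using that by auto
    have "snd (h (\<Gamma> \<theta>)) > 0"
      using that s[OF \<theta>] by (auto simp: h\<Gamma>[OF \<theta>] weighted_polar_def sin_gt_zero)
    then show ?thesis
      using sgn[OF h\<Gamma>(2)[OF \<theta>]] by (simp add: pos_side_def sgn_if split: if_splits)
  qed
  have ends: "h (\<Gamma> 0) = (s 0 ^ k, 0)" "h (\<Gamma> pi) = (- (s pi ^ k), 0)"
    by (simp_all add: h\<Gamma> weighted_polar_def)
  note arc = arc_parametrization_endpoints[OF ab pi_gt_zero \<Gamma>c \<Gamma>i \<gamma>' \<gamma>im]
  show ?thesis
    unfolding crossing_arc_def S_def[symmetric] im
  proof (rule exI[of _ a], rule exI[of _ b], rule exI[of _ \<gamma>], intro conjI ab \<gamma> \<gamma>im[symmetric])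
    have "\<Gamma> ` {0<..<pi} \<subseteq> pos_side f" by (rule image_subsetI[OF \<Gamma>pos])
    with arc(2) show "\<gamma> ` {a<..<b} \<subseteq> pos_side f" by (rule subset_trans)
    from arc(1) show "h (\<gamma> a) = (s 0 ^ k, 0) \<and> h (\<gamma> b) = (- (s pi ^ k), 0) \<or>
        h (\<gamma> a) = (- (s pi ^ k), 0) \<and> h (\<gamma> b) = (s 0 ^ k, 0)"
    proof
      assume "\<gamma> a = \<Gamma> 0 \<and> \<gamma> b = \<Gamma> pi"
      then show ?thesis using ends by simp
    next
      assume "\<gamma> a = \<Gamma> pi \<and> \<gamma> b = \<Gamma> 0"
      then show ?thesis using ends by simp
    qed
  qed
qed

text \<open>The arc is the graph of a solution over some interval of angles inside
  \<open>{0..pi}\<close>. Its ends lie on the switching curve, where the sine vanishes, hence at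
  angle \<open>0\<close> or \<open>pi\<close>; a graph has one point per angle, so two distinct ends
  use both angles and the interval is all of \<open>{0..pi}\<close>.\<close>

lemma solution_of_crossing_arc:
  assumes hom: "homeomorphism U V h g"
    and sgn: "\<And>z. z \<in> U \<Longrightarrow> sgn (snd (h z)) = sgn (f z)" and kl: "k > 0" "l > 0"
    and sub: "weighted_polar k l ` ({0..pi} \<times> {0<..<\<epsilon>}) \<subseteq> V"
    and orb: "\<And>S. S \<subseteq> {0..pi} \<times> {0<..<\<epsilon>} \<Longrightarrow> orbit_arc Y (g ` weighted_polar k l ` S) \<Longrightarrow> solution_arc R S"
    and \<gamma>: "a < b" "regular_trajectory Y {a..b} \<gamma>" "\<gamma> ` {a..b} \<subseteq> U" "f (\<gamma> a) = 0" "f (\<gamma> b) = 0" "\<gamma> a \<noteq> \<gamma> b"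
    and cov: "h ` \<gamma> ` {a..b} \<subseteq> weighted_polar k l ` ({0..pi} \<times> {0<..<e})" and e: "e \<le> \<epsilon>"
  obtains s where "\<And>\<theta>. \<theta> \<in> {0..pi} \<Longrightarrow> s \<theta> \<in> {0<..<e}"
    "\<And>\<theta>. \<theta> \<in> {0..pi} \<Longrightarrow> (s has_real_derivative R \<theta> (s \<theta>)) (at \<theta> within {0..pi})"
    "\<gamma> ` {a..b} = g ` weighted_polar k l ` (\<lambda>\<theta>. (\<theta>, s \<theta>)) ` {0..pi}"
    "h (\<gamma> a) = (s 0 ^ k, 0) \<and> h (\<gamma> b) = (- (s pi ^ k), 0) \<or>
     h (\<gamma> a) = (- (s pi ^ k), 0) \<and> h (\<gamma> b) = (s 0 ^ k, 0)"
proof -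
  \<comment> \<open>Radii are restricted to below \<open>e\<close>, not just \<epsilon>, so that the
    solution inherits the bound. The covering assumption ensures that the image of this set is still
    the whole arc.\<close>
  define S where "S = {w \<in> {0..pi} \<times> {0<..<e}. g (weighted_polar k l w) \<in> \<gamma> ` {a..b}}"
  have "\<gamma> ` {a..b} \<subseteq> g ` weighted_polar k l ` S"
  proof
    fix z assume z: "z \<in> \<gamma> ` {a..b}"
    then obtain w where w: "w \<in> {0..pi} \<times> {0<..<e}" "h z = weighted_polar k l w" using cov by blast
    have "g (h z) = z" using z \<gamma>(3) hom by (auto simp: homeomorphism_def)
    then show "z \<in> g ` weighted_polar k l ` S" using w z by (force simp: S_def)
  qed
  then have im: "g ` weighted_polar k l ` S = \<gamma> ` {a..b}" by (auto simp: S_def)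
  have "S \<subseteq> {0..pi} \<times> {0<..<\<epsilon>}" using e by (auto simp: S_def)
  moreover have "orbit_arc Y (g ` weighted_polar k l ` S)"
    unfolding im orbit_arc_def using \<gamma> by blast
  ultimately have "solution_arc R S" by (rule orb)
  then obtain \<alpha> \<beta> s where "\<alpha> < \<beta>"
    and s': "\<And>\<theta>. \<theta> \<in> {\<alpha>..\<beta>} \<Longrightarrow> (s has_real_derivative R \<theta> (s \<theta>)) (at \<theta> within {\<alpha>..\<beta>})"
    and S: "S = (\<lambda>\<theta>. (\<theta>, s \<theta>)) ` {\<alpha>..\<beta>}"
    unfolding solution_arc_def by blast
  have s: "\<theta> \<in> {0..pi} \<and> s \<theta> \<in> {0<..<e}" if "\<theta> \<in> {\<alpha>..\<beta>}" for \<theta>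
    using that S unfolding S_def by blast
  have hg: "h (g (weighted_polar k l (\<theta>, s \<theta>))) = weighted_polar k l (\<theta>, s \<theta>)" if "\<theta> \<in> {\<alpha>..\<beta>}" for \<theta>
  proof -
    have "weighted_polar k l (\<theta>, s \<theta>) \<in> V" using s[OF that] sub e by auto
    then show ?thesis using hom by (simp add: homeomorphism_def)
  qed
  have endp: "\<exists>\<theta>\<in>{\<alpha>..\<beta>}. (\<theta> = 0 \<or> \<theta> = pi) \<and> \<gamma> t = g (weighted_polar k l (\<theta>, s \<theta>))"
    if t: "t \<in> {a..b}" "f (\<gamma> t) = 0" for t
  proof -
    have "\<gamma> t \<in> g ` weighted_polar k l ` S" using im t by blast
    then obtain \<theta> where \<theta>: "\<theta> \<in> {\<alpha>..\<beta>}" "\<gamma> t = g (weighted_polar k l (\<theta>, s \<theta>))" using S by auto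
    have "\<gamma> t \<in> U" using \<gamma>(3) t by blast
    then have "sgn (snd (h (\<gamma> t))) = 0" using sgn t by simp
    then have "sin \<theta> = 0" using s[OF \<theta>(1)] hg[OF \<theta>(1)] \<theta>(2)
      by (auto simp: weighted_polar_def sgn_zero_iff)
    then have "\<theta> = 0 \<or> \<theta> = pi" using s[OF \<theta>(1)] sin_gt_zero[of \<theta>] by force
    then show ?thesis using \<theta> by blast
  qed
  obtain \<theta>1 where \<theta>1: "\<theta>1 \<in> {\<alpha>..\<beta>}" "\<theta>1 = 0 \<or> \<theta>1 = pi" "\<gamma> a = g (weighted_polar k l (\<theta>1, s \<theta>1))"
    using endp[of a] \<gamma> by auto
  obtain \<theta>2 where \<theta>2: "\<theta>2 \<in> {\<alpha>..\<beta>}" "\<theta>2 = 0 \<or> \<theta>2 = pi" "\<gamma> b = g (weighted_polar k l (\<theta>2, s \<theta>2))"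
    using endp[of b] \<gamma> by auto
  have ne: "\<theta>1 \<noteq> \<theta>2" using \<theta>1 \<theta>2 \<gamma>(6) by auto
  then have "0 \<in> {\<alpha>..\<beta>}" "pi \<in> {\<alpha>..\<beta>}" using \<theta>1 \<theta>2 by auto
  then have \<alpha>\<beta>: "\<alpha> = 0" "\<beta> = pi" using s[of \<alpha>] s[of \<beta>] \<open>\<alpha> < \<beta>\<close> by auto
  have "h (g (weighted_polar k l (0, s 0))) = (s 0 ^ k, 0)"
    "h (g (weighted_polar k l (pi, s pi))) = (- (s pi ^ k), 0)"
    using hg[of 0] hg[of pi] \<alpha>\<beta> by (simp_all add: weighted_polar_def)
  then have "h (\<gamma> a) = (s 0 ^ k, 0) \<and> h (\<gamma> b) = (- (s pi ^ k), 0) \<or>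
     h (\<gamma> a) = (- (s pi ^ k), 0) \<and> h (\<gamma> b) = (s 0 ^ k, 0)"
    using \<theta>1 \<theta>2 ne by auto
  then show thesis
    using that[of s] s s' im S \<alpha>\<beta> by auto
qed

text \<open>The bound \<open>e\<close> remains free because the caller fixes it only after the zeros
  of the comparison function are known. An arc in a small box of the chart has small radii, so it is
  the graph of a solution, which uniqueness identifies with the flow line of its initial radius. The
  Lipschitz dependence then supplies arcs from nearby radii.\<close>

lemma half_return_map:
  assumes hom: "homeomorphism U V h g" and opn: "open U" "open V"
    and p0: "p0 \<in> U" "h p0 = (0, 0)"
    and sgn: "\<And>z. z \<in> U \<Longrightarrow> sgn (snd (h z)) = sgn (f z)" and kl: "k > 0" "l > 0"
    and pe: "polar_equivalent Y g V {0..pi} k l"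
  obtains \<eta> P ret where "\<eta> > 0" "P holomorphic_on ball 0 \<eta>"
    "\<And>\<rho>. \<rho> \<in> {0<..<\<eta>} \<Longrightarrow> P (complex_of_real \<rho>) = of_real (ret \<rho>)"
    "\<And>\<rho>. \<rho> \<in> {0<..<\<eta>} \<Longrightarrow> ret \<rho> > 0"
    "\<And>e. 0 < e \<Longrightarrow> e \<le> \<eta> \<Longrightarrow> \<exists>N. open N \<and> p0 \<in> N \<and> radial_arcs Y f h p0 k ret e N"
proof -
  obtain F G where F: "real_analytic_on (\<lambda>(\<theta>, \<rho>). F \<theta> \<rho>) (UNIV \<times> {0})"
    and G: "real_analytic_on (\<lambda>(\<theta>, \<rho>). G \<theta> \<rho>) (UNIV \<times> {0})"
    and FG0: "\<forall>\<theta>. F \<theta> 0 = 0" "\<forall>\<theta>\<in>{0..pi}. G \<theta> 0 \<noteq> 0"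
    and ex: "\<exists>\<epsilon>>0. weighted_polar k l ` ({0..pi} \<times> {0<..<\<epsilon>}) \<subseteq> V \<and>
      (\<forall>\<theta>\<in>{0..pi}. \<forall>\<rho>\<in>{0<..<\<epsilon>}. G \<theta> \<rho> \<noteq> 0) \<and>
      (\<forall>S\<subseteq>{0..pi} \<times> {0<..<\<epsilon>}. solution_arc (\<lambda>\<theta> \<rho>. F \<theta> \<rho> / G \<theta> \<rho>) S \<longleftrightarrow>
         orbit_arc Y (g ` weighted_polar k l ` S))"
    using pe unfolding polar_equivalent_def by (elim exE, intro that[rotated 4]) (elim conjE, assumption)+
  note F0 = FG0(1)[rule_format]
  from ex obtain \<epsilon> where \<epsilon>: "\<epsilon> > 0"
    and sub: "weighted_polar k l ` ({0..pi} \<times> {0<..<\<epsilon>}) \<subseteq> V"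
    and orb': "\<forall>S\<subseteq>{0..pi} \<times> {0<..<\<epsilon>}. solution_arc (\<lambda>\<theta> \<rho>. F \<theta> \<rho> / G \<theta> \<rho>) S \<longleftrightarrow>
         orbit_arc Y (g ` weighted_polar k l ` S)"
    by (elim exE conjE) (rule that)
  note orb = orb'[rule_format]
  obtain \<eta> C P \<sigma> where \<eta>: "\<eta> > 0" and C: "C > 0" and P: "P holomorphic_on ball 0 \<eta>"
    and P\<sigma>: "\<And>\<rho>. \<rho> \<in> {0<..<\<eta>} \<Longrightarrow> P (complex_of_real \<rho>) = of_real (\<sigma> \<rho> pi)"
    and \<sigma>0: "\<And>\<rho>. \<rho> \<in> {0<..<\<eta>} \<Longrightarrow> \<sigma> \<rho> 0 = \<rho>"
    and \<sigma>pos: "\<And>\<rho> t. \<rho> \<in> {0<..<\<eta>} \<Longrightarrow> t \<in> {0..pi} \<Longrightarrow> \<sigma> \<rho> t > 0"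
    and \<sigma>': "\<And>\<rho> t. \<rho> \<in> {0<..<\<eta>} \<Longrightarrow> t \<in> {0..pi} \<Longrightarrow>
       (\<sigma> \<rho> has_real_derivative F t (\<sigma> \<rho> t) / G t (\<sigma> \<rho> t)) (at t within {0..pi})"
    and \<sigma>lip: "\<And>\<rho> \<rho>' t. \<rho> \<in> {0<..<\<eta>} \<Longrightarrow> \<rho>' \<in> {0<..<\<eta>} \<Longrightarrow> t \<in> {0..pi} \<Longrightarrow>
       \<bar>\<sigma> \<rho> t - \<sigma> \<rho>' t\<bar> \<le> C * \<bar>\<rho> - \<rho>'\<bar>"
    and \<sigma>uniq: "\<And>\<tau> t. \<lbrakk>\<And>s. s \<in> {0..pi} \<Longrightarrow> \<tau> s \<in> {0<..<\<eta>};
       \<And>s. s \<in> {0..pi} \<Longrightarrow> (\<tau> has_real_derivative F s (\<tau> s) / G s (\<tau> s)) (at s within {0..pi});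
       t \<in> {0..pi}\<rbrakk> \<Longrightarrow> \<tau> t = \<sigma> (\<tau> 0) t"
    using polar_flow[OF F G F0 FG0(2) pi_ge_zero] by blast
  show thesis
  proof (rule that[OF \<eta> P, of "\<lambda>\<rho>. \<sigma> \<rho> pi"])
    show "P (complex_of_real \<rho>) = of_real (\<sigma> \<rho> pi)" "\<sigma> \<rho> pi > 0" if "\<rho> \<in> {0<..<\<eta>}" for \<rho>
      using P\<sigma>[OF that] \<sigma>pos[OF that] by auto
    fix e :: real assume "0 < e" "e \<le> \<eta>"
    \<comment> \<open>Below \<open>e\<close> for the claimed bound on the radius and below
      \<epsilon> for the polar equivalence to apply.\<close>
    define e' where "e' = min e \<epsilon>"
    have e': "e' > 0" "e' \<le> e" "e' \<le> \<eta>" "e' \<le> \<epsilon>" using \<open>0 < e\<close> \<open>e \<le> \<eta>\<close> \<epsilon> by (auto simp: e'_def)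
    obtain m where m: "m > 0" and cov: "\<And>x y. \<bar>x\<bar> < m \<Longrightarrow> \<bar>y\<bar> < m \<Longrightarrow> y \<ge> 0 \<Longrightarrow> (x, y) \<noteq> (0, 0) \<Longrightarrow>
        (x, y) \<in> weighted_polar k l ` ({0..pi} \<times> {0<..<e'})"
      using weighted_polar_covers[OF kl e'(1)] by blast
    define N where "N = U \<inter> h -` ({-m<..<m} \<times> {-m<..<m})"
    have "open N"
      unfolding N_def using hom opn
      by (intro continuous_open_preimage) (auto simp: homeomorphism_def intro: open_Times)
    moreover have "p0 \<in> N" using p0 m by (simp add: N_def)
    moreover have "\<exists>\<rho>\<in>{0<..<e}.
          (h (\<gamma> a) = (\<rho> ^ k, 0) \<and> h (\<gamma> b) = (- (\<sigma> \<rho> pi ^ k), 0) \<or>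
           h (\<gamma> a) = (- (\<sigma> \<rho> pi ^ k), 0) \<and> h (\<gamma> b) = (\<rho> ^ k, 0)) \<and>
          (\<forall>W. open W \<longrightarrow> \<gamma> ` {a..b} \<subseteq> W \<longrightarrow>
             (\<forall>\<^sub>F \<rho>' in nhds \<rho>. \<exists>A \<subseteq> W. crossing_arc Y f h A (\<rho>' ^ k) (- (\<sigma> \<rho>' pi ^ k))))"
      if \<gamma>: "a < b" "regular_trajectory Y {a..b} \<gamma>" "\<gamma> ` {a..b} \<subseteq> N" and p0\<gamma>: "p0 \<notin> \<gamma> ` {a..b}" and
        \<gamma>0: "f (\<gamma> a) = 0" "f (\<gamma> b) = 0"
        "\<gamma> a \<noteq> \<gamma> b" "\<gamma> ` {a<..<b} \<subseteq> pos_side f" for a b \<gamma>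
    proof -
      have NU: "\<gamma> ` {a..b} \<subseteq> U" using \<gamma>(3) by (auto simp: N_def)
      have hcov: "h ` \<gamma> ` {a..b} \<subseteq> weighted_polar k l ` ({0..pi} \<times> {0<..<e'})"
      proof
        fix w assume "w \<in> h ` \<gamma> ` {a..b}"
        then obtain t where t: "t \<in> {a..b}" and w: "w = h (\<gamma> t)" by blast
        obtain x y where xy: "h (\<gamma> t) = (x, y)" by fastforce
        have U: "\<gamma> t \<in> U" using NU t by auto
        have "f (\<gamma> t) \<ge> 0"
          using \<gamma>0(1,2,4) t by (cases "t = a \<or> t = b") (auto simp: pos_side_def image_subset_iff less_imp_le)
        then have "y \<ge> 0" using sgn[OF U] xy by (auto simp: sgn_if split: if_splits)
        moreover have "(x, y) \<noteq> (0, 0)"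
          using hom U p0 xy p0\<gamma> t unfolding homeomorphism_def by (metis imageI)
        moreover from \<gamma>(3) t have "\<gamma> t \<in> N" by blast
        then have "\<bar>x\<bar> < m \<and> \<bar>y\<bar> < m" using xy by (auto simp: N_def)
        ultimately show "w \<in> weighted_polar k l ` ({0..pi} \<times> {0<..<e'})"
          using cov xy w by simp
      qed
      obtain s where s: "\<And>\<theta>. \<theta> \<in> {0..pi} \<Longrightarrow> s \<theta> \<in> {0<..<e'}"
        and s': "\<And>\<theta>. \<theta> \<in> {0..pi} \<Longrightarrow> (s has_real_derivative F \<theta> (s \<theta>) / G \<theta> (s \<theta>)) (at \<theta> within {0..pi})"
        and im: "\<gamma> ` {a..b} = g ` weighted_polar k l ` (\<lambda>\<theta>. (\<theta>, s \<theta>)) ` {0..pi}"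
        and ends: "h (\<gamma> a) = (s 0 ^ k, 0) \<and> h (\<gamma> b) = (- (s pi ^ k), 0) \<or>
          h (\<gamma> a) = (- (s pi ^ k), 0) \<and> h (\<gamma> b) = (s 0 ^ k, 0)"
        using solution_of_crossing_arc[where R = "\<lambda>\<theta> \<rho>. F \<theta> \<rho> / G \<theta> \<rho>", OF hom sgn kl sub _ \<gamma>(1,2) NU \<gamma>0(1-3) hcov e'(4)] orb
        by blast
      have s\<sigma>: "s t = \<sigma> (s 0) t" if "t \<in> {0..pi}" for t
      proof (rule \<sigma>uniq[OF _ s' that])
        show "s u \<in> {0<..<\<eta>}" if "u \<in> {0..pi}" for u using s[OF that] e' by auto
      qed
      have \<rho>: "s 0 \<in> {0<..<e'}" "s 0 \<in> {0<..<\<eta>}" using s[of 0] e' by auto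
      have "\<forall>\<^sub>F \<rho>' in nhds (s 0). \<exists>A \<subseteq> W. crossing_arc Y f h A (\<rho>' ^ k) (- (\<sigma> \<rho>' pi ^ k))"
        if W: "open W" "\<gamma> ` {a..b} \<subseteq> W" for W
      proof -
        \<comment> \<open>The open set of angles and radii that are sent into \<open>W\<close>. The
          compact graph of \<open>s\<close> has a tube of some radius \<open>d\<close> inside
          it.\<close>
        define B where "B = {w \<in> weighted_polar k l -` V. g (weighted_polar k l w) \<in> W} \<inter> UNIV \<times> {0<..<\<epsilon>}"
        have oV: "open (weighted_polar k l -` V)"
          by (rule open_vimage[OF opn(2) continuous_on_weighted_polar])
        have "continuous_on (weighted_polar k l -` V) (\<lambda>w. g (weighted_polar k l w))"
          by (rule continuous_on_compose2[OF _ continuous_on_weighted_polar, of V])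
            (use hom in \<open>auto simp: homeomorphism_def\<close>)
        from continuous_open_preimage[OF this oV W(1)]
        have "open B" unfolding B_def by (intro open_Int open_Times) (auto simp: vimage_def Int_def)
        moreover have "compact ((\<lambda>\<theta>. (\<theta>, s \<theta>)) ` {0..pi})"
          by (intro compact_continuous_image continuous_intros DERIV_continuous_on[OF s']) auto
        moreover have "(\<lambda>\<theta>. (\<theta>, s \<theta>)) ` {0..pi} \<subseteq> B"
        proof clarify
          fix \<theta> assume \<theta>: "\<theta> \<in> {0..pi}"
          have "s \<theta> \<in> {0<..<\<epsilon>}" using s[OF \<theta>] e' by auto
          moreover from this have "weighted_polar k l (\<theta>, s \<theta>) \<in> V" using sub \<theta> by blast
          moreover have "g (weighted_polar k l (\<theta>, s \<theta>)) \<in> W" using im W(2) \<theta> by blast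
          ultimately show "(\<theta>, s \<theta>) \<in> B" by (simp add: B_def)
        qed
        ultimately obtain d where d: "d > 0" "(\<Union>w\<in>(\<lambda>\<theta>. (\<theta>, s \<theta>)) ` {0..pi}. ball w d) \<subseteq> B"
          using compact_subset_open_imp_ball_epsilon_subset by metis
        \<comment> \<open>Initial radii closer than \<open>d / C\<close> give solutions that stay
          within \<open>d\<close> of \<open>s\<close> for all angles, that is, inside the
          tube.\<close>
        have "\<forall>\<^sub>F \<rho>' in nhds (s 0). \<rho>' \<in> {0<..<\<eta>} \<inter> ball (s 0) (d / C)"
          using \<rho> d C by (intro eventually_nhds_in_open) auto
        then show ?thesis
        proof eventually_elim
          case (elim \<rho>')
          then have \<rho>': "\<rho>' \<in> {0<..<\<eta>}" by auto
          have "C * \<bar>\<rho>' - s 0\<bar> < d" using elim C by (auto simp: dist_real_def field_simps abs_minus_commute)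
          then have near: "\<bar>\<sigma> \<rho>' \<theta> - s \<theta>\<bar> < d" if "\<theta> \<in> {0..pi}" for \<theta>
            using \<sigma>lip[OF \<rho>' \<rho>(2) that] s\<sigma>[OF that] by simp
          have inB: "(\<theta>, \<sigma> \<rho>' \<theta>) \<in> B" if "\<theta> \<in> {0..pi}" for \<theta>
          proof -
            have "(\<theta>, \<sigma> \<rho>' \<theta>) \<in> ball (\<theta>, s \<theta>) d"
              using near[OF that] by (simp add: dist_Pair_Pair dist_real_def abs_minus_commute)
            then show ?thesis using d(2) that by blast
          qed
          have "crossing_arc Y f h (g ` weighted_polar k l ` (\<lambda>\<theta>. (\<theta>, \<sigma> \<rho>' \<theta>)) ` {0..pi})
              (\<sigma> \<rho>' 0 ^ k) (- (\<sigma> \<rho>' pi ^ k))"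
            by (rule crossing_arc_of_solution[where R = "\<lambda>\<theta> \<rho>. F \<theta> \<rho> / G \<theta> \<rho>", OF hom sgn kl sub])
              (use orb inB \<sigma>'[OF \<rho>'] in \<open>auto simp: B_def\<close>)
          moreover have "g ` weighted_polar k l ` (\<lambda>\<theta>. (\<theta>, \<sigma> \<rho>' \<theta>)) ` {0..pi} \<subseteq> W"
            using inB by (auto simp: B_def)
          ultimately show ?case using \<sigma>0[OF \<rho>'] by auto
        qed
      qed
      then show ?thesis using \<rho> e' ends s\<sigma>[of pi] by (intro bexI[of _ "s 0"]) auto
    qed
    ultimately show "\<exists>N. open N \<and> p0 \<in> N \<and> radial_arcs Y f h p0 k (\<lambda>\<rho>. \<sigma> \<rho> pi) e N"
      unfolding radial_arcs_def by blast
  qed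
qed

subsection \<open>Closing up the two half-return maps\<close>

lemma has_derivative_along_trajectory:
  assumes "GDERIV f (\<gamma> t) :> gradient f (\<gamma> t)" "regular_trajectory Y I \<gamma>" "t \<in> I"
  shows "((\<lambda>t. c * f (\<gamma> t)) has_real_derivative c * lie Y f (\<gamma> t)) (at t within I)"
proof -
  have "(\<gamma> has_derivative (\<lambda>h. h *\<^sub>R Y (\<gamma> t))) (at t within I)"
    using assms(2,3) by (auto simp: regular_trajectory_def has_vector_derivative_def)
  from has_derivative_compose[OF this, of f "\<lambda>h. h \<bullet> gradient f (\<gamma> t)"]
  have "((\<lambda>t. f (\<gamma> t)) has_derivative (\<lambda>h. (h *\<^sub>R Y (\<gamma> t)) \<bullet> gradient f (\<gamma> t))) (at t within I)"
    using assms(1) by (auto simp: gderiv_def)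
  then have "((\<lambda>t. f (\<gamma> t)) has_real_derivative lie Y f (\<gamma> t)) (at t within I)"
    unfolding has_field_derivative_def
    by (rule has_derivative_eq_rhs) (auto simp: lie_def inner_commute fun_eq_iff)
  then show ?thesis by (rule DERIV_cmult)
qed

text \<open>The function \<open>c * f\<close> is nonnegative along the arc and zero at both ends, so
  its one-sided derivatives point inwards. The values \<open>c = 1\<close> and
  \<open>c = - 1\<close> serve the two sides of the switching curve.\<close>

lemma lie_sign_at_ends:
  assumes "\<And>z. GDERIV f z :> gradient f z" "a < b" "regular_trajectory Y {a..b} \<gamma>"
    and nn: "\<And>t. t \<in> {a<..<b} \<Longrightarrow> 0 \<le> c * f (\<gamma> t)" and "f (\<gamma> a) = 0" "f (\<gamma> b) = 0"
  shows "0 \<le> c * lie Y f (\<gamma> a)" "c * lie Y f (\<gamma> b) \<le> 0"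
proof -
  note D = has_derivative_along_trajectory[OF assms(1,3), of _ c]
  show "0 \<le> c * lie Y f (\<gamma> a)"
  proof (rule ccontr)
    assume "\<not> 0 \<le> c * lie Y f (\<gamma> a)"
    then obtain d where d: "d > 0" "\<And>h. 0 < h \<Longrightarrow> a + h \<in> {a..b} \<Longrightarrow> h < d \<Longrightarrow> c * f (\<gamma> (a + h)) < c * f (\<gamma> a)"
      using has_real_derivative_neg_dec_right[OF D[of a]] \<open>a < b\<close> by auto
    define h where "h = min (d / 2) ((b - a) / 2)"
    have "0 < h" "h < d" "a + h \<in> {a<..<b}" using d(1) \<open>a < b\<close> by (auto simp: h_def min_def field_simps)
    then show False using d(2)[of h] nn[of "a + h"] assms(5) by auto
  qed
  show "c * lie Y f (\<gamma> b) \<le> 0"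
  proof (rule ccontr)
    assume "\<not> c * lie Y f (\<gamma> b) \<le> 0"
    then obtain d where d: "d > 0" "\<And>h. 0 < h \<Longrightarrow> b - h \<in> {a..b} \<Longrightarrow> h < d \<Longrightarrow> c * f (\<gamma> (b - h)) < c * f (\<gamma> b)"
      using has_real_derivative_pos_inc_left[OF D[of b]] \<open>a < b\<close> by auto
    define h where "h = min (d / 2) ((b - a) / 2)"
    have "0 < h" "h < d" "b - h \<in> {a<..<b}" using d(1) \<open>a < b\<close> by (auto simp: h_def min_def field_simps)
    then show False using d(2)[of h] nn[of "b - h"] assms(6) by auto
  qed
qed

text \<open>Isolation makes the other nearby points of the switching curve regular, and the absence
  of characteristic orbits of the third kind removes sliding and escaping points near
  \<open>p0\<close>.\<close>

lemma sewing_near_monodromic: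
  assumes "sigma_monodromic f Xp Xm p0"
  obtains N where "open N" "p0 \<in> N" "\<And>z. z \<in> N \<Longrightarrow> f z = 0 \<Longrightarrow> z \<noteq> p0 \<Longrightarrow> z \<in> sewing f Xp Xm"
proof -
  obtain V where V: "open V" "p0 \<in> V" "\<And>z. z \<in> V \<Longrightarrow> sigma_singular f Xp Xm z \<Longrightarrow> z = p0"
    using assms unfolding sigma_monodromic_def isolated_sigma_singular_def by blast
  obtain V' where V': "open V'" "p0 \<in> V'" "\<And>z. z \<in> V' \<inter> switching f \<Longrightarrow> \<not> lie Xp f z * lie Xm f z < 0"
    using assms unfolding sigma_monodromic_def has_characteristic_orbit_def by blast
  show thesis
  proof (rule that[of "V \<inter> V'"])
    fix z assume z: "z \<in> V \<inter> V'" "f z = 0" "z \<noteq> p0"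
    then have sw: "z \<in> switching f" by (simp add: switching_def)
    have "sigma_regular f Xp Xm z"
      using V(3)[of z] z sw by (auto simp: sigma_singular_def)
    moreover have "z \<notin> sliding f Xp Xm \<union> escaping f Xp Xm"
      using V'(3)[of z] z sw by (auto simp: sliding_def escaping_def mult_neg_pos mult_pos_neg)
    ultimately show "z \<in> sewing f Xp Xm" by (auto simp: sigma_regular_def)
  qed (use V V' in auto)
qed

section \<open>Reflecting the lower half-plane onto the upper one\<close>

definition refl_axis :: "plane \<Rightarrow> plane" where
  "refl_axis = (\<lambda>(x, y). (x, - y))"

definition refl_angle :: "plane \<Rightarrow> plane" where
  "refl_angle = (\<lambda>(\<theta>, \<rho>). (- \<theta>, \<rho>))"

lemma refl_axis_invol [simp]: "refl_axis (refl_axis z) = z"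
  by (cases z) (simp add: refl_axis_def)

lemma refl_angle_invol [simp]: "refl_angle (refl_angle z) = z"
  by (cases z) (simp add: refl_angle_def)

lemma continuous_on_refl_axis: "continuous_on A refl_axis"
  unfolding refl_axis_def case_prod_unfold by (intro continuous_intros)

lemma weighted_polar_refl_angle: "weighted_polar k l (refl_angle w) = refl_axis (weighted_polar k l w)"
  by (cases w) (simp add: weighted_polar_def refl_angle_def refl_axis_def)

text \<open>The expansion is recentred at the mirrored angle by putting the sign
  \<open>(- 1) ^ i\<close> into the coefficients. The factor \<open>a\<close> will be
  \<open>- 1\<close> for the numerator and \<open>1\<close> for the denominator.\<close>

lemma real_analytic_on_reflect:
  assumes "real_analytic_on (\<lambda>(\<theta>, \<rho>). F \<theta> \<rho>) (UNIV \<times> {0})"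
  shows "real_analytic_on (\<lambda>(\<theta>, \<rho>). a * F (- \<theta>) \<rho>) (UNIV \<times> {0})"
  unfolding real_analytic_on_def
proof (rule ballI)
  fix w :: plane assume "w \<in> UNIV \<times> {0}"
  then obtain x0 where w: "w = (x0, 0)" by auto
  obtain r c where r: "r > 0" and c: "\<And>x y. \<bar>x - (- x0)\<bar> < r \<Longrightarrow> \<bar>y - 0\<bar> < r \<Longrightarrow>
      ((\<lambda>(i, j). c (i, j) * (x - (- x0)) ^ i * (y - 0) ^ j) has_sum F x y) UNIV"
    using bspec[OF assms[unfolded real_analytic_on_def], of "(- x0, 0)", unfolded prod.case] by auto
  have "((\<lambda>(i, j). (a * (- 1) ^ i * c (i, j)) * (x - x0) ^ i * (y - 0) ^ j) has_sum a * F (- x) y) UNIV"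
    if "\<bar>x - x0\<bar> < r" "\<bar>y - 0\<bar> < r" for x y
  proof -
    have "((\<lambda>(i, j). c (i, j) * (- x - (- x0)) ^ i * (y - 0) ^ j) has_sum F (- x) y) UNIV"
      using that by (intro c) auto
    from has_sum_cmult_right[OF this, of a]
    have s: "((\<lambda>k. a * (case k of (i, j) \<Rightarrow> c (i, j) * (- x - (- x0)) ^ i * (y - 0) ^ j)) has_sum a * F (- x) y) UNIV" .
    have pw: "(x0 - x) ^ i = (- 1) ^ i * (x - x0) ^ i" for i
      by (simp add: power_mult_distrib[symmetric])
    show ?thesis
      by (rule has_sum_cong[THEN iffD1, OF _ s]) (simp add: pw mult_ac split: prod.split)
  qed
  then show "case w of (x0, y0) \<Rightarrow> \<exists>r>0. \<exists>c. \<forall>x y. \<bar>x - x0\<bar> < r \<longrightarrow> \<bar>y - y0\<bar> < r \<longrightarrow>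
      ((\<lambda>(i, j). c (i, j) * (x - x0) ^ i * (y - y0) ^ j) has_sum (case (x, y) of (\<theta>, \<rho>) \<Rightarrow> a * F (- \<theta>) \<rho>)) UNIV"
    unfolding w prod.case using r
    by (intro exI[of _ r] conjI exI[of _ "\<lambda>(i, j). a * (- 1) ^ i * c (i, j)"]) auto
qed

lemma solution_arc_reflect:
  assumes "solution_arc R S"
  shows "solution_arc (\<lambda>\<theta> \<rho>. - R (- \<theta>) \<rho>) (refl_angle ` S)"
proof -
  obtain \<alpha> \<beta> s where ab: "\<alpha> < \<beta>" and s: "\<And>\<theta>. \<theta> \<in> {\<alpha>..\<beta>} \<Longrightarrow> (s has_real_derivative R \<theta> (s \<theta>)) (at \<theta> within {\<alpha>..\<beta>})"
    and S: "S = (\<lambda>\<theta>. (\<theta>, s \<theta>)) ` {\<alpha>..\<beta>}"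
    using assms unfolding solution_arc_def by blast
  have im: "uminus ` {- \<beta>..- \<alpha>} = {\<alpha>..\<beta>}" by simp
  have "((\<lambda>\<theta>. s (- \<theta>)) has_real_derivative - R (- \<theta>) (s (- \<theta>))) (at \<theta> within {- \<beta>..- \<alpha>})"
    if "\<theta> \<in> {- \<beta>..- \<alpha>}" for \<theta>
  proof -
    have "(s has_real_derivative R (- \<theta>) (s (- \<theta>))) (at (- \<theta>) within uminus ` {- \<beta>..- \<alpha>})"
      unfolding im using that by (intro s) auto
    moreover have "(uminus has_real_derivative - 1) (at \<theta> within {- \<beta>..- \<alpha>})"
      by (auto intro!: derivative_eq_intros)
    ultimately show ?thesis using DERIV_image_chain by (force simp: o_def)
  qed
  moreover have "refl_angle ` S = (\<lambda>\<theta>. (\<theta>, s (- \<theta>))) ` {- \<beta>..- \<alpha>}"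
  proof -
    have "refl_angle ` S = (\<lambda>\<theta>. (\<theta>, s (- \<theta>))) ` uminus ` {\<alpha>..\<beta>}"
      unfolding S image_image by (simp add: refl_angle_def)
    then show ?thesis by simp
  qed
  ultimately show ?thesis
    unfolding solution_arc_def using ab
    by - (rule exI[of _ "- \<beta>"], rule exI[of _ "- \<alpha>"], rule exI[of _ "\<lambda>\<theta>. s (- \<theta>)"], auto)
qed

text \<open>Reversing the angle flips the sign of the slope of a solution and leaves the radius
  alone. One half-return lemma, stated for the upper half, can then be used for both fields.\<close>

lemma polar_equivalent_reflect:
  assumes "polar_equivalent Y g V {- pi..0} k l"
  shows "polar_equivalent Y (g \<circ> refl_axis) (refl_axis -` V) {0..pi} k l"
proof -
  obtain F G where F: "real_analytic_on (\<lambda>(\<theta>, \<rho>). F \<theta> \<rho>) (UNIV \<times> {0})"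
    and G: "real_analytic_on (\<lambda>(\<theta>, \<rho>). G \<theta> \<rho>) (UNIV \<times> {0})"
    and FG0: "\<forall>\<theta>. F \<theta> 0 = 0" "\<forall>\<theta>\<in>{- pi..0}. G \<theta> 0 \<noteq> 0"
    and ex: "\<exists>\<epsilon>>0. weighted_polar k l ` ({- pi..0} \<times> {0<..<\<epsilon>}) \<subseteq> V \<and>
      (\<forall>\<theta>\<in>{- pi..0}. \<forall>\<rho>\<in>{0<..<\<epsilon>}. G \<theta> \<rho> \<noteq> 0) \<and>
      (\<forall>S\<subseteq>{- pi..0} \<times> {0<..<\<epsilon>}. solution_arc (\<lambda>\<theta> \<rho>. F \<theta> \<rho> / G \<theta> \<rho>) S \<longleftrightarrow>
         orbit_arc Y (g ` weighted_polar k l ` S))"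
    using assms unfolding polar_equivalent_def by (elim exE, intro that[rotated 4]) (elim conjE, assumption)+
  from ex obtain \<epsilon> where \<epsilon>: "\<epsilon> > 0"
    and sub: "weighted_polar k l ` ({- pi..0} \<times> {0<..<\<epsilon>}) \<subseteq> V"
    and Gn: "\<forall>\<theta>\<in>{- pi..0}. \<forall>\<rho>\<in>{0<..<\<epsilon>}. G \<theta> \<rho> \<noteq> 0"
    and orb: "\<forall>S\<subseteq>{- pi..0} \<times> {0<..<\<epsilon>}. solution_arc (\<lambda>\<theta> \<rho>. F \<theta> \<rho> / G \<theta> \<rho>) S \<longleftrightarrow>
         orbit_arc Y (g ` weighted_polar k l ` S)"
    by (elim exE conjE) (rule that)
  \<comment> \<open>The sign of the slope is put into the numerator. The explicit factors
    \<open>- 1\<close> and \<open>1\<close> are the values of \<open>a\<close> in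
    \<open>real_analytic_on_reflect\<close>.\<close>
  let ?R = "\<lambda>\<theta> \<rho>. F \<theta> \<rho> / G \<theta> \<rho>" and ?R' = "\<lambda>\<theta> \<rho>. (- 1 * F (- \<theta>) \<rho>) / (1 * G (- \<theta>) \<rho>)"
  have R': "(\<lambda>\<theta> \<rho>. - ?R (- \<theta>) \<rho>) = ?R'" "(\<lambda>\<theta> \<rho>. - ?R' (- \<theta>) \<rho>) = ?R" by (auto simp: fun_eq_iff)
  have arc: "solution_arc ?R' S \<longleftrightarrow> orbit_arc Y ((g \<circ> refl_axis) ` weighted_polar k l ` S)"
    if S: "S \<subseteq> {0..pi} \<times> {0<..<\<epsilon>}" for S
  proof -
    have "refl_angle ` S \<subseteq> {- pi..0} \<times> {0<..<\<epsilon>}" using S by (auto simp: refl_angle_def)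
    then have "solution_arc ?R (refl_angle ` S) \<longleftrightarrow> orbit_arc Y (g ` weighted_polar k l ` refl_angle ` S)"
      using orb by blast
    moreover have "solution_arc ?R' S \<longleftrightarrow> solution_arc ?R (refl_angle ` S)"
      using solution_arc_reflect[of ?R' S, unfolded R'] solution_arc_reflect[of ?R "refl_angle ` S", unfolded R']
      by (auto simp: image_image)
    moreover have "g ` weighted_polar k l ` refl_angle ` S = (g \<circ> refl_axis) ` weighted_polar k l ` S"
      by (simp add: image_image weighted_polar_refl_angle)
    ultimately show ?thesis by simp
  qed
  have "weighted_polar k l w \<in> refl_axis -` V" if "w \<in> {0..pi} \<times> {0<..<\<epsilon>}" for w
  proof -
    have "refl_angle w \<in> {- pi..0} \<times> {0<..<\<epsilon>}" using that by (auto simp: refl_angle_def)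
    then show ?thesis using sub by (auto simp: weighted_polar_refl_angle[symmetric])
  qed
  then show ?thesis
    unfolding polar_equivalent_def using \<epsilon> arc FG0 Gn
    by - (rule exI[of _ "\<lambda>\<theta> \<rho>. - 1 * F (- \<theta>) \<rho>"], rule exI[of _ "\<lambda>\<theta> \<rho>. 1 * G (- \<theta>) \<rho>"],
        intro conjI real_analytic_on_reflect F G exI[of _ \<epsilon>], auto)
qed

lemma homeomorphism_reflect:
  assumes "homeomorphism U V h g"
  shows "homeomorphism U (refl_axis -` V) (refl_axis \<circ> h) (g \<circ> refl_axis)"
proof (rule homeomorphism_compose[OF assms])
  show "homeomorphism V (refl_axis -` V) refl_axis refl_axis"
    by (rule homeomorphismI) (auto intro!: continuous_on_refl_axis)
qed

text \<open>Crossing arcs carry no orientation, so the lower arc might seem to run from the start of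
  the upper arc to its end. The upper arc makes \<open>lie Xp f\<close> nonnegative at its start and
  nonpositive at its end; sewing turns this into strict signs of \<open>lie Xm f\<close>, and these
  are incompatible with a lower arc in that direction.\<close>

lemma closed_crossing_orbit_of_arcs:
  assumes grad: "\<And>z. GDERIV f z :> gradient f z"
    and Ap: "crossing_arc Xp f h Ap x (- y)"
    and Am: "crossing_arc Xm (\<lambda>z. - f z) (refl_axis \<circ> h) Am x (- y)"
    and xy: "x > 0" "y > 0" and AN: "Ap \<subseteq> N" "Am \<subseteq> N" and inj: "inj_on h N"
    and sgn: "\<And>z. z \<in> N \<Longrightarrow> sgn (snd (h z)) = sgn (f z)" and p0: "h p0 = (0, 0)"
    and sew: "\<And>z. z \<in> N \<Longrightarrow> f z = 0 \<Longrightarrow> z \<noteq> p0 \<Longrightarrow> z \<in> sewing f Xp Xm"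
  shows "closed_crossing_orbit f Xp Xm (Ap \<union> Am)"
proof -
  obtain a b \<gamma> where ab: "a < b" and \<gamma>: "regular_trajectory Xp {a..b} \<gamma>" and Aeq: "Ap = \<gamma> ` {a..b}"
    and \<gamma>pos: "\<gamma> ` {a<..<b} \<subseteq> pos_side f"
    and \<gamma>ends: "h (\<gamma> a) = (x, 0) \<and> h (\<gamma> b) = (- y, 0) \<or> h (\<gamma> a) = (- y, 0) \<and> h (\<gamma> b) = (x, 0)"
    using Ap unfolding crossing_arc_def by blast
  obtain c d \<mu> where cd: "c < d" and \<mu>: "regular_trajectory Xm {c..d} \<mu>" and Meq: "Am = \<mu> ` {c..d}"
    and \<mu>neg: "\<mu> ` {c<..<d} \<subseteq> pos_side (\<lambda>z. - f z)"
    and \<mu>ends': "refl_axis (h (\<mu> c)) = (x, 0) \<and> refl_axis (h (\<mu> d)) = (- y, 0) \<or>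
      refl_axis (h (\<mu> c)) = (- y, 0) \<and> refl_axis (h (\<mu> d)) = (x, 0)"
    using Am unfolding crossing_arc_def by auto
  have refl: "refl_axis z = (u, 0) \<longleftrightarrow> z = (u, 0)" for z u
    by (cases z) (auto simp: refl_axis_def)
  note \<mu>ends = \<mu>ends'[unfolded refl]
  have inN: "\<gamma> a \<in> N" "\<gamma> b \<in> N" "\<mu> c \<in> N" "\<mu> d \<in> N"
    using AN ab cd by (auto simp: Aeq Meq)
  have zero: "f z = 0 \<and> z \<noteq> p0" if "z \<in> N" "h z = (u, 0)" "u = x \<or> u = - y" for z u
    using sgn[OF that(1)] that xy p0 by (auto simp: sgn_zero_iff eq_commute[of 0])
  have f0: "f (\<gamma> a) = 0" "f (\<gamma> b) = 0" "f (\<mu> c) = 0" "f (\<mu> d) = 0"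
    using \<gamma>ends \<mu>ends zero inN by metis+
  have sew2: "\<gamma> a \<in> sewing f Xp Xm" "\<gamma> b \<in> sewing f Xp Xm"
    using \<gamma>ends zero inN sew by metis+
  have ne: "\<gamma> a \<noteq> \<gamma> b" using \<gamma>ends xy by auto
  have "0 \<le> 1 * lie Xp f (\<gamma> a)" "1 * lie Xp f (\<gamma> b) \<le> 0"
    by (rule lie_sign_at_ends[OF grad ab \<gamma>]; use \<gamma>pos f0 in \<open>auto simp: pos_side_def image_subset_iff less_imp_le\<close>)+
  then have la: "lie Xm f (\<gamma> a) > 0" and lb: "lie Xm f (\<gamma> b) < 0"
    using sew2 by (auto simp: sewing_def zero_less_mult_iff)
  have lcd: "0 \<le> - 1 * lie Xm f (\<mu> c)" "- 1 * lie Xm f (\<mu> d) \<le> 0"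
    by (rule lie_sign_at_ends[OF grad cd \<mu>]; use \<mu>neg f0 in \<open>auto simp: pos_side_def image_subset_iff less_imp_le\<close>)+
  have "\<mu> c = \<gamma> a \<and> \<mu> d = \<gamma> b \<or> \<mu> c = \<gamma> b \<and> \<mu> d = \<gamma> a"
    using \<gamma>ends \<mu>ends inN inj by (metis inj_onD)
  then have m: "\<mu> c = \<gamma> b" "\<mu> d = \<gamma> a" using la lb lcd by auto
  have "\<mu> ` {c<..<d} \<subseteq> neg_side f" using \<mu>neg by (auto simp: pos_side_def neg_side_def)
  then show ?thesis
    unfolding closed_crossing_orbit_def Aeq Meq using ne sew2 ab \<gamma> \<gamma>pos cd \<mu> m by blast
qed

text \<open>If the function is nonzero somewhere, a zero at the centre is isolated, and a nonzero
  value there persists nearby by continuity. The centre itself is left out because only positive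
  zeros stand for orbits.\<close>

lemma zero_free_or_identically_zero:
  assumes hol: "D holomorphic_on ball 0 \<eta>" and \<eta>: "\<eta> > 0"
  obtains \<delta> where "0 < \<delta>" "\<delta> \<le> \<eta>"
    "(\<forall>u \<in> ball 0 \<eta>. D u = 0) \<or> (\<forall>u \<in> ball 0 \<delta> - {0}. D u \<noteq> 0)"
proof (cases "\<forall>u \<in> ball 0 \<eta>. D u = 0")
  case True
  then show thesis using that[of \<eta>] \<eta> by auto
next
  case False
  then obtain \<beta> where \<beta>: "\<beta> \<in> ball 0 \<eta>" "D \<beta> \<noteq> 0" by blast
  have "\<exists>r>0. \<forall>u \<in> ball 0 r - {0}. u \<in> ball 0 \<eta> \<longrightarrow> D u \<noteq> 0"
  proof (cases "D 0 = 0")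
    case True
    then show ?thesis
      using isolated_zeros[OF hol open_ball connected_ball _ _ \<beta>, of 0] \<eta> by (metis centre_in_ball)
  next
    case False
    have "open {u \<in> ball 0 \<eta>. D u \<in> - {0}}"
      using continuous_open_preimage[OF holomorphic_on_imp_continuous_on[OF hol] open_ball, of "- {0}"]
      by (auto simp: vimage_def Int_def)
    then obtain r where "r > 0" "ball 0 r \<subseteq> {u \<in> ball 0 \<eta>. D u \<in> - {0}}"
      using False \<eta> by (metis (mono_tags, lifting) ComplI centre_in_ball mem_Collect_eq open_contains_ball singletonD)
    then show ?thesis by blast
  qed
  then obtain r where r: "r > 0" "\<forall>u \<in> ball 0 r - {0}. u \<in> ball 0 \<eta> \<longrightarrow> D u \<noteq> 0" by blast
  show thesis by (rule that[of "min r \<eta>"]) (use r \<eta> in auto)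
qed

theorem corollary14:
  fixes f :: "real \<times> real \<Rightarrow> real"
    and Xp Xm :: "real \<times> real \<Rightarrow> real \<times> real"
    and p0 :: "real \<times> real"
  assumes "real_analytic_on f UNIV"
    and "zero_regular_value f"
    and "analytic_vector_field Xp"
    and "analytic_vector_field Xm"
    and "sigma_monodromic f Xp Xm p0"
    and "hypothesis_H f Xp Xm p0"
  shows "\<exists>N. open N \<and> p0 \<in> N \<and> \<not> (\<exists>C. crossing_limit_cycle f Xp Xm C \<and> C \<subseteq> N)"
proof -
  have grad: "GDERIV f z :> gradient f z" for z
    using assms(1) by (rule real_analytic_has_gradient) simp
  have p0_singular: "p0 \<in> switching f" "p0 \<notin> sewing f Xp Xm"
    using assms(5) by (auto simp: sigma_monodromic_def isolated_sigma_singular_def sigma_singular_def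
        sigma_regular_def)
  obtain N0 where N0: "open N0" "p0 \<in> N0"
    and sew: "\<And>z. z \<in> N0 \<Longrightarrow> f z = 0 \<Longrightarrow> z \<noteq> p0 \<Longrightarrow> z \<in> sewing f Xp Xm"
    using sewing_near_monodromic[OF assms(5)] by blast
  obtain U V h g p q r s where U: "open U" "p0 \<in> U" and V: "open V"
    and hom: "homeomorphism U V h g" and hp0: "h p0 = (0, 0)"
    and sgn_all: "\<forall>z \<in> U. sgn (snd (h z)) = sgn (f z)"
    and pos: "p > 0" "q > 0" "r > 0" "s > 0"
    and pe: "polar_equivalent Xp g V {0..pi} p r" "polar_equivalent Xm g V {- pi..0} q s"
    using assms(6) unfolding hypothesis_H_def by (elim exE conjE) (rule that)
  note sgn = sgn_all[rule_format]
  have hinj: "inj_on h U"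
    using hom unfolding homeomorphism_def by (metis inj_on_inverseI)
  have hom': "homeomorphism U (refl_axis -` V) (refl_axis \<circ> h) (g \<circ> refl_axis)"
    by (rule homeomorphism_reflect[OF hom])
  have V': "open (refl_axis -` V)" by (rule open_vimage[OF V continuous_on_refl_axis])
  have hp0': "(refl_axis \<circ> h) p0 = (0, 0)" by (simp add: hp0 refl_axis_def)
  have sgn': "sgn (snd ((refl_axis \<circ> h) z)) = sgn (- f z)" if "z \<in> U" for z
    using sgn[OF that] by (simp add: refl_axis_def case_prod_unfold sgn_minus)
  have refl: "refl_axis z = (u, 0) \<longleftrightarrow> z = (u, 0)" for z u
    by (cases z) (auto simp: refl_axis_def)
  obtain \<eta>p P retp where \<eta>p: "\<eta>p > 0" and P: "P holomorphic_on ball 0 \<eta>p"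
    and P_ret: "\<And>\<rho>. \<rho> \<in> {0<..<\<eta>p} \<Longrightarrow> P (complex_of_real \<rho>) = of_real (retp \<rho>)"
    and retp: "\<And>\<rho>. \<rho> \<in> {0<..<\<eta>p} \<Longrightarrow> retp \<rho> > 0"
    and arcs_p: "\<And>e. 0 < e \<Longrightarrow> e \<le> \<eta>p \<Longrightarrow> \<exists>N. open N \<and> p0 \<in> N \<and> radial_arcs Xp f h p0 p retp e N"
    using half_return_map[OF hom U(1) V U(2) hp0 sgn pos(1,3) pe(1)] by blast
  obtain \<eta>m Q retm where \<eta>m: "\<eta>m > 0" and Q: "Q holomorphic_on ball 0 \<eta>m"
    and Q_ret: "\<And>\<rho>. \<rho> \<in> {0<..<\<eta>m} \<Longrightarrow> Q (complex_of_real \<rho>) = of_real (retm \<rho>)"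
    and retm: "\<And>\<rho>. \<rho> \<in> {0<..<\<eta>m} \<Longrightarrow> retm \<rho> > 0"
    and arcs_m: "\<And>e. 0 < e \<Longrightarrow> e \<le> \<eta>m \<Longrightarrow>
       \<exists>N. open N \<and> p0 \<in> N \<and> radial_arcs Xm (\<lambda>z. - f z) (refl_axis \<circ> h) p0 q retm e N"
    using half_return_map[where f = "\<lambda>z. - f z", OF hom' U(1) V' U(2) hp0' sgn' pos(2,4)
          polar_equivalent_reflect[OF pe(2)]] by blast
  text \<open>A point of the switching curve at first coordinate \<open>u ^ (p * q)\<close> has radius \<open>u ^ q\<close> in the upper
    and \<open>u ^ p\<close> in the lower polar coordinates, so \<open>D\<close> compares the two half-return maps.\<close>
  define D where "D u = P (u ^ q) ^ p - Q (u ^ p) ^ q" for u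
  \<comment> \<open>The bound \<open>1\<close> makes positive powers no larger than their base, so
    \<open>u ^ q\<close> and \<open>u ^ p\<close> stay in the discs of \<open>P\<close> and
    \<open>Q\<close>.\<close>
  define \<eta> where "\<eta> = min 1 (min \<eta>p \<eta>m)"
  have \<eta>: "\<eta> > 0" "\<eta> \<le> 1" "\<eta> \<le> \<eta>p" "\<eta> \<le> \<eta>m" using \<eta>p \<eta>m by (auto simp: \<eta>_def)
  have pw: "x ^ n \<le> x" if "0 \<le> x" "x \<le> 1" "n > 0" for x :: real and n
    using power_decreasing[of 1 n x] that by simp
  have pw_ball: "(\<lambda>u. u ^ n) ` ball (0::complex) \<eta> \<subseteq> ball 0 d" if "n > 0" "\<eta> \<le> d" for n d
  proof (rule image_subsetI)
    fix u :: complex assume "u \<in> ball 0 \<eta>"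
    then show "u ^ n \<in> ball 0 d" using pw[of "norm u" n] that \<eta>(2) by (simp add: norm_power)
  qed
  have "(P \<circ> (\<lambda>u. u ^ q)) holomorphic_on ball 0 \<eta>"
    by (rule holomorphic_on_compose_gen[OF _ P pw_ball]) (use pos \<eta> in \<open>auto intro!: holomorphic_intros\<close>)
  moreover have "(Q \<circ> (\<lambda>u. u ^ p)) holomorphic_on ball 0 \<eta>"
    by (rule holomorphic_on_compose_gen[OF _ Q pw_ball]) (use pos \<eta> in \<open>auto intro!: holomorphic_intros\<close>)
  ultimately have D: "D holomorphic_on ball 0 \<eta>"
    unfolding D_def by (auto simp: o_def intro!: holomorphic_intros)
  have Dreal: "D (complex_of_real u) = of_real (retp (u ^ q) ^ p - retm (u ^ p) ^ q)"
    and urange: "u ^ q \<in> {0<..<\<eta>p}" "u ^ p \<in> {0<..<\<eta>m}" if "0 < u" "u < \<eta>" for u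
  proof -
    show "u ^ q \<in> {0<..<\<eta>p}" "u ^ p \<in> {0<..<\<eta>m}"
      using pw[of u q] pw[of u p] that pos \<eta> by auto
    then show "D (complex_of_real u) = of_real (retp (u ^ q) ^ p - retm (u ^ p) ^ q)"
      using P_ret[of "u ^ q"] Q_ret[of "u ^ p"] by (simp add: D_def)
  qed
  obtain \<delta> where \<delta>: "0 < \<delta>" "\<delta> \<le> \<eta>"
    and dich: "(\<forall>u \<in> ball 0 \<eta>. D u = 0) \<or> (\<forall>u \<in> ball 0 \<delta> - {0}. D u \<noteq> 0)"
    using zero_free_or_identically_zero[OF D \<eta>(1)] by blast
  \<comment> \<open>An upper radius below \<open>\<delta> ^ q\<close> means
    \<open>u < \<delta>\<close> for \<open>\<rho> = u ^ q\<close>: every closed orbit in the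
    neighbourhood then belongs to a zero of \<open>D\<close> in the disc of the dichotomy.\<close>
  obtain Np where Np: "open Np" "p0 \<in> Np" and arc_p: "radial_arcs Xp f h p0 p retp (min \<eta>p (\<delta> ^ q)) Np"
    using arcs_p[of "min \<eta>p (\<delta> ^ q)"] \<delta>(1) \<eta>p by auto
  obtain Nm where Nm: "open Nm" "p0 \<in> Nm"
    and arc_m: "radial_arcs Xm (\<lambda>z. - f z) (refl_axis \<circ> h) p0 q retm \<eta>m Nm"
    using arcs_m[of \<eta>m] \<eta>m by auto
  define N where "N = U \<inter> N0 \<inter> Np \<inter> Nm"
  have N: "open N" "p0 \<in> N" using U N0 Np Nm by (auto simp: N_def)
  have False if C: "crossing_limit_cycle f Xp Xm C" "C \<subseteq> N" for C
  proof -
    obtain W where W: "open W" "C \<subseteq> W"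
      and isol: "\<And>C'. closed_crossing_orbit f Xp Xm C' \<Longrightarrow> C' \<subseteq> W \<Longrightarrow> C' = C"
      using C(1) unfolding crossing_limit_cycle_def by blast
    have "closed_crossing_orbit f Xp Xm C" using C(1) by (simp add: crossing_limit_cycle_def)
    then obtain p1 p2 a b \<gamma> c d \<mu> where ne: "p1 \<noteq> p2" and sw: "{p1, p2} \<subseteq> sewing f Xp Xm"
      and ab: "a < b" and \<gamma>: "regular_trajectory Xp {a..b} \<gamma>" "\<gamma> a = p1" "\<gamma> b = p2"
      and \<gamma>pos: "\<gamma> ` {a<..<b} \<subseteq> pos_side f"
      and cd: "c < d" and \<mu>: "regular_trajectory Xm {c..d} \<mu>" "\<mu> c = p2" "\<mu> d = p1"
      and \<mu>neg: "\<mu> ` {c<..<d} \<subseteq> neg_side f"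
      and Ceq: "C = \<gamma> ` {a..b} \<union> \<mu> ` {c..d}"
      unfolding closed_crossing_orbit_def by (elim exE conjE) (rule that)
    have f12: "f p1 = 0" "f p2 = 0" using sw by (auto simp: sewing_def switching_def)
    have zeros: "z = p1 \<or> z = p2" if "z \<in> C" "f z = 0" for z
    proof -
      from \<open>z \<in> C\<close> consider t where "t \<in> {a..b}" "z = \<gamma> t" | t where "t \<in> {c..d}" "z = \<mu> t"
        unfolding Ceq by blast
      then show ?thesis
      proof cases
        case 1
        then have "t = a \<or> t = b"
          using subsetD[OF \<gamma>pos imageI, of t] \<open>f z = 0\<close> by (cases "t = a \<or> t = b") (auto simp: pos_side_def)
        then show ?thesis using \<gamma>(2,3) 1 by blast
      next
        case 2
        then have "t = c \<or> t = d"
          using subsetD[OF \<mu>neg imageI, of t] \<open>f z = 0\<close> by (cases "t = c \<or> t = d") (auto simp: neg_side_def)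
        then show ?thesis using \<mu>(2,3) 2 by blast
      qed
    qed
    have p0C: "p0 \<notin> C"
      using zeros[of p0] p0_singular sw by (auto simp: switching_def)
    have sub: "\<gamma> ` {a..b} \<subseteq> W \<inter> N" "\<mu> ` {c..d} \<subseteq> W \<inter> N" using C(2) W(2) by (auto simp: Ceq)
    have \<mu>neg': "\<mu> ` {c<..<d} \<subseteq> pos_side (\<lambda>z. - f z)" using \<mu>neg by (auto simp: pos_side_def neg_side_def)
    have oWN: "open (W \<inter> N)" using W(1) N(1) by (rule open_Int)
    have "\<gamma> ` {a..b} \<subseteq> Np" "\<mu> ` {c..d} \<subseteq> Nm" "p0 \<notin> \<gamma> ` {a..b}" "p0 \<notin> \<mu> ` {c..d}"
      using sub p0C by (auto simp: N_def Ceq)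
    note in_p = arc_p[unfolded radial_arcs_def, rule_format, OF ab \<gamma>(1) this(1) this(3), unfolded \<gamma>(2,3)]
      and in_m = arc_m[unfolded radial_arcs_def, rule_format, OF cd \<mu>(1) this(2) this(4), unfolded \<mu>(2,3)]
    from in_p[OF f12 ne \<gamma>pos] obtain \<rho> where \<rho>_in: "\<rho> \<in> {0<..<min \<eta>p (\<delta> ^ q)}"
      and ends_p: "h p1 = (\<rho> ^ p, 0) \<and> h p2 = (- (retp \<rho> ^ p), 0) \<or>
        h p1 = (- (retp \<rho> ^ p), 0) \<and> h p2 = (\<rho> ^ p, 0)"
      and near_p: "\<forall>W. open W \<longrightarrow> \<gamma> ` {a..b} \<subseteq> W \<longrightarrow>
        (\<forall>\<^sub>F \<rho>' in nhds \<rho>. \<exists>A \<subseteq> W. crossing_arc Xp f h A (\<rho>' ^ p) (- (retp \<rho>' ^ p)))"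
      by (elim bexE conjE) (rule that)
    have "- f p2 = 0" "- f p1 = 0" using f12 by simp_all
    from in_m[OF this ne[symmetric] \<mu>neg'] obtain \<rho>' where \<rho>'_in: "\<rho>' \<in> {0<..<\<eta>m}"
      and ends_m': "(refl_axis \<circ> h) p2 = (\<rho>' ^ q, 0) \<and> (refl_axis \<circ> h) p1 = (- (retm \<rho>' ^ q), 0) \<or>
        (refl_axis \<circ> h) p2 = (- (retm \<rho>' ^ q), 0) \<and> (refl_axis \<circ> h) p1 = (\<rho>' ^ q, 0)"
      and near_m: "\<forall>W. open W \<longrightarrow> \<mu> ` {c..d} \<subseteq> W \<longrightarrow> (\<forall>\<^sub>F \<rho>'' in nhds \<rho>'. \<exists>A \<subseteq> W.
        crossing_arc Xm (\<lambda>z. - f z) (refl_axis \<circ> h) A (\<rho>'' ^ q) (- (retm \<rho>'' ^ q)))"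
      by (elim bexE conjE) (rule that)
    note ends_m = ends_m'[unfolded o_apply refl]
      and pert_p = near_p[rule_format, OF oWN sub(1)] and pert_m = near_m[rule_format, OF oWN sub(2)]
    have \<rho>: "0 < \<rho>" "\<rho> < \<delta> ^ q" "\<rho> < \<eta>p" and \<rho>': "0 < \<rho>'" "\<rho>' < \<eta>m" using \<rho>_in \<rho>'_in by auto
    have rpos: "0 < \<rho> ^ p" "0 < \<rho>' ^ q" "0 < retp \<rho> ^ p" "0 < retm \<rho>' ^ q"
      using \<rho> \<rho>' retp[of \<rho>] retm[of \<rho>'] by auto
    \<comment> \<open>The two arcs share their end points. One of these has positive and the other
      negative first coordinate, so the starting and the final radii are matched without regard to
      orientation.\<close>
    have match: "\<rho> ^ p = \<rho>' ^ q" "retp \<rho> ^ p = retm \<rho>' ^ q"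
      using ends_p ends_m rpos by auto
    \<comment> \<open>With this \<open>u\<close> the upper radius is \<open>u ^ q\<close>, and the
      matching of first coordinates forces the lower radius to be \<open>u ^ p\<close>.\<close>
    define u where "u = root q \<rho>"
    have uq: "u ^ q = \<rho>" and u0: "0 < u" using \<rho> pos by (simp_all add: u_def)
    have "u < \<delta>"
    proof (rule ccontr)
      assume "\<not> u < \<delta>"
      then have "\<delta> ^ q \<le> u ^ q" using \<delta> by (intro power_mono) auto
      then show False using uq \<rho> by simp
    qed
    then have u: "u < \<eta>" using \<delta> by simp
    have "(u ^ p) ^ q = \<rho>' ^ q" by (metis match(1) mult.commute power_mult uq)
    then have up: "u ^ p = \<rho>'"
      using power_eq_iff_eq_base[of q "u ^ p" \<rho>'] pos u0 \<rho>' by simp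
    have "D (of_real u) = 0" using Dreal[OF u0 u] match by (simp add: uq up)
    moreover have "complex_of_real u \<in> ball 0 \<delta> - {0}" using u0 \<open>u < \<delta>\<close> by simp
    \<comment> \<open>The zero at \<open>u\<close> lies in the punctured disc, so only the
      alternative of identical vanishing is left.\<close>
    ultimately have D0: "\<forall>v \<in> ball 0 \<eta>. D v = 0" using dich by blast
    have lim: "filterlim (\<lambda>v. v ^ n) (nhds (u ^ n)) (at u)" for n :: nat
      by (intro tendsto_intros)
    have e1: "\<forall>\<^sub>F v in at u. v \<in> {0<..<\<eta>}"
      using u u0 by (intro eventually_at_in_open') auto
    have e2: "\<forall>\<^sub>F v in at u. v \<noteq> u" by (simp add: eventually_at_filter)
    have e3: "\<forall>\<^sub>F v in at u. \<exists>A \<subseteq> W \<inter> N. crossing_arc Xp f h A ((v ^ q) ^ p) (- (retp (v ^ q) ^ p))"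
      using pert_p lim[of q] unfolding uq by (rule eventually_compose_filterlim)
    have e4: "\<forall>\<^sub>F v in at u. \<exists>A \<subseteq> W \<inter> N.
        crossing_arc Xm (\<lambda>z. - f z) (refl_axis \<circ> h) A ((v ^ p) ^ q) (- (retm (v ^ p) ^ q))"
      using pert_m lim[of p] unfolding up by (rule eventually_compose_filterlim)
    \<comment> \<open>The punctured neighbourhood filter at \<open>u\<close> is nontrivial, so some
      \<open>v\<close> other than \<open>u\<close> admits both perturbed arcs inside
      \<open>W \<inter> N\<close>. As \<open>D\<close> also vanishes at \<open>v\<close>, these arcs
      close up.\<close>
    obtain v A1 A2 where v_in: "v \<in> {0<..<\<eta>}" and "v \<noteq> u" and A: "A1 \<subseteq> W \<inter> N" "A2 \<subseteq> W \<inter> N"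
      and A1: "crossing_arc Xp f h A1 ((v ^ q) ^ p) (- (retp (v ^ q) ^ p))"
      and A2: "crossing_arc Xm (\<lambda>z. - f z) (refl_axis \<circ> h) A2 ((v ^ p) ^ q) (- (retm (v ^ p) ^ q))"
      using eventually_happens'[OF at_neq_bot eventually_conj[OF eventually_conj[OF e1 e2] eventually_conj[OF e3 e4]]]
      by (elim exE conjE)
    then have v: "0 < v" "v < \<eta>" "v \<noteq> u" by auto
    have "D (of_real v) = 0" using D0 v by simp
    then have ret_eq: "retm (v ^ p) ^ q = retp (v ^ q) ^ p"
      using Dreal[OF v(1,2)] by (metis eq_iff_diff_eq_0 of_real_eq_0_iff)
    have v_eq: "(v ^ p) ^ q = (v ^ q) ^ p" by (simp add: power_mult[symmetric] mult.commute)
    have "closed_crossing_orbit f Xp Xm (A1 \<union> A2)"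
    proof (rule closed_crossing_orbit_of_arcs[OF grad A1 A2[unfolded ret_eq v_eq]])
      show "0 < (v ^ q) ^ p" using v by simp
      show "0 < retp (v ^ q) ^ p" using retp[OF urange(1)[OF v(1,2)]] by simp
      show "A1 \<subseteq> N" "A2 \<subseteq> N" using A by auto
      show "inj_on h N" by (rule inj_on_subset[OF hinj]) (auto simp: N_def)
      show "sgn (snd (h z)) = sgn (f z)" if "z \<in> N" for z using sgn that by (simp add: N_def)
      show "z \<in> sewing f Xp Xm" if "z \<in> N" "f z = 0" "z \<noteq> p0" for z
        using sew that by (simp add: N_def)
    qed (fact hp0)
    then have C': "A1 \<union> A2 = C" by (rule isol) (use A in auto)
    \<comment> \<open>The new orbit must equal \<open>C\<close> by isolation, but it crosses the
      switching curve at first coordinate \<open>(v ^ q) ^ p\<close>, while the only crossing of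
      \<open>C\<close> with positive first coordinate is at \<open>(u ^ q) ^ p\<close>.\<close>
    obtain z where z: "z \<in> A1" "h z = ((v ^ q) ^ p, 0)"
      using A1 unfolding crossing_arc_def by (metis atLeastAtMost_iff imageI less_imp_le order_refl)
    have "f z = 0"
      using sgn[of z] z A by (auto simp: N_def sgn_zero_iff eq_commute[of 0])
    then have "z = p1 \<or> z = p2" using zeros C' z by blast
    moreover have "0 < (v ^ q) ^ p" using v by simp
    ultimately have "(v ^ q) ^ p = (u ^ q) ^ p"
      using ends_p z(2) rpos unfolding uq by auto
    then have "v = u"
      using power_eq_iff_eq_base[of "q * p" v u] pos v u0 by (simp add: power_mult[symmetric])
    then show False using v by simp
  qed
  then show ?thesis using N by blast
qed

end
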